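(* Let $(R,\mathfrak m)$ be a Cohen-Macaulay local ring of positive dimension $d$ and let $I$ be an $\mathfrak m$-primary ideal of $R$. (1) Let $a_1,\ldots,a_{d-1}\in I$ and $x\in\mathfrak m$ be such that $a_1,\ldots,a_{d-1},x$ is a regular sequence in $R$ which is a Rees-superficial sequence for the multiset $(I^{[d-1]}\,|\,\mathfrak m^{[1]})$. Then $$f_0(I)=e_{d-1}(\mathfrak m|I)-\lim_{n\to\infty}\ell\left(\frac{\mathfrak m I^n}{xI^n+(a_1,\ldots,a_{d-1})\mathfrak m I^{n-1}}\right).$$ (2) Let $a_1,\ldots,a_d\in I$ be a regular sequence in $R$ which is a Rees-superficial sequence for the multiset $(I^{[d-1]}\,|\,\mathfrak m^{[1]})$. Then $$f_0(I)=e(I)-\lim_{n\to\infty}\ell\left(\frac{\mathfrak m I^n}{a_dI^n+(a_1,\ldots,a_{d-1})\mathfrak m I^{n-1}}\right).$$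
   Context: Local rings are Noetherian; $\ell$ denotes length. The fiber cone of $I$ is $F(I)=\bigoplus_{n\ge 0}I^n/\mathfrak m I^n$. For all large $n$, $\ell(I^n/\mathfrak m I^n)$ agrees with a polynomial of degree $d-1$ written as $f_0(I)\binom{n+d-1}{d-1}-f_1(I)\binom{n+d-2}{d-2}+\cdots+(-1)^{d-1}f_{d-1}(I)$; the integer $f_0(I)$ is the multiplicity of $F(I)$. $e(I)$ is the Hilbert-Samuel multiplicity of $I$. Mixed multiplicity: for $r,s$ large, $\ell(R/\mathfrak m^rI^s)$ agrees with a polynomial of total degree $d$ written as $\sum_{i+j\le d}e_{(i,j)}\binom{r+i}{i}\binom{s+j}{j}$ with integers $e_{(i,j)}$; one sets $e_{d-1}(\mathfrak m|I):=e_{(1,d-1)}$. Rees-superficial: let $I_1,\ldots,I_r$ be $\mathfrak m$-primary ideals of a local ring. An element $a\in I_1$ is Rees-superficial for $I_1,\ldots,I_r$ if for all large $n_1$ and all $n_2,\ldots,n_r\ge 0$, $(a)\cap I_1^{n_1}I_2^{n_2}\cdots I_r^{n_r}=(a)I_1^{n_1-1}I_2^{n_2}\cdots I_r^{n_r}$. A sequence $a_1,\ldots,a_r$ is Rees-superficial for $I_1,\ldots,I_r$ if for each $i=1,\ldots,r$ the image of $a_i$ in $R_{i-1}=R/(a_1,\ldots,a_{i-1})$ is Rees-superficial for the images of $I_i,\ldots,I_r$ in $R_{i-1}$. The multiset $(I^{[d-1]}|\mathfrak m^{[1]})$ is the list of $d$ ideals $I,\ldots,I,\mathfrak m$ with $I$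 occurring $d-1$ times followed by $\mathfrak m$. *)

theory Defs
  imports "HOL-Library.Extended_Real" "HOL-Algebra.Ideal_Product" "HOL-Algebra.QuotRing"
    "HOL-Algebra.Ring_Divisibility" "HOL-Algebra.Module"
begin

subsection \<open>Local rings\<close>

locale noetherian_local_ring = cring R + noetherian_ring R for R (structure) +
  fixes \<mm> :: "'a set"
  assumes maximal_iff: "maximalideal J R \<longleftrightarrow> J = \<mm>"

definition krull_dim :: "('a, 'b) ring_scheme \<Rightarrow> enat" where
  "krull_dim R = Sup {enat n | n.
     \<exists>P :: nat \<Rightarrow> 'a set. (\<forall>i\<le>n. primeideal (P i) R) \<and> (\<forall>i<n. P i \<subset> P (Suc i))}"

text \<open>Below, the image of \<open>a\<close> in \<open>R Quot J\<close> is the coset \<open>J +>\<^bsub>R\<^esub> a\<close>, and the image of an ideal \<open>I\<close> is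
  \<open>(\<lambda>y. J +>\<^bsub>R\<^esub> y) ` I\<close>.\<close>

definition nonzerodivisor :: "('a, 'b) ring_scheme \<Rightarrow> 'a \<Rightarrow> bool" where
  "nonzerodivisor R a \<longleftrightarrow> a \<in> carrier R \<and>
     (\<forall>y \<in> carrier R. a \<otimes>\<^bsub>R\<^esub> y = \<zero>\<^bsub>R\<^esub> \<longrightarrow> y = \<zero>\<^bsub>R\<^esub>)"

definition regular_sequence :: "('a, 'b) ring_scheme \<Rightarrow> 'a list \<Rightarrow> bool" where
  "regular_sequence R as \<longleftrightarrow> set as \<subseteq> carrier R \<and>
     (\<forall>i < length as. let J = genideal R (set (take i as)) in
        nonzerodivisor (R Quot J) (J +>\<^bsub>R\<^esub> as ! i)) \<and>
     genideal R (set as) \<noteq> carrier R"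

definition depth :: "('a, 'b) ring_scheme \<Rightarrow> 'a set \<Rightarrow> enat" where
  "depth R \<mm> = Sup {enat (length as) | as. set as \<subseteq> \<mm> \<and> regular_sequence R as}"

locale cohen_macaulay_local_ring = noetherian_local_ring +
  assumes depth_eq_dim: "depth R \<mm> = krull_dim R"

definition ideal_radical :: "('a, 'b) ring_scheme \<Rightarrow> 'a set \<Rightarrow> 'a set" where
  "ideal_radical R Q = {a \<in> carrier R. \<exists>n::nat. a [^]\<^bsub>R\<^esub> n \<in> Q}"

definition primary_ideal :: "('a, 'b) ring_scheme \<Rightarrow> 'a set \<Rightarrow> bool" where
  "primary_ideal R Q \<longleftrightarrow> ideal Q R \<and> Q \<noteq> carrier R \<and>
     (\<forall>a \<in> carrier R. \<forall>b \<in> carrier R. a \<otimes>\<^bsub>R\<^esub> b \<in> Q \<longrightarrow> a \<in> Q \<or> b \<in> ideal_radical R Q)"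

definition primary_to :: "('a, 'b) ring_scheme \<Rightarrow> 'a set \<Rightarrow> 'a set \<Rightarrow> bool" where
  "primary_to R P Q \<longleftrightarrow> primary_ideal R Q \<and> ideal_radical R Q = P"

text \<open>Powers and finite products of ideals are those of the monoid \<^const>\<open>ideals_set\<close>, whose
  multiplication is \<^const>\<open>ideal_prod\<close> and whose unit is \<open>carrier R\<close>.\<close>

abbreviation ideal_pow :: "('a, 'b) ring_scheme \<Rightarrow> 'a set \<Rightarrow> nat \<Rightarrow> 'a set" where
  "ideal_pow R I n \<equiv> I [^]\<^bsub>ideals_set R\<^esub> n"


subsection \<open>Length\<close>

definition module_length :: "('a, 'b) ring_scheme \<Rightarrow> ('a, 'c, 'd) module_scheme \<Rightarrow> enat" where
  "module_length R M = Sup {enat n | n.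
     \<exists>N :: nat \<Rightarrow> 'c set. (\<forall>i\<le>n. submodule (N i) R M) \<and> (\<forall>i<n. N i \<subset> N (Suc i))}"

definition ideal_module :: "('a, 'b) ring_scheme \<Rightarrow> 'a set \<Rightarrow> ('a, 'a) module" where
  "ideal_module R I = \<lparr>carrier = I, monoid.mult = (\<otimes>\<^bsub>R\<^esub>), monoid.one = \<one>\<^bsub>R\<^esub>,
     ring.zero = \<zero>\<^bsub>R\<^esub>, ring.add = (\<oplus>\<^bsub>R\<^esub>), module.smult = (\<otimes>\<^bsub>R\<^esub>)\<rparr>"

text \<open>The fields \<^const>\<open>monoid.mult\<close> and \<^const>\<open>monoid.one\<close> of a module record carry no information
  (\<^locale>\<open>module\<close> does not constrain them).\<close>

definition quotient_module :: "('a, 'c, 'd) module_scheme \<Rightarrow> 'c set \<Rightarrow> ('a, 'c set) module" where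
  "quotient_module M N = \<lparr>carrier = a_rcosets\<^bsub>M\<^esub> N, monoid.mult = undefined, monoid.one = undefined,
     ring.zero = N, ring.add = set_add M, module.smult = (\<lambda>r X. \<Union>x\<in>X. N +>\<^bsub>M\<^esub> (r \<odot>\<^bsub>M\<^esub> x))\<rparr>"

text \<open>The length of the \<open>R\<close>-module \<open>I / J\<close>, for ideals \<open>J \<subseteq> I\<close>.\<close>

definition quot_length :: "('a, 'b) ring_scheme \<Rightarrow> 'a set \<Rightarrow> 'a set \<Rightarrow> enat" where
  "quot_length R I J = module_length R (quotient_module (ideal_module R I) J)"


subsection \<open>Hilbert coefficients\<close>

text \<open>The parameter \<open>d\<close> stands for the dimension of \<open>R\<close>. In each case the coefficients are determined
  by the values at all large arguments, because the binomial coefficients involved form a basis of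
  the polynomials of the respective degree; this is what makes the definite descriptions below
  meaningful. The lengths are required to be finite at large arguments.\<close>

definition fiber_coeffs ::
  "('a, 'b) ring_scheme \<Rightarrow> 'a set \<Rightarrow> nat \<Rightarrow> 'a set \<Rightarrow> (nat \<Rightarrow> int) \<Rightarrow> bool" where
  "fiber_coeffs R \<mm> d I f \<longleftrightarrow> (\<forall>\<^sub>F n in sequentially. \<exists>l::nat.
     quot_length R (ideal_pow R I n) (ideal_prod R \<mm> (ideal_pow R I n)) = enat l \<and>
     int l = (\<Sum>i<d. (-1) ^ i * f i * int ((n + d - 1 - i) choose (d - 1 - i))))"

text \<open>\<open>f\<^sub>0(I)\<close>\<close>

definition fiber_multiplicity :: "('a, 'b) ring_scheme \<Rightarrow> 'a set \<Rightarrow> nat \<Rightarrow> 'a set \<Rightarrow> int" where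
  "fiber_multiplicity R \<mm> d I = (THE c. \<exists>f. fiber_coeffs R \<mm> d I f \<and> f 0 = c)"

definition hilbert_samuel_coeffs ::
  "('a, 'b) ring_scheme \<Rightarrow> nat \<Rightarrow> 'a set \<Rightarrow> (nat \<Rightarrow> int) \<Rightarrow> bool" where
  "hilbert_samuel_coeffs R d I e \<longleftrightarrow> (\<forall>\<^sub>F n in sequentially. \<exists>l::nat.
     quot_length R (carrier R) (ideal_pow R I n) = enat l \<and>
     int l = (\<Sum>i\<le>d. (-1) ^ i * e i * int ((n + d - 1 - i) choose (d - i))))"

text \<open>\<open>e(I)\<close>\<close>

definition hilbert_samuel_multiplicity :: "('a, 'b) ring_scheme \<Rightarrow> nat \<Rightarrow> 'a set \<Rightarrow> int" where
  "hilbert_samuel_multiplicity R d I = (THE c. \<exists>e. hilbert_samuel_coeffs R d I e \<and> e 0 = c)"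

definition mixed_coeffs ::
  "('a, 'b) ring_scheme \<Rightarrow> 'a set \<Rightarrow> nat \<Rightarrow> 'a set \<Rightarrow> (nat \<Rightarrow> nat \<Rightarrow> int) \<Rightarrow> bool" where
  "mixed_coeffs R \<mm> d I e \<longleftrightarrow> (\<exists>N. \<forall>r\<ge>N. \<forall>s\<ge>N. \<exists>l::nat.
     quot_length R (carrier R) (ideal_prod R (ideal_pow R \<mm> r) (ideal_pow R I s)) = enat l \<and>
     int l = (\<Sum>(i, j) \<in> {(i, j). i + j \<le> d}. e i j * int ((r + i) choose i) * int ((s + j) choose j)))"

text \<open>\<open>e\<^sub>d\<^sub>-\<^sub>1(\<mm>|I) = e\<^bsub>(1,d-1)\<^esub>\<close>\<close>

definition mixed_multiplicity :: "('a, 'b) ring_scheme \<Rightarrow> 'a set \<Rightarrow> nat \<Rightarrow> 'a set \<Rightarrow> int" where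
  "mixed_multiplicity R \<mm> d I = (THE c. \<exists>e. mixed_coeffs R \<mm> d I e \<and> e 1 (d - 1) = c)"


subsection \<open>Rees-superficial sequences\<close>

text \<open>\<open>I\<^sub>1\<^sup>n\<^sup>1 \<dots> I\<^sub>r\<^sup>n\<^sup>r\<close>, with \<open>I\<^sub>1\<close> at index \<open>0\<close> of the list\<close>

definition ideal_power_prod :: "('a, 'b) ring_scheme \<Rightarrow> 'a set list \<Rightarrow> (nat \<Rightarrow> nat) \<Rightarrow> 'a set" where
  "ideal_power_prod R Is n = (\<Otimes>\<^bsub>ideals_set R\<^esub> k \<in> {..<length Is}. ideal_pow R (Is ! k) (n k))"

text \<open>The bound \<open>N\<close> on the first exponent is uniform in the other exponents.\<close>

definition rees_superficial :: "('a, 'b) ring_scheme \<Rightarrow> 'a \<Rightarrow> 'a set list \<Rightarrow> bool" where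
  "rees_superficial R a Is \<longleftrightarrow> Is \<noteq> [] \<and> a \<in> Is ! 0 \<and>
     (\<exists>N. \<forall>n. n 0 \<ge> N \<longrightarrow>
        cgenideal R a \<inter> ideal_power_prod R Is n =
        ideal_prod R (cgenideal R a) (ideal_power_prod R Is (n(0 := n 0 - 1))))"

definition rees_superficial_sequence :: "('a, 'b) ring_scheme \<Rightarrow> 'a list \<Rightarrow> 'a set list \<Rightarrow> bool" where
  "rees_superficial_sequence R as Is \<longleftrightarrow> length as = length Is \<and>
     (\<forall>i < length as. let J = genideal R (set (take i as)) in
        rees_superficial (R Quot J) (J +>\<^bsub>R\<^esub> as ! i)
          (map (\<lambda>I. (\<lambda>y. J +>\<^bsub>R\<^esub> y) ` I) (drop i Is)))"

end

theory Submission
  imports Defs "HOL-Library.List_Lexorder"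
begin

text \<open>
  Write \<open>J\<^sub>i = (a\<^sub>1, \<dots>, a\<^sub>i)\<close> and \<open>b\<^sub>i(r, s) = \<ell>(R / (\<mm>\<^sup>r I\<^sup>s + J\<^sub>i))\<close>. Since \<open>a\<^sub>i\<^sub>+\<^sub>1\<close> is regular modulo \<open>J\<^sub>i\<close> and
  Rees-superficial, \<open>b\<^sub>i(r, s) - b\<^sub>i(r, s - 1) = b\<^sub>i\<^sub>+\<^sub>1(r, s)\<close> for all large \<open>s\<close> and all \<open>r\<close>. Every leading
  coefficient in question can therefore be read off in the one-dimensional ring \<open>R / J\<close>, where
  \<open>J = J\<^sub>d\<^sub>-\<^sub>1\<close>. There \<open>\<mm>\<^sup>r\<^sup>+\<^sup>1 = x \<mm>\<^sup>r\<close> for large \<open>r\<close>, so \<open>b(r + 1, s) - b(r, s) = c\<close> with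
  \<open>c = \<ell>(R / ((x) + J))\<close>; hence \<open>e\<^sub>d\<^sub>-\<^sub>1(\<mm>|I) = c\<close>, and \<open>e(I) = c\<close> if \<open>x \<in> I\<close>. Modulo \<open>J\<close>, multiplication
  by \<open>x\<close> gives \<open>\<ell>(I\<^sup>n / x I\<^sup>n) = c\<close>, so \<open>\<ell>(\<mm> I\<^sup>n / x I\<^sup>n) = c - f\<^sub>0(I)\<close> for large \<open>n\<close>; and this length is
  that of the module in the theorem because \<open>J \<inter> \<mm> I\<^sup>n = J \<mm> I\<^sup>n\<^sup>-\<^sup>1\<close> for large \<open>n\<close>.

  What remains is that the Hilbert functions are eventually polynomial of the expected degrees. Ordering
  monomials lexicographically, such a function is a sum \<open>\<Sum>\<^bsub>|\<alpha>| = n\<^esub> \<lambda>(\<alpha>)\<close> with \<open>\<lambda>\<close> antitone on \<open>\<nat>\<^sup>g\<close>,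
  and a sum of this kind bounded by a constant times \<open>(n + 1)\<^sup>D\<close> is eventually a polynomial of degree
  at most \<open>D\<close>.
\<close>

text \<open>The lexicographic summation argument alone only bounds degrees in terms of the number of
  generators. The correct degrees come from growth bounds, found from the one-dimensional end: if
  \<open>\<mm>^k \<subseteq> I\<close>, then \<open>(x)^(k n) \<subseteq> I^n\<close>, so
  \<open>b_l(0, n) \<le> k c n\<close>; passing back from \<open>J_(i+1)\<close> to
  \<open>J_i\<close> is a summation and raises the exponent by one. The inclusion
  \<open>I^(r+s) \<subseteq> \<mm>^r I^s\<close> extends the bound to rows and columns of
  \<open>b_i\<close>. Polynomiality in each variable separately does not yet give a polynomial in
  two variables. Summing in \<open>s\<close> leaves a summation constant that depends on
  \<open>r\<close>, and the row at one fixed \<open>s\<close> shows that it is polynomial in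
  \<open>r\<close>. That \<open>c\<close> is finite rests on the dimension: a regular sequence of
  length \<open>d\<close> lies in no prime but \<open>\<mm>\<close>, because a smaller prime would
  end a chain of length \<open>d\<close> that \<open>\<mm>\<close> prolongs to length
  \<open>d + 1\<close>. Hence \<open>(x) + J\<close> contains a power of \<open>\<mm>\<close>. The
  second formula comes from the same construction with \<open>x = a_d\<close>; then
  \<open>(x)^n \<subseteq> I^n\<close> fixes the slope of the Hilbert-Samuel function modulo
  \<open>J\<close>.\<close>

no_notation Sum_Type.Plus (infixr \<open><+>\<close> 65)

section \<open>Eventually polynomial functions\<close>

definition forward_diff :: "(nat \<Rightarrow> int) \<Rightarrow> nat \<Rightarrow> int" where
  "forward_diff h n = h (Suc n) - h n"

text \<open>Iterated differences describe eventual polynomials of degree at most \<open>D\<close>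
  without naming coefficients, so closure properties become inductions on \<open>D\<close>. The
  coefficients reappear in \<open>ev_poly_imp_binom_poly\<close>.\<close>

fun ev_poly :: "nat \<Rightarrow> (nat \<Rightarrow> int) \<Rightarrow> bool" where
  "ev_poly 0 h \<longleftrightarrow> (\<exists>c. \<forall>\<^sub>F n in sequentially. h n = c)"
| "ev_poly (Suc D) h \<longleftrightarrow> ev_poly D (forward_diff h)"

lemma ev_poly_cong:
  assumes "ev_poly D h" "\<forall>\<^sub>F n in sequentially. h n = h' n"
  shows "ev_poly D h'"
  using assms
proof (induction D arbitrary: h h')
  case 0
  then obtain c where "\<forall>\<^sub>F n in sequentially. h n = c" by auto
  with 0(2) have "\<forall>\<^sub>F n in sequentially. h' n = c" by eventually_elim simp
  then show ?case by auto
next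
  case (Suc D)
  have "\<forall>\<^sub>F n in sequentially. h (Suc n) = h' (Suc n)"
    using Suc.prems(2) by (simp add: eventually_sequentially_Suc[of "\<lambda>n. h n = h' n"])
  with Suc.prems(2) have "\<forall>\<^sub>F n in sequentially. forward_diff h n = forward_diff h' n"
    by eventually_elim (simp add: forward_diff_def)
  with Suc show ?case by auto
qed

lemma ev_poly_add:
  assumes "ev_poly D f" "ev_poly D g"
  shows "ev_poly D (\<lambda>n. f n + g n)"
  using assms
proof (induction D arbitrary: f g)
  case 0
  then obtain a b where "\<forall>\<^sub>F n in sequentially. f n = a" "\<forall>\<^sub>F n in sequentially. g n = b" by auto
  then have "\<forall>\<^sub>F n in sequentially. f n + g n = a + b" by eventually_elim simp
  then show ?case by auto
next
  case (Suc D)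
  have "forward_diff (\<lambda>n. f n + g n) = (\<lambda>n. forward_diff f n + forward_diff g n)"
    by (auto simp: forward_diff_def)
  with Suc show ?case by auto
qed

lemma ev_poly_cmult: "ev_poly D f \<Longrightarrow> ev_poly D (\<lambda>n. c * f n)"
proof (induction D arbitrary: f)
  case 0
  then obtain a where "\<forall>\<^sub>F n in sequentially. f n = a" by auto
  then have "\<forall>\<^sub>F n in sequentially. c * f n = c * a" by eventually_elim simp
  then show ?case by (subst ev_poly.simps) blast
next
  case (Suc D)
  have "forward_diff (\<lambda>n. c * f n) = (\<lambda>n. c * forward_diff f n)"
    by (auto simp: forward_diff_def algebra_simps)
  with Suc show ?case by auto
qed

lemma ev_poly_diff:
  assumes "ev_poly D f" "ev_poly D g"
  shows "ev_poly D (\<lambda>n. f n - g n)"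
  using ev_poly_add[OF assms(1) ev_poly_cmult[OF assms(2), of "-1"]] by simp

lemma ev_poly_const: "ev_poly D (\<lambda>n. c)"
proof (induction D arbitrary: c)
  case (Suc D)
  have "forward_diff (\<lambda>n. c) = (\<lambda>n. 0)" by (auto simp: forward_diff_def)
  with Suc show ?case by simp
qed auto

lemma ev_poly_sum:
  assumes "finite A" "\<And>k. k \<in> A \<Longrightarrow> ev_poly D (f k)"
  shows "ev_poly D (\<lambda>n. \<Sum>k\<in>A. f k n)"
  using assms by (induction A rule: finite_induct) (auto intro: ev_poly_const ev_poly_add)

lemma ev_poly_Suc_shift: "ev_poly D (\<lambda>n. h (Suc n)) \<longleftrightarrow> ev_poly D h"
proof (induction D arbitrary: h)
  case 0
  show ?case by (simp add: eventually_sequentially_Suc[of "\<lambda>n. h n = _"])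
next
  case (Suc D)
  have "forward_diff (\<lambda>n. h (Suc n)) = (\<lambda>n. forward_diff h (Suc n))"
    by (auto simp: forward_diff_def)
  with Suc show ?case by auto
qed

lemma ev_poly_shift: "ev_poly D (\<lambda>n. h (n + k)) \<longleftrightarrow> ev_poly D h"
proof (induction k)
  case (Suc k)
  then show ?case using ev_poly_Suc_shift[of D "\<lambda>n. h (n + k)"] by simp
qed simp

lemma ev_poly_minus_shift: "ev_poly D h \<Longrightarrow> ev_poly D (\<lambda>n. h (n - k))"
  using ev_poly_shift[of D "\<lambda>n. h (n - k)" k] by simp

lemma ev_poly_forward_diff: "ev_poly D h \<Longrightarrow> ev_poly D (forward_diff h)"
  using ev_poly_diff[of D "\<lambda>n. h (Suc n)" h] ev_poly_Suc_shift[of D h]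
  by (simp add: forward_diff_def[abs_def])

section \<open>Integer-valued polynomials in the binomial basis\<close>

definition binom_poly :: "(nat \<Rightarrow> int) \<Rightarrow> nat \<Rightarrow> nat \<Rightarrow> int" where
  "binom_poly c D n = (\<Sum>i\<le>D. c i * int ((n + i) choose i))"

text \<open>Pascal's rule: in this basis a difference merely shifts the coefficients down. The rule
  produces the argument \<open>Suc n\<close> on the right.\<close>

lemma forward_diff_binom_poly:
  "forward_diff (binom_poly c (Suc D)) n = binom_poly (\<lambda>i. c (Suc i)) D (Suc n)"
proof -
  have "binom_poly c (Suc D) m = c 0 + (\<Sum>i\<le>D. c (Suc i) * int ((m + Suc i) choose Suc i))" for m
    unfolding binom_poly_def by (subst sum.atMost_Suc_shift) simp
  then show ?thesis
    by (simp add: forward_diff_def binom_poly_def[of _ D] algebra_simps del: sum.atMost_Suc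
        flip: sum_subtractf)
qed

lemma ev_poly_binom_poly: "ev_poly D (binom_poly c D)"
proof (induction D arbitrary: c)
  case 0
  then show ?case by (auto simp: binom_poly_def)
next
  case (Suc D)
  have "forward_diff (binom_poly c (Suc D)) = (\<lambda>n. binom_poly (\<lambda>i. c (Suc i)) D (Suc n))"
    by (rule ext) (rule forward_diff_binom_poly)
  then show ?case using Suc ev_poly_Suc_shift by simp
qed

text \<open>Summation shifts the coefficients up, so the leading one survives and only the constant
  \<open>k\<close> is new. This is how leading coefficients travel from the one-dimensional quotient
  back to the ring itself.\<close>

lemma binom_poly_antidiff:
  assumes "\<forall>\<^sub>F n in sequentially. h (Suc n) - h n = binom_poly c D (Suc n)"
  shows "\<exists>k. \<forall>\<^sub>F n in sequentially. h n = binom_poly (case_nat k c) (Suc D) n"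
proof -
  obtain N where N: "\<And>n. n \<ge> N \<Longrightarrow> h (Suc n) - h n = binom_poly c D (Suc n)"
    using assms by (auto simp: eventually_sequentially)
  define k where "k = h N - binom_poly (case_nat 0 c) (Suc D) N"
  have shift: "binom_poly (case_nat k c) (Suc D) n = k + binom_poly (case_nat 0 c) (Suc D) n" for n
    unfolding binom_poly_def by (simp del: sum.atMost_Suc add: sum.atMost_Suc_shift)
  have "h n = binom_poly (case_nat k c) (Suc D) n" if "n \<ge> N" for n
    using that
  proof (induction n rule: dec_induct)
    case base
    show ?case by (simp add: shift) (simp add: k_def)
  next
    case (step n)
    have "binom_poly (case_nat k c) (Suc D) (Suc n) - binom_poly (case_nat k c) (Suc D) n
        = binom_poly c D (Suc n)"
      using forward_diff_binom_poly[of "case_nat k c" D n] by (simp add: forward_diff_def)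
    with step N[of n] show ?case by simp
  qed
  then show ?thesis by (auto simp: eventually_sequentially)
qed

lemma ev_poly_imp_binom_poly:
  "ev_poly D h \<Longrightarrow> \<exists>c. \<forall>\<^sub>F n in sequentially. h n = binom_poly c D n"
proof (induction D arbitrary: h)
  case 0
  then obtain c where "\<forall>\<^sub>F n in sequentially. h n = c" by auto
  then have "\<forall>\<^sub>F n in sequentially. h n = binom_poly (\<lambda>_. c) 0 n" by (simp add: binom_poly_def)
  then show ?case by blast
next
  case (Suc D)
  \<comment> \<open>The difference is delayed by one because \<open>binom_poly_antidiff\<close>
    wants it at the argument \<open>Suc n\<close>.\<close>
  have "ev_poly D (\<lambda>n. forward_diff h (n - 1))"
    using Suc.prems ev_poly_minus_shift[of D "forward_diff h" 1] by simp
  then obtain c where "\<forall>\<^sub>F n in sequentially. forward_diff h (n - 1) = binom_poly c D n"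
    using Suc.IH by blast
  then have "\<forall>\<^sub>F n in sequentially. forward_diff h (Suc n - 1) = binom_poly c D (Suc n)"
    by (subst eventually_sequentially_Suc)
  then have "\<forall>\<^sub>F n in sequentially. h (Suc n) - h n = binom_poly c D (Suc n)"
    by (simp add: forward_diff_def)
  then show ?case using binom_poly_antidiff by blast
qed

lemma tendsto_choose_div_power:
  "(\<lambda>n. real ((n + i) choose i) / real n ^ i) \<longlonglongrightarrow> 1 / fact i"
proof (induction i)
  case (Suc i)
  have eq: "real ((n + Suc i) choose Suc i) / real n ^ Suc i
      = (real ((n + i) choose i) / real n ^ i) * ((1 + real (Suc i) * inverse (real n)) / real (Suc i))"
    if "n > 0" for n
  proof -
    have "Suc i * ((n + Suc i) choose Suc i) = (n + Suc i) * ((n + i) choose i)"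
      using Suc_times_binomial[of i "n + i"] by simp
    then have "real (Suc i) * real ((n + Suc i) choose Suc i) = real (n + Suc i) * real ((n + i) choose i)"
      by (metis of_nat_mult)
    then have "real ((n + Suc i) choose Suc i) = real (n + Suc i) * real ((n + i) choose i) / real (Suc i)"
      by (simp add: field_simps)
    then show ?thesis using that by (simp add: divide_simps)
  qed
  have "(\<lambda>n. (real ((n + i) choose i) / real n ^ i) * ((1 + real (Suc i) * inverse (real n)) / real (Suc i)))
     \<longlonglongrightarrow> 1 / fact i * ((1 + real (Suc i) * 0) / real (Suc i))"
    by (intro tendsto_mult[OF Suc] tendsto_divide tendsto_add tendsto_const
        tendsto_mult[OF tendsto_const lim_inverse_n]) simp
  then have "(\<lambda>n. real ((n + Suc i) choose Suc i) / real n ^ Suc i)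
     \<longlonglongrightarrow> 1 / fact i * ((1 + real (Suc i) * 0) / real (Suc i))"
    by (rule Lim_transform_eventually)
      (use eq in \<open>auto simp: eventually_sequentially intro!: exI[of _ 1]\<close>)
  then show ?case by (simp add: field_simps)
qed simp

lemma tendsto_binom_poly:
  "(\<lambda>n. real_of_int (binom_poly c D n) / real n ^ D) \<longlonglongrightarrow> real_of_int (c D) / fact D"
proof -
  have "(\<lambda>n. real ((n + i) choose i) / real n ^ D) \<longlonglongrightarrow> (if i = D then 1 / fact D else 0)"
    if "i \<le> D" for i
  proof (cases "i = D")
    case False
    have "(\<lambda>n. (real ((n + i) choose i) / real n ^ i) * inverse (real n) ^ (D - i)) \<longlonglongrightarrow> 1 / fact i * 0 ^ (D - i)"
      by (intro tendsto_intros tendsto_choose_div_power lim_inverse_n)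
    moreover have "real n ^ D = real n ^ i * real n ^ (D - i)" for n
      using that by (simp flip: power_add)
    moreover have "(0::real) ^ (D - i) = 0" using False that by simp
    ultimately show ?thesis using False by (simp add: field_simps)
  qed (simp add: tendsto_choose_div_power)
  then have "(\<lambda>n. \<Sum>i\<le>D. real_of_int (c i) * (real ((n + i) choose i) / real n ^ D))
      \<longlonglongrightarrow> (\<Sum>i\<le>D. real_of_int (c i) * (if i = D then 1 / fact D else 0))"
    by (intro tendsto_intros) auto
  then show ?thesis
    by (simp add: binom_poly_def sum_divide_distrib if_distrib cong: if_cong)
qed

text \<open>Dividing by \<open>n ^ D\<close> and passing to the limit isolates the leading
  coefficient. This uniqueness is what evaluates the definite descriptions of the
  multiplicities.\<close>

lemma binom_poly_eq_imp_lead_eq: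
  assumes "\<forall>\<^sub>F n in sequentially. binom_poly c D n = binom_poly c' D n"
  shows "c D = c' D"
proof -
  have "(\<lambda>n. real_of_int (binom_poly c' D n) / real n ^ D) \<longlonglongrightarrow> real_of_int (c D) / fact D"
    using tendsto_binom_poly by (rule Lim_transform_eventually) (use assms in \<open>eventually_elim, simp\<close>)
  from LIMSEQ_unique[OF this tendsto_binom_poly] show ?thesis by simp
qed

lemma binom_poly_eq_imp_eq:
  assumes "\<forall>\<^sub>F n in sequentially. binom_poly c D n = binom_poly c' D n" "i \<le> D"
  shows "c i = c' i"
  using assms
proof (induction D)
  case 0
  then show ?case using binom_poly_eq_imp_lead_eq[of c 0 c'] by simp
next
  case (Suc D)
  have lead: "c (Suc D) = c' (Suc D)" using Suc.prems binom_poly_eq_imp_lead_eq by blast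
  have "\<forall>\<^sub>F n in sequentially. binom_poly c D n = binom_poly c' D n"
    using Suc.prems(1) by eventually_elim (simp add: binom_poly_def lead)
  with Suc lead show ?case by (cases "i = Suc D") auto
qed

section \<open>Growth bounds and reduction of the degree\<close>

definition poly_growth :: "nat \<Rightarrow> (nat \<Rightarrow> int) \<Rightarrow> bool" where
  "poly_growth D h \<longleftrightarrow> (\<exists>C. \<forall>n. \<bar>real_of_int (h n)\<bar> \<le> C * real (Suc n) ^ D)"

lemma poly_growth_mono:
  assumes "poly_growth D h'" "\<And>n. \<bar>h n\<bar> \<le> \<bar>h' n\<bar>"
  shows "poly_growth D h"
proof -
  obtain C where C: "\<And>n. \<bar>real_of_int (h' n)\<bar> \<le> C * real (Suc n) ^ D"
    using assms(1) by (auto simp: poly_growth_def)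
  have "\<bar>real_of_int (h n)\<bar> \<le> \<bar>real_of_int (h' n)\<bar>" for n
    using assms(2)[of n] by (metis of_int_abs of_int_le_iff)
  then show ?thesis unfolding poly_growth_def using C order_trans by blast
qed

lemma poly_growth_shift:
  assumes "poly_growth D h"
  shows "poly_growth D (\<lambda>n. h (n + k))"
proof -
  obtain C where C: "\<And>n. \<bar>real_of_int (h n)\<bar> \<le> C * real (Suc n) ^ D"
    using assms by (auto simp: poly_growth_def)
  have "C \<ge> 0" using C[of 0] by simp
  have "\<bar>real_of_int (h (n + k))\<bar> \<le> (C * real (Suc k) ^ D) * real (Suc n) ^ D" for n
  proof -
    have "real (Suc (n + k)) \<le> real (Suc k) * real (Suc n)" by (simp add: algebra_simps)
    then have "real (Suc (n + k)) ^ D \<le> (real (Suc k) * real (Suc n)) ^ D"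
      by (rule power_mono) simp
    then have "C * real (Suc (n + k)) ^ D \<le> C * (real (Suc k) * real (Suc n)) ^ D"
      using \<open>C \<ge> 0\<close> by (rule mult_left_mono)
    also have "\<dots> = (C * real (Suc k) ^ D) * real (Suc n) ^ D" by (simp only: power_mult_distrib mult.assoc)
    finally show ?thesis using C[of "n + k"] by linarith
  qed
  then show ?thesis unfolding poly_growth_def by blast
qed

lemma poly_growth_diff:
  assumes "poly_growth D f" "poly_growth D g"
  shows "poly_growth D (\<lambda>n. f n - g n)"
proof -
  obtain A B where "\<And>n. \<bar>real_of_int (f n)\<bar> \<le> A * real (Suc n) ^ D" "\<And>n. \<bar>real_of_int (g n)\<bar> \<le> B * real (Suc n) ^ D"
    using assms by (auto simp: poly_growth_def)
  note AB = this
  have "\<bar>real_of_int (f n - g n)\<bar> \<le> (A + B) * real (Suc n) ^ D" for n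
  proof -
    have "\<bar>real_of_int (f n - g n)\<bar> \<le> \<bar>real_of_int (f n)\<bar> + \<bar>real_of_int (g n)\<bar>"
      unfolding of_int_diff by (rule abs_triangle_ineq4)
    also have "\<dots> \<le> (A + B) * real (Suc n) ^ D"
      unfolding distrib_right by (intro add_mono AB)
    finally show ?thesis .
  qed
  then show ?thesis unfolding poly_growth_def by blast
qed

lemma poly_growth_antidiff:
  assumes "poly_growth D g" "\<And>n. n \<ge> N \<Longrightarrow> h (Suc n) - h n = g (Suc n)"
  shows "poly_growth (Suc D) h"
proof -
  obtain C where C: "\<And>n. \<bar>real_of_int (g n)\<bar> \<le> C * real (Suc n) ^ D"
    using assms by (auto simp: poly_growth_def)
  have "C \<ge> 0" using C[of 0] by simp
  \<comment> \<open>\<open>A\<close> absorbs the finitely many values up to \<open>N\<close>, where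
    nothing is known about the increments.\<close>
  define A where "A = (\<Sum>i\<le>N. \<bar>real_of_int (h i)\<bar>)"
  have small: "\<bar>real_of_int (h n)\<bar> \<le> A" if "n \<le> N" for n
    unfolding A_def using that by (intro member_le_sum) auto
  have "A \<ge> 0" unfolding A_def by (intro sum_nonneg) auto
  have "\<bar>real_of_int (h n)\<bar> \<le> A + C * real n * real (Suc n) ^ D" for n
  proof (cases "n \<le> N")
    case True
    then show ?thesis using small[of n] \<open>C \<ge> 0\<close> by (intro add_increasing2 mult_nonneg_nonneg) auto
  next
    case False
    then have "N \<le> n" by simp
    then show ?thesis
    proof (induction n rule: dec_induct)
      case base
      then show ?case using small[of N] \<open>C \<ge> 0\<close> by (intro add_increasing2 mult_nonneg_nonneg) auto
    next
      case (step n)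
      have "\<bar>real_of_int (h (Suc n))\<bar> \<le> \<bar>real_of_int (h n)\<bar> + \<bar>real_of_int (g (Suc n))\<bar>"
        using assms(2)[of n] step by (simp flip: of_int_add of_int_diff of_int_abs)
      also have "\<dots> \<le> A + C * real n * real (Suc n) ^ D + C * real (Suc (Suc n)) ^ D"
        using step C[of "Suc n"] by linarith
      also have "\<dots> \<le> A + C * real n * real (Suc (Suc n)) ^ D + C * real (Suc (Suc n)) ^ D"
        using \<open>C \<ge> 0\<close> by (intro add_mono mult_left_mono power_mono) auto
      also have "\<dots> = A + C * real (Suc n) * real (Suc (Suc n)) ^ D" by (simp add: algebra_simps)
      finally show ?case .
    qed
  qed
  moreover have "A + C * real n * real (Suc n) ^ D \<le> (A + C) * real (Suc n) ^ Suc D" for n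
  proof -
    have "A * 1 \<le> A * real (Suc n) ^ Suc D" using \<open>A \<ge> 0\<close> by (intro mult_left_mono one_le_power) auto
    moreover have "C * real n * real (Suc n) ^ D \<le> C * real (Suc n) * real (Suc n) ^ D"
      using \<open>C \<ge> 0\<close> by (intro mult_right_mono mult_left_mono) auto
    ultimately show ?thesis by (simp add: algebra_simps)
  qed
  ultimately show ?thesis unfolding poly_growth_def by (meson order_trans)
qed

text \<open>The coefficient in degree \<open>Suc D\<close> is, up to a factorial, the limit of
  \<open>h n / n ^ Suc D\<close>, and the growth bound forces this limit to be 0.\<close>

lemma ev_poly_reduce:
  assumes "ev_poly (Suc D) h" "poly_growth D h"
  shows "ev_poly D h"
proof -
  obtain c where c: "\<forall>\<^sub>F n in sequentially. h n = binom_poly c (Suc D) n"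
    using ev_poly_imp_binom_poly[OF assms(1)] by blast
  obtain C where C: "\<And>n. \<bar>real_of_int (h n)\<bar> \<le> C * real (Suc n) ^ D"
    using assms(2) by (auto simp: poly_growth_def)
  have "(\<lambda>n. real_of_int (h n) / real n ^ Suc D) \<longlonglongrightarrow> real_of_int (c (Suc D)) / fact (Suc D)"
    using tendsto_binom_poly by (rule Lim_transform_eventually) (use c in \<open>eventually_elim, simp\<close>)
  moreover have "(\<lambda>n. real_of_int (h n) / real n ^ Suc D) \<longlonglongrightarrow> 0"
  proof (rule tendsto_rabs_zero_cancel, rule tendsto_sandwich[OF _ _ tendsto_const])
    have "\<bar>real_of_int (h n) / real n ^ Suc D\<bar> \<le> C * (1 + inverse (real n)) ^ D * inverse (real n)"
      if "n > 0" for n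
    proof -
      have "\<bar>real_of_int (h n) / real n ^ Suc D\<bar> \<le> C * real (Suc n) ^ D / real n ^ Suc D"
        using C[of n] by (simp add: abs_divide divide_right_mono del: power_Suc)
      also have "real (Suc n) = real n * (1 + inverse (real n))" using that by (simp add: field_simps)
      also have "C * (real n * a) ^ D / real n ^ Suc D = C * a ^ D * inverse (real n)" for a
        using that by (simp add: power_mult_distrib field_simps)
      finally show ?thesis .
    qed
    then show "\<forall>\<^sub>F n in sequentially. \<bar>real_of_int (h n) / real n ^ Suc D\<bar>
        \<le> C * (1 + inverse (real n)) ^ D * inverse (real n)"
      by (auto simp: eventually_sequentially intro!: exI[of _ 1])
    have "(\<lambda>n. C * (1 + inverse (real n)) ^ D * inverse (real n)) \<longlonglongrightarrow> C * (1 + 0) ^ D * 0"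
      by (intro tendsto_intros lim_inverse_n)
    then show "(\<lambda>n. C * (1 + inverse (real n)) ^ D * inverse (real n)) \<longlonglongrightarrow> 0" by simp
  qed simp
  ultimately have "c (Suc D) = 0" using LIMSEQ_unique by fastforce
  then have "\<forall>\<^sub>F n in sequentially. binom_poly c D n = h n"
    using c by (auto elim!: eventually_mono simp: binom_poly_def)
  then show ?thesis by (rule ev_poly_cong[OF ev_poly_binom_poly])
qed

lemma ev_poly_le:
  assumes "ev_poly D h" "D \<le> D'"
  shows "ev_poly D' h"
proof -
  have "ev_poly (D + k) h" for k
    by (induction k) (auto intro: ev_poly_forward_diff assms(1))
  from this[of "D' - D"] show ?thesis using assms(2) by simp
qed

text \<open>Nesting one-variable polynomials, with inner degree \<open>D - j\<close>, keeps the
  total degree at most \<open>D\<close> and makes the one-variable lemmas applicable in each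
  variable.\<close>

definition biv_poly :: "(nat \<Rightarrow> nat \<Rightarrow> int) \<Rightarrow> nat \<Rightarrow> nat \<Rightarrow> nat \<Rightarrow> int" where
  "biv_poly e D r s = binom_poly (\<lambda>j. binom_poly (\<lambda>i. e i j) (D - j) r) D s"

lemma biv_poly_eq_sum:
  "biv_poly e D r s =
    (\<Sum>(i, j) \<in> {(i, j). i + j \<le> D}. e i j * int ((r + i) choose i) * int ((s + j) choose j))"
proof -
  have "biv_poly e D r s =
      (\<Sum>j\<le>D. \<Sum>i\<le>D - j. e i j * int ((r + i) choose i) * int ((s + j) choose j))"
    by (simp add: biv_poly_def binom_poly_def sum_distrib_right)
  also have "\<dots> = (\<Sum>(j, i)\<in>(SIGMA j:{..D}. {..D - j}). e i j * int ((r + i) choose i) * int ((s + j) choose j))"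
    by (rule sum.Sigma) auto
  also have "\<dots> = (\<Sum>(i, j) \<in> {(i, j). i + j \<le> D}. e i j * int ((r + i) choose i) * int ((s + j) choose j))"
    by (rule sum.reindex_bij_witness[of _ "\<lambda>(i, j). (j, i)" "\<lambda>(i, j). (j, i)"]) auto
  finally show ?thesis .
qed

text \<open>Summing in \<open>s\<close> determines \<open>f r s\<close> up to a term depending on
  \<open>r\<close> alone. The hypothesis \<open>rows\<close> makes that term polynomial in
  \<open>r\<close>, which the differences in \<open>s\<close> could not show.\<close>

lemma biv_poly_antidiff:
  assumes diff: "\<And>r s. N \<le> r \<Longrightarrow> N \<le> s \<Longrightarrow> f r (Suc s) - f r s = biv_poly e D r (Suc s)"
    and rows: "\<And>s. ev_poly (Suc D) (\<lambda>r. f r s)"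
  shows "\<exists>e' N'. (\<forall>r\<ge>N'. \<forall>s\<ge>N'. f r s = biv_poly e' (Suc D) r s) \<and> (\<forall>i j. e' i (Suc j) = e i j)"
proof -
  define g where "g j r = binom_poly (\<lambda>i. e i j) (D - j) r" for j r
  \<comment> \<open>\<open>G r\<close> is the antidifference with vanishing constant coefficient;
    \<open>f - G\<close> is therefore independent of \<open>s\<close> from \<open>N\<close>
    on.\<close>
  define G where "G r s = binom_poly (case_nat 0 (\<lambda>j. g j r)) (Suc D) s" for r s
  have G_diff: "G r (Suc s) - G r s = binom_poly (\<lambda>j. g j r) D (Suc s)" for r s
    using forward_diff_binom_poly[of "case_nat 0 (\<lambda>j. g j r)" D s] by (simp add: G_def forward_diff_def)
  have G_sum: "G r s = (\<Sum>j\<le>D. g j r * int ((s + Suc j) choose Suc j))" for r s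
    unfolding G_def binom_poly_def by (subst sum.atMost_Suc_shift) simp
  have const: "f r s - G r s = f r N - G r N" if "N \<le> r" "N \<le> s" for r s
    using that(2)
  proof (induction s rule: dec_induct)
    case (step s)
    have "f r (Suc s) - f r s = G r (Suc s) - G r s"
      using diff[OF that(1) step(1)] by (simp add: G_diff biv_poly_def g_def)
    then show ?case using step by simp
  qed simp
  have "ev_poly (Suc D) (\<lambda>r. f r N - G r N)"
  proof (rule ev_poly_diff[OF rows])
    have "ev_poly (Suc D) (\<lambda>r. int ((N + Suc j) choose Suc j) * g j r)" for j
      unfolding g_def by (intro ev_poly_cmult ev_poly_le[OF ev_poly_binom_poly]) simp
    then have "ev_poly (Suc D) (\<lambda>r. \<Sum>j\<le>D. int ((N + Suc j) choose Suc j) * g j r)"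
      by (intro ev_poly_sum) auto
    then show "ev_poly (Suc D) (\<lambda>r. G r N)" unfolding G_sum by (simp add: mult.commute)
  qed
  then obtain \<kappa> where "\<forall>\<^sub>F r in sequentially. f r N - G r N = binom_poly \<kappa> (Suc D) r"
    using ev_poly_imp_binom_poly by blast
  then obtain M where M: "\<And>r. M \<le> r \<Longrightarrow> f r N - G r N = binom_poly \<kappa> (Suc D) r"
    by (auto simp: eventually_sequentially)
  \<comment> \<open>Summation moves the second index up by one and leaves the first alone; column 0
    takes the coefficients of the summation constant.\<close>
  define e' where "e' i = case_nat (\<kappa> i) (\<lambda>j. e i j)" for i
  have "f r s = biv_poly e' (Suc D) r s" if "max M N \<le> r" "max M N \<le> s" for r s
  proof -
    have "biv_poly e' (Suc D) r s = binom_poly \<kappa> (Suc D) r + G r s"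
      unfolding biv_poly_def G_sum g_def binom_poly_def[of _ "Suc D" s]
      by (subst sum.atMost_Suc_shift) (simp add: e'_def)
    then show ?thesis using const[of r s] M[of r] that by simp
  qed
  then show ?thesis by (intro exI[of _ e'] exI[of _ "max M N"]) (simp add: e'_def)
qed

text \<open>Uniqueness in one variable is used twice: in \<open>s\<close> for each large
  \<open>r\<close>, then in \<open>r\<close> for the resulting coefficient polynomials.\<close>

lemma biv_poly_eq_imp_eq:
  assumes "\<And>r s. N \<le> r \<Longrightarrow> N \<le> s \<Longrightarrow> biv_poly e D r s = biv_poly e' D r s" "i + j \<le> D"
  shows "e i j = e' i j"
proof (rule binom_poly_eq_imp_eq[where D = "D - j" and c = "\<lambda>i. e i j" and c' = "\<lambda>i. e' i j"])
  have "binom_poly (\<lambda>i. e i j) (D - j) r = binom_poly (\<lambda>i. e' i j) (D - j) r" if "N \<le> r" for r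
  proof (rule binom_poly_eq_imp_eq[where D = D and i = j and c = "\<lambda>j. binom_poly (\<lambda>i. e i j) (D - j) r"
        and c' = "\<lambda>j. binom_poly (\<lambda>i. e' i j) (D - j) r"])
    show "\<forall>\<^sub>F s in sequentially. binom_poly (\<lambda>j. binom_poly (\<lambda>i. e i j) (D - j) r) D s =
        binom_poly (\<lambda>j. binom_poly (\<lambda>i. e' i j) (D - j) r) D s"
      using assms(1)[OF that] unfolding eventually_sequentially biv_poly_def by blast
  qed (use assms(2) in simp)
  then show "\<forall>\<^sub>F r in sequentially. binom_poly (\<lambda>i. e i j) (D - j) r = binom_poly (\<lambda>i. e' i j) (D - j) r"
    unfolding eventually_sequentially by blast
qed (use assms(2) in simp)

subsection \<open>Sums of antitone functions over exponent vectors\<close>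

definition comps :: "nat \<Rightarrow> nat \<Rightarrow> nat list set" where
  "comps g n = {\<alpha>. length \<alpha> = g \<and> sum_list \<alpha> = n}"

lemma comps_0: "comps 0 n = (if n = 0 then {[]} else {})"
  by (auto simp: comps_def)

lemma comps_Suc: "comps (Suc g) n = (\<Union>k\<le>n. (#) k ` comps g (n - k))"
proof (intro equalityI subsetI)
  fix \<alpha> assume "\<alpha> \<in> comps (Suc g) n"
  then show "\<alpha> \<in> (\<Union>k\<le>n. (#) k ` comps g (n - k))"
    by (cases \<alpha>) (auto simp: comps_def intro!: bexI[of _ "hd \<alpha>"] image_eqI[of _ _ "tl \<alpha>"])
qed (auto simp: comps_def)

lemma finite_comps: "finite (comps g n)"
  by (induction g arbitrary: n) (auto simp: comps_0 comps_Suc)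

lemma sum_comps_Suc:
  "(\<Sum>\<alpha>\<in>comps (Suc g) n. f \<alpha>) = (\<Sum>k\<le>n. \<Sum>\<alpha>\<in>comps g (n - k). f (k # \<alpha>))"
proof -
  have "(\<Sum>\<alpha>\<in>comps (Suc g) n. f \<alpha>) = (\<Sum>k\<le>n. \<Sum>\<alpha>\<in>(#) k ` comps g (n - k). f \<alpha>)"
    unfolding comps_Suc by (rule sum.UNION_disjoint) (auto simp: finite_comps)
  moreover have "sum f ((#) k ` A) = (\<Sum>\<alpha>\<in>A. f (k # \<alpha>))" for k A
    by (subst sum.reindex) auto
  ultimately show ?thesis by simp
qed

definition antitone_lists :: "nat \<Rightarrow> (nat list \<Rightarrow> nat) \<Rightarrow> bool" where
  "antitone_lists g lam \<longleftrightarrow> (\<forall>\<alpha> \<beta>. length \<alpha> = g \<longrightarrow> list_all2 (\<le>) \<alpha> \<beta> \<longrightarrow> lam \<beta> \<le> lam \<alpha>)"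

lemma antitone_listsD:
  "antitone_lists g lam \<Longrightarrow> length \<alpha> = g \<Longrightarrow> list_all2 (\<le>) \<alpha> \<beta> \<Longrightarrow> lam \<beta> \<le> lam \<alpha>"
  by (auto simp: antitone_lists_def)

lemma list_all2_map_min: "list_all2 (\<le>) (map (min (K::nat)) \<alpha>) \<alpha>"
  by (induction \<alpha>) auto

lemma list_all2_map_min_mono: "K \<le> K' \<Longrightarrow> list_all2 (\<le>) (map (min (K::nat)) \<alpha>) (map (min K') \<alpha>)"
  by (induction \<alpha>) auto

text \<open>This finiteness statement takes the place of the Hilbert basis theorem.\<close>

lemma antitone_lists_truncate:
  assumes "antitone_lists g lam"
  shows "\<exists>K. \<forall>\<alpha>. length \<alpha> = g \<longrightarrow> lam (map (min K) \<alpha>) = lam \<alpha>"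
  using assms
proof (induction g arbitrary: lam)
  case 0
  then show ?case by auto
next
  case (Suc g)
  have anti: "antitone_lists g (\<lambda>\<alpha>. lam (k # \<alpha>))" for k
    using Suc.prems unfolding antitone_lists_def by auto
  have anti_head: "lam (k' # \<alpha>) \<le> lam (k # \<alpha>)" if "k \<le> k'" "length \<alpha> = g" for k k' \<alpha>
    using that by (intro antitone_listsD[OF Suc.prems]) (auto intro: list.rel_refl)
  \<comment> \<open>\<open>mu \<alpha>\<close> is the limit of the antitone sequence
    \<open>lam (k # \<alpha>)\<close> as \<open>k\<close> grows; a sequence of naturals attains
    it.\<close>
  define mu where "mu \<alpha> = (LEAST v. \<exists>k. v = lam (k # \<alpha>))" for \<alpha>
  have mu_le: "mu \<alpha> \<le> lam (k # \<alpha>)" for \<alpha> k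
    unfolding mu_def by (rule Least_le) auto
  have mu_ex: "\<exists>k. mu \<alpha> = lam (k # \<alpha>)" for \<alpha>
    unfolding mu_def by (rule LeastI_ex) auto
  have "antitone_lists g mu"
    unfolding antitone_lists_def
  proof (intro allI impI)
    fix \<alpha> \<beta> :: "nat list" assume "length \<alpha> = g" "list_all2 (\<le>) \<alpha> \<beta>"
    moreover obtain k where "mu \<alpha> = lam (k # \<alpha>)" using mu_ex by blast
    ultimately show "mu \<beta> \<le> mu \<alpha>" using antitone_listsD[OF anti] mu_le le_trans by metis
  qed
  then obtain K0 where K0: "\<And>\<alpha>. length \<alpha> = g \<Longrightarrow> mu (map (min K0) \<alpha>) = mu \<alpha>"
    using Suc.IH by blast
  \<comment> \<open>Tails truncated at \<open>K0\<close> are finitely many, so one head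
    \<open>k0\<close> reaches the limit for all of them. An arbitrary tail is then squeezed between
    \<open>mu \<alpha>\<close> and the value at its truncation.\<close>
  define B where "B = {\<alpha>. set \<alpha> \<subseteq> {..K0} \<and> length \<alpha> = g}"
  have "finite B" unfolding B_def by (rule finite_lists_length_eq) auto
  obtain k where k: "\<And>\<alpha>. mu \<alpha> = lam (k \<alpha> # \<alpha>)" using mu_ex by metis
  define k0 where "k0 = Max (insert 0 (k ` B))"
  have k0: "k \<alpha> \<le> k0" if "\<alpha> \<in> B" for \<alpha>
    unfolding k0_def using that \<open>finite B\<close> by auto
  have stable: "lam (j # \<alpha>) = mu \<alpha>" if "j \<ge> k0" "length \<alpha> = g" for j \<alpha>
  proof (rule antisym)
    let ?\<beta> = "map (min K0) \<alpha>"
    have "?\<beta> \<in> B" using that by (auto simp: B_def)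
    have "lam (j # \<alpha>) \<le> lam (j # ?\<beta>)"
      using that list_all2_map_min by (intro antitone_listsD[OF anti]) auto
    also have "\<dots> \<le> lam (k ?\<beta> # ?\<beta>)"
      using that k0[OF \<open>?\<beta> \<in> B\<close>] by (intro anti_head) auto
    also have "\<dots> = mu \<alpha>" using k K0 that by metis
    finally show "lam (j # \<alpha>) \<le> mu \<alpha>" .
  qed (rule mu_le)
  have "\<exists>K. \<forall>\<alpha>. length \<alpha> = g \<longrightarrow> lam (j # map (min K) \<alpha>) = lam (j # \<alpha>)" for j
    using Suc.IH[OF anti] .
  then obtain Kj where Kj: "\<And>j \<alpha>. length \<alpha> = g \<Longrightarrow> lam (j # map (min (Kj j)) \<alpha>) = lam (j # \<alpha>)"
    by metis
  \<comment> \<open>Heads beyond \<open>k0\<close> are governed by \<open>mu\<close> and its bound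
    \<open>K0\<close>; each of the finitely many smaller heads contributes its own bound
    \<open>Kj\<close>.\<close>
  define K where "K = Max (insert k0 (insert K0 (Kj ` {..k0})))"
  have K: "k0 \<le> K" "K0 \<le> K" "\<And>j. j \<le> k0 \<Longrightarrow> Kj j \<le> K"
    unfolding K_def by (intro Max_ge; simp)+
  have "lam (map (min K) (j # \<alpha>)) = lam (j # \<alpha>)" if "length \<alpha> = g" for j \<alpha>
  proof (cases "j \<le> k0")
    case True
    have "lam (j # map (min K) \<alpha>) \<le> lam (j # map (min (Kj j)) \<alpha>)"
      using that K True list_all2_map_min_mono by (intro antitone_listsD[OF anti]) auto
    moreover have "lam (j # \<alpha>) \<le> lam (j # map (min K) \<alpha>)"
      using that list_all2_map_min by (intro antitone_listsD[OF anti]) auto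
    ultimately show ?thesis using Kj[OF that, of j] K True by simp
  next
    case False
    have "mu (map (min K) \<alpha>) = mu \<alpha>"
    proof (rule antisym)
      show "mu (map (min K) \<alpha>) \<le> mu \<alpha>"
        using antitone_listsD[OF \<open>antitone_lists g mu\<close> _ list_all2_map_min_mono[OF K(2)]] K0 that
        by (metis length_map)
      show "mu \<alpha> \<le> mu (map (min K) \<alpha>)"
        using antitone_listsD[OF \<open>antitone_lists g mu\<close> _ list_all2_map_min] that by simp
    qed
    then show ?thesis using stable[of "min K j" "map (min K) \<alpha>"] stable[of j \<alpha>] False that K by auto
  qed
  then show ?case by (intro exI[of _ K]) (metis length_Suc_conv)
qed

text \<open>Induction on the number of variables, splitting off the first exponent. The difference
  of the sum is a finite combination of sums in one variable less, so the degree goes up by at most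
  one, and the growth bound brings it back to \<open>D\<close>.\<close>

theorem antitone_sum_ev_poly:
  assumes "antitone_lists g lam" "poly_growth D (\<lambda>n. int (\<Sum>\<alpha>\<in>comps g n. lam \<alpha>))"
  shows "ev_poly D (\<lambda>n. int (\<Sum>\<alpha>\<in>comps g n. lam \<alpha>))"
  using assms
proof (induction g arbitrary: lam)
  case 0
  have "\<forall>\<^sub>F n in sequentially. 0 = int (\<Sum>\<alpha>\<in>comps 0 n. lam \<alpha>)"
    by (auto simp: eventually_sequentially comps_0 intro!: exI[of _ 1])
  then show ?case by (rule ev_poly_cong[OF ev_poly_const])
next
  case (Suc g)
  define H where "H k n = int (\<Sum>\<alpha>\<in>comps g n. lam (k # \<alpha>))" for k n
  define F where "F n = int (\<Sum>\<alpha>\<in>comps (Suc g) n. lam \<alpha>)" for n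
  have F: "F n = (\<Sum>k\<le>n. H k (n - k))" for n
    unfolding F_def H_def sum_comps_Suc by simp
  have H_nonneg: "H k n \<ge> 0" for k n unfolding H_def by (rule of_nat_0_le_iff)
  \<comment> \<open>All summands are nonnegative, so each slice inherits the growth bound of the
    whole sum up to a shift.\<close>
  have H_le: "H k n \<le> F (n + k)" for k n
    unfolding F using member_le_sum[of k "{..n+k}" "\<lambda>j. H j (n + k - j)"] H_nonneg by simp
  have "poly_growth D F" using Suc.prems unfolding F_def by simp
  have "ev_poly D (H k)" for k
    unfolding H_def
  proof (rule Suc.IH)
    show "antitone_lists g (\<lambda>\<alpha>. lam (k # \<alpha>))"
      using Suc.prems unfolding antitone_lists_def by auto
    have "\<bar>H k n\<bar> \<le> \<bar>F (n + k)\<bar>" for n using H_le[of k n] H_nonneg[of k n] by linarith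
    with poly_growth_shift[OF \<open>poly_growth D F\<close>, of k] have "poly_growth D (H k)"
      by (rule poly_growth_mono)
    then show "poly_growth D (\<lambda>n. int (\<Sum>\<alpha>\<in>comps g n. lam (k # \<alpha>)))" unfolding H_def .
  qed
  obtain K where K: "\<And>\<alpha>. length \<alpha> = Suc g \<Longrightarrow> lam (map (min K) \<alpha>) = lam \<alpha>"
    using antitone_lists_truncate[OF Suc.prems(1)] by blast
  have stable: "H (Suc k) n = H k n" if "k \<ge> K" for k n
  proof -
    have "lam (Suc k # \<alpha>) = lam (k # \<alpha>)" if "length \<alpha> = g" for \<alpha>
      using K[of "Suc k # \<alpha>"] K[of "k # \<alpha>"] that \<open>k \<ge> K\<close> by (simp add: min_def)
    then show ?thesis unfolding H_def by (auto simp: comps_def intro!: sum.cong)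
  qed
  \<comment> \<open>Pairing head \<open>k + 1\<close> in degree \<open>n + 1\<close> with head
    \<open>k\<close> in degree \<open>n\<close> gives tails of equal degree. By truncation the pairs
    with \<open>k \<ge> K\<close> cancel.\<close>
  have "forward_diff F n = H 0 (Suc n) + (\<Sum>k<K. H (Suc k) (n - k) - H k (n - k))" if "n \<ge> K" for n
  proof -
    have "F (Suc n) = H 0 (Suc n) + (\<Sum>k\<le>n. H (Suc k) (n - k))"
      unfolding F by (subst sum.atMost_Suc_shift) simp
    then have "forward_diff F n = H 0 (Suc n) + (\<Sum>k\<le>n. H (Suc k) (n - k) - H k (n - k))"
      by (simp add: forward_diff_def F[of n] sum_subtractf)
    also have "(\<Sum>k\<le>n. H (Suc k) (n - k) - H k (n - k)) = (\<Sum>k<K. H (Suc k) (n - k) - H k (n - k))"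
      by (rule sum.mono_neutral_right) (use that stable in \<open>auto simp: not_less\<close>)
    finally show ?thesis .
  qed
  then have "\<forall>\<^sub>F n in sequentially.
      H 0 (Suc n) + (\<Sum>k<K. H (Suc k) (n - k) - H k (n - k)) = forward_diff F n"
    unfolding eventually_sequentially by metis
  moreover have "ev_poly D (\<lambda>n. H 0 (Suc n) + (\<Sum>k<K. H (Suc k) (n - k) - H k (n - k)))"
    using \<open>\<And>k. ev_poly D (H k)\<close>
    by (intro ev_poly_add ev_poly_sum ev_poly_diff ev_poly_minus_shift) (auto simp: ev_poly_Suc_shift)
  ultimately have "ev_poly (Suc D) F" using ev_poly_cong by auto
  then have "ev_poly D F" using ev_poly_reduce \<open>poly_growth D F\<close> by blast
  then show ?case unfolding F_def .
qed

section \<open>Length of a quotient of ideals\<close>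

text \<open>Chains of ideals of \<open>R\<close> between \<open>J\<close> and \<open>K\<close>
  replace chains of submodules of \<open>K / J\<close>. All lengths then live in the ideal lattice
  of one ring, and \<open>quot_length_eq\<close> returns to modules.\<close>

definition ideal_len :: "('a, 'b) ring_scheme \<Rightarrow> 'a set \<Rightarrow> 'a set \<Rightarrow> enat" where
  "ideal_len R K J = Sup {enat n | n.
     \<exists>N :: nat \<Rightarrow> 'a set. (\<forall>i\<le>n. ideal (N i) R \<and> J \<subseteq> N i \<and> N i \<subseteq> K) \<and> (\<forall>i<n. N i \<subset> N (Suc i))}"

context cring
begin

section \<open>Sums, products and colons of ideals\<close>

lemma set_add_iff: "y \<in> A <+> B \<longleftrightarrow> (\<exists>a\<in>A. \<exists>b\<in>B. y = a \<oplus> b)"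
  by (auto simp: set_add_def')

lemma ideal_simps:
  assumes "ideal J R"
  shows "\<zero> \<in> J" "x \<in> J \<Longrightarrow> x \<in> carrier R" "x \<in> J \<Longrightarrow> y \<in> J \<Longrightarrow> x \<oplus> y \<in> J"
    "x \<in> J \<Longrightarrow> \<ominus> x \<in> J" "x \<in> J \<Longrightarrow> y \<in> J \<Longrightarrow> x \<ominus> y \<in> J"
    "x \<in> J \<Longrightarrow> r \<in> carrier R \<Longrightarrow> r \<otimes> x \<in> J" "x \<in> J \<Longrightarrow> r \<in> carrier R \<Longrightarrow> x \<otimes> r \<in> J"
  using additive_subgroup.zero_closed[OF ideal.axioms(1)[OF assms]] ideal.Icarr[OF assms]
    additive_subgroup.a_closed[OF ideal.axioms(1)[OF assms]]
    additive_subgroup.a_inv_closed[OF ideal.axioms(1)[OF assms]]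
    ideal.I_l_closed[OF assms] ideal.I_r_closed[OF assms]
  by (auto simp: a_minus_def)

lemma cring_idealI:
  assumes "N \<subseteq> carrier R" "\<zero> \<in> N" "\<And>x y. x \<in> N \<Longrightarrow> y \<in> N \<Longrightarrow> x \<oplus> y \<in> N"
    "\<And>r x. r \<in> carrier R \<Longrightarrow> x \<in> N \<Longrightarrow> r \<otimes> x \<in> N"
  shows "ideal N R"
proof (rule idealI[OF ring_axioms])
  show "subgroup N (add_monoid R)"
  proof (rule add.subgroupI)
    fix a assume "a \<in> N"
    then show "\<ominus> a \<in> N" using assms(4)[of "\<ominus> \<one>" a] assms(1) by (simp add: l_minus subset_eq)
  qed (use assms in auto)
  fix a x assume "a \<in> N" "x \<in> carrier R"
  then show "x \<otimes> a \<in> N" "a \<otimes> x \<in> N"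
    using assms(1,4) m_comm[of a x] by auto
qed

lemma ideal_colon:
  assumes "ideal L R" "z \<in> carrier R"
  shows "ideal {y \<in> carrier R. z \<otimes> y \<in> L} R"
  by (rule ideal.helper_max_prime[OF assms(1) cring_axioms assms(2)])

lemma subset_set_add1: "ideal B R \<Longrightarrow> A \<subseteq> carrier R \<Longrightarrow> A \<subseteq> A <+> B"
proof
  fix a assume "ideal B R" "A \<subseteq> carrier R" "a \<in> A"
  then have "\<zero> \<in> B" "a = a \<oplus> \<zero>" using ideal_simps(1) by auto
  with \<open>a \<in> A\<close> show "a \<in> A <+> B" unfolding set_add_iff by blast
qed

lemma subset_set_add2: "ideal A R \<Longrightarrow> B \<subseteq> carrier R \<Longrightarrow> B \<subseteq> A <+> B"
proof
  fix b assume "ideal A R" "B \<subseteq> carrier R" "b \<in> B"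
  then have "\<zero> \<in> A" "b = \<zero> \<oplus> b" using ideal_simps(1) by auto
  with \<open>b \<in> B\<close> show "b \<in> A <+> B" unfolding set_add_iff by blast
qed

lemma ideal_subset_carrier: "ideal J R \<Longrightarrow> J \<subseteq> carrier R"
  by (simp add: ideal_simps(2) subsetI)

lemma set_add_least: "ideal C R \<Longrightarrow> A \<subseteq> C \<Longrightarrow> B \<subseteq> C \<Longrightarrow> A <+> B \<subseteq> C"
  unfolding set_add_iff subset_iff using ideal_simps(3) by blast

lemma set_add_mono: "A \<subseteq> A' \<Longrightarrow> B \<subseteq> B' \<Longrightarrow> A <+> B \<subseteq> A' <+> B'"
  unfolding set_add_iff subset_iff by blast

lemma ideal_prod_mono: "A \<subseteq> A' \<Longrightarrow> B \<subseteq> B' \<Longrightarrow> A \<cdot> B \<subseteq> A' \<cdot> B'"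
proof
  fix x assume "A \<subseteq> A'" "B \<subseteq> B'" "x \<in> A \<cdot> B"
  from this(3,1,2) show "x \<in> A' \<cdot> B'"
    by (induction x rule: ideal_prod.induct) (auto intro: ideal_prod.intros)
qed

lemma cgenideal_prod_elem:
  assumes xc: "x \<in> carrier R" and K: "ideal K R" and "y \<in> (PIdl x) \<cdot> K"
  shows "\<exists>k\<in>K. y = x \<otimes> k"
  using assms(3)
proof (induction y rule: ideal_prod.induct)
  case (prod i j)
  then obtain r where r: "r \<in> carrier R" "i = r \<otimes> x" by (auto simp: cgenideal_def)
  have jc: "j \<in> carrier R" using prod ideal_simps(2)[OF K] by blast
  have "i \<otimes> j = x \<otimes> (r \<otimes> j)" using r jc xc by (simp add: m_ac)
  then show ?case using ideal_simps(6)[OF K prod(2) r(1)] by blast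
next
  case (sum s t)
  then obtain k l where kl: "k \<in> K" "l \<in> K" "s = x \<otimes> k" "t = x \<otimes> l" by blast
  then have "s \<oplus> t = x \<otimes> (k \<oplus> l)" using ideal_simps(2)[OF K] xc by (simp add: r_distr)
  then show ?case using ideal_simps(3)[OF K] kl by blast
qed

lemma mult_set_add:
  assumes "ideal A R" "ideal J R" "a \<in> carrier R" "y \<in> A <+> J" "\<And>u. u \<in> A \<Longrightarrow> a \<otimes> u \<in> B"
  shows "a \<otimes> y \<in> B <+> J"
proof -
  obtain u j where uj: "u \<in> A" "j \<in> J" "y = u \<oplus> j" using assms(4) by (auto simp: set_add_iff)
  then have "a \<otimes> y = a \<otimes> u \<oplus> a \<otimes> j"
    using ideal_simps(2)[OF assms(1)] ideal_simps(2)[OF assms(2)] assms(3) by (simp add: r_distr)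
  then show ?thesis
    unfolding set_add_iff using assms(5)[OF uj(1)] ideal_simps(6)[OF assms(2) uj(2) assms(3)] by blast
qed

section \<open>Additivity of length and comparison of quotients\<close>

lemma ideal_len_upper:
  assumes "\<forall>i\<le>n. ideal (N i) R \<and> J \<subseteq> N i \<and> N i \<subseteq> K" "\<forall>i<n. N i \<subset> N (Suc i)"
  shows "enat n \<le> ideal_len R K J"
  unfolding ideal_len_def using assms by (intro Sup_upper) blast

lemma ideal_len_least:
  assumes "\<And>n N. \<forall>i\<le>n. ideal (N i) R \<and> J \<subseteq> N i \<and> N i \<subseteq> K \<Longrightarrow> \<forall>i<n. N i \<subset> N (Suc i) \<Longrightarrow> enat n \<le> b"
  shows "ideal_len R K J \<le> b"
  unfolding ideal_len_def by (rule Sup_least) (use assms in blast)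

text \<open>A longer chain can be cut down to \<open>n\<close> steps, so every finite value below
  the supremum is realised, even when the supremum is infinite.\<close>

lemma ideal_len_chain:
  assumes "enat n \<le> ideal_len R K J" "ideal J R" "J \<subseteq> K"
  shows "\<exists>N. (\<forall>i\<le>n. ideal (N i) R \<and> J \<subseteq> N i \<and> N i \<subseteq> K) \<and> (\<forall>i<n. N i \<subset> N (Suc i))"
proof (cases n)
  case 0
  \<comment> \<open>A supremum over the empty set would also be 0, so the chain with no steps has to
    be exhibited.\<close>
  then show ?thesis using assms(2,3) by (intro exI[of _ "\<lambda>_. J"]) auto
next
  case (Suc m)
  then have "enat m < ideal_len R K J"
    using assms(1) by (metis enat_ord_simps(2) lessI order_less_le_trans)
  then obtain n' N where *: "enat m < enat n'"
    "\<forall>i\<le>n'. ideal (N i) R \<and> J \<subseteq> N i \<and> N i \<subseteq> K" "\<forall>i<n'. N i \<subset> N (Suc i)"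
    unfolding ideal_len_def less_Sup_iff by blast
  then show ?thesis using Suc by (intro exI[of _ N]) auto
qed

text \<open>Deleting repetitions leaves one strict step for each proper inclusion. The induction
  also records that the shortened chain ends in \<open>N n\<close>, so that the next ideal can be
  appended.\<close>

lemma weak_chain_len:
  assumes "\<forall>i\<le>n. ideal (N i) R \<and> J \<subseteq> N i \<and> N i \<subseteq> K" "\<forall>i<n. N i \<subseteq> N (Suc i)"
  shows "enat (card {i. i < n \<and> N i \<noteq> N (Suc i)}) \<le> ideal_len R K J"
proof -
  have "\<exists>M. (\<forall>i\<le>card {i. i < n \<and> N i \<noteq> N (Suc i)}. ideal (M i) R \<and> J \<subseteq> M i \<and> M i \<subseteq> K) \<and>
      (\<forall>i<card {i. i < n \<and> N i \<noteq> N (Suc i)}. M i \<subset> M (Suc i)) \<and>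
      M (card {i. i < n \<and> N i \<noteq> N (Suc i)}) = N n"
    using assms
  proof (induction n)
    case 0
    then show ?case by (intro exI[of _ N]) auto
  next
    case (Suc n)
    let ?S = "{i. i < n \<and> N i \<noteq> N (Suc i)}"
    obtain M where M: "\<forall>i\<le>card ?S. ideal (M i) R \<and> J \<subseteq> M i \<and> M i \<subseteq> K"
      "\<forall>i<card ?S. M i \<subset> M (Suc i)" "M (card ?S) = N n"
      using Suc.IH Suc.prems by auto
    show ?case
    proof (cases "N n = N (Suc n)")
      case True
      have "{i. i < Suc n \<and> N i \<noteq> N (Suc i)} = ?S" using True by (auto simp: less_Suc_eq)
      then show ?thesis using M True by (intro exI[of _ M]) auto
    next
      case False
      have "{i. i < Suc n \<and> N i \<noteq> N (Suc i)} = insert n ?S" using False by (auto simp: less_Suc_eq)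
      then have card: "card {i. i < Suc n \<and> N i \<noteq> N (Suc i)} = Suc (card ?S)" by simp
      have "N n \<subset> N (Suc n)" using False Suc.prems by auto
      then show ?thesis unfolding card using M Suc.prems
        by (intro exI[of _ "M(Suc (card ?S) := N (Suc n))"]) (auto simp: le_Suc_eq less_Suc_eq)
    qed
  qed
  then show ?thesis using ideal_len_upper by blast
qed

text \<open>The modular law. It ensures that a proper inclusion stays proper after intersecting with
  \<open>K\<close> or after adding \<open>K\<close>.\<close>

lemma ideal_modular_eq:
  assumes "ideal A R" "ideal B R" "ideal K R" "A \<subseteq> B" "A \<inter> K = B \<inter> K" "A <+> K = B <+> K"
  shows "A = B"
proof
  show "B \<subseteq> A"
  proof
    fix y assume y: "y \<in> B"
    then have "y \<in> A <+> K" using assms subset_set_add1 ideal_subset_carrier by blast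
    then obtain a k where ak: "a \<in> A" "k \<in> K" "y = a \<oplus> k" by (auto simp: set_add_iff)
    have car: "a \<in> carrier R" "k \<in> carrier R" using ak assms ideal_simps by blast+
    have "k = y \<ominus> a" using ak car by (simp add: minus_eq a_ac r_neg1) algebra
    then have "k \<in> B" using y ak assms ideal_simps(5) by blast
    then have "k \<in> A" using ak assms by blast
    then show "y \<in> A" using ak assms ideal_simps(3) by blast
  qed
qed (rule assms)

text \<open>For one inequality a chain is split into its traces on \<open>K\<close> and its sums
  with \<open>K\<close>, and each strict step survives in one of them. For the other, chains below
  and above \<open>K\<close> are concatenated.\<close>

lemma ideal_len_add:
  assumes "ideal J R" "ideal K R" "ideal L R" "J \<subseteq> K" "K \<subseteq> L"
  shows "ideal_len R L J = ideal_len R L K + ideal_len R K J"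
proof (rule antisym)
  show "ideal_len R L J \<le> ideal_len R L K + ideal_len R K J"
  proof (rule ideal_len_least)
    fix n N assume N: "\<forall>i\<le>n. ideal (N i) R \<and> J \<subseteq> N i \<and> N i \<subseteq> L" "\<forall>i<n. N i \<subset> N (Suc i)"
    let ?S = "{i. i < n \<and> N i \<inter> K \<noteq> N (Suc i) \<inter> K}"
    let ?T = "{i. i < n \<and> N i <+> K \<noteq> N (Suc i) <+> K}"
    have "enat (card ?S) \<le> ideal_len R K J"
      using N assms by (intro weak_chain_len) (auto intro: i_intersect)
    moreover have "enat (card ?T) \<le> ideal_len R L K"
    proof (rule weak_chain_len)
      show "\<forall>i\<le>n. ideal (N i <+> K) R \<and> K \<subseteq> N i <+> K \<and> N i <+> K \<subseteq> L"
        using N assms by (auto intro!: add_ideals) 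
          (metis ideal_subset_carrier set_add_least subset_set_add2 subsetD)+
      show "\<forall>i<n. N i <+> K \<subseteq> N (Suc i) <+> K"
        using N(2) set_add_mono[OF _ order_refl] by (meson psubset_imp_subset)
    qed
    moreover have "enat n \<le> enat (card ?T) + enat (card ?S)"
    proof -
      have "{..<n} \<subseteq> ?T \<union> ?S"
      proof
        fix i assume i: "i \<in> {..<n}"
        then have "ideal (N i) R" "ideal (N (Suc i)) R" "N i \<subset> N (Suc i)" using N by auto
        then have "N i \<inter> K \<noteq> N (Suc i) \<inter> K \<or> N i <+> K \<noteq> N (Suc i) <+> K"
          using ideal_modular_eq[of "N i" "N (Suc i)" K] assms by blast
        then show "i \<in> ?T \<union> ?S" using i by auto
      qed
      then have "card {..<n} \<le> card (?T \<union> ?S)" by (intro card_mono) auto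
      then show ?thesis using card_Un_le[of ?T ?S] by simp
    qed
    ultimately show "enat n \<le> ideal_len R L K + ideal_len R K J"
      by (meson add_mono order_trans)
  qed
next
  show "ideal_len R L K + ideal_len R K J \<le> ideal_len R L J"
  proof -
    have step: "enat p + enat q \<le> ideal_len R L J"
      if pq: "enat p \<le> ideal_len R L K" "enat q \<le> ideal_len R K J" for p q
    proof -
      obtain N where N: "\<forall>i\<le>p. ideal (N i) R \<and> K \<subseteq> N i \<and> N i \<subseteq> L" "\<forall>i<p. N i \<subset> N (Suc i)"
        using ideal_len_chain[OF pq(1)] assms by blast
      obtain M where M: "\<forall>i\<le>q. ideal (M i) R \<and> J \<subseteq> M i \<and> M i \<subseteq> K" "\<forall>i<q. M i \<subset> M (Suc i)"
        using ideal_len_chain[OF pq(2)] assms by blast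
      \<comment> \<open>The upper chain enters at \<open>N 1\<close>: the junction
        \<open>M q \<subseteq> K \<subseteq> N 0 \<subset> N 1\<close> is strict although
        \<open>M q\<close> and \<open>N 0\<close> may coincide.\<close>
      define C where "C i = (if i \<le> q then M i else N (i - q))" for i
      have Cid: "ideal (C i) R \<and> J \<subseteq> C i \<and> C i \<subseteq> L" if "i \<le> p + q" for i
      proof (cases "i \<le> q")
        case True
        then have "ideal (M i) R" "J \<subseteq> M i" "M i \<subseteq> K" using M(1) by auto
        with True show ?thesis using assms(5) by (auto simp: C_def)
      next
        case False
        then have "i - q \<le> p" using that by simp
        with False show ?thesis using N(1) assms(4) by (auto simp: C_def)
      qed
      have Cstrict: "C i \<subset> C (Suc i)" if "i < p + q" for i
      proof (cases "i < q")
        case True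
        then show ?thesis using M by (auto simp: C_def)
      next
        case False
        show ?thesis
        proof (cases "i = q")
          case True
          then have "C (Suc i) = N (Suc 0)" "p > 0" using that by (auto simp: C_def)
          moreover have "N 0 \<subset> N (Suc 0)" "K \<subseteq> N 0" "M q \<subseteq> K" using N M \<open>p > 0\<close> by auto
          ultimately show ?thesis using True by (auto simp: C_def)
        next
          case False
          with \<open>\<not> i < q\<close> have "C i = N (i - q)" "C (Suc i) = N (Suc (i - q))" "i - q < p"
            using that by (auto simp: C_def Suc_diff_le)
          then show ?thesis using N by auto
        qed
      qed
      have "enat (p + q) \<le> ideal_len R L J"
        by (rule ideal_len_upper[of _ C]) (use Cid Cstrict in blast)+
      then show ?thesis by simp
    qed
    show ?thesis
    proof (cases "ideal_len R L K")
      case (enat p)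
      show ?thesis
      proof (cases "ideal_len R K J")
        case (enat q)
        then show ?thesis using step[of p q] \<open>ideal_len R L K = enat p\<close> by simp
      next
        case infinity
        then have "enat q \<le> ideal_len R L J" for q
          using step[of 0 q] by (metis enat_0 add_0 enat_ord_code(3) zero_le)
        then have "ideal_len R L J = \<infinity>" by (metis enat_ord_simps(1) not_infinity_eq Suc_n_not_le_n)
        then show ?thesis by simp
      qed
    next
      case infinity
      then have "enat q \<le> ideal_len R L J" for q
        using step[of q 0] by (metis enat_0 add_0_right enat_ord_code(3) zero_le)
      then have "ideal_len R L J = \<infinity>" by (metis enat_ord_simps(1) not_infinity_eq Suc_n_not_le_n)
      then show ?thesis by simp
    qed
  qed
qed

lemma ideal_len_refl: "ideal_len R J J = 0"
proof -
  have "ideal_len R J J \<le> 0"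
  proof (rule ideal_len_least)
    fix n N assume "\<forall>i\<le>n. ideal (N i) R \<and> J \<subseteq> N i \<and> N i \<subseteq> J" "\<forall>i<n. N i \<subset> N (Suc i)"
    then have "n = 0" by (metis Suc_leI gr0I le0 psubset_imp_ex_mem subset_antisym psubset_eq)
    then show "enat n \<le> 0" by (simp add: enat_0)
  qed
  then show ?thesis by simp
qed

text \<open>In the next two lemmas, multiplication by \<open>z\<close> induces a map \<open>K / L \<rightarrow> K' / L'\<close>.\<close>

lemma ideal_len_surj:
  assumes "ideal K R" "ideal L R" "ideal K' R" "ideal L' R" "L \<subseteq> K" "L' \<subseteq> K'" "z \<in> carrier R"
    and "\<And>y. y \<in> L \<Longrightarrow> z \<otimes> y \<in> L'"
    and surj: "\<And>y. y \<in> K' \<Longrightarrow> \<exists>k\<in>K. z \<otimes> k \<in> K' \<and> y \<ominus> z \<otimes> k \<in> L'"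
  shows "ideal_len R K' L' \<le> ideal_len R K L"
proof (rule ideal_len_least)
  fix n N assume N: "\<forall>i\<le>n. ideal (N i) R \<and> L' \<subseteq> N i \<and> N i \<subseteq> K'" "\<forall>i<n. N i \<subset> N (Suc i)"
  \<comment> \<open>Chains are pulled back: \<open>M i\<close> is the preimage of \<open>N i\<close>
    in \<open>K\<close>. Surjectivity keeps the steps strict.\<close>
  define M where "M i = {y \<in> carrier R. z \<otimes> y \<in> N i} \<inter> K" for i
  show "enat n \<le> ideal_len R K L"
  proof (rule ideal_len_upper[of _ M], intro allI impI)
    fix i assume i: "i \<le> n"
    show "ideal (M i) R \<and> L \<subseteq> M i \<and> M i \<subseteq> K"
    proof (intro conjI)
      show "ideal (M i) R" unfolding M_def using N i assms by (intro i_intersect ideal_colon) auto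
      have "L' \<subseteq> N i" using N i by blast
      then show "L \<subseteq> M i" unfolding M_def using assms ideal_subset_carrier[of L] by blast
    qed (auto simp: M_def)
  next
    show "\<forall>i<n. M i \<subset> M (Suc i)"
    proof (intro allI impI)
      fix i assume i: "i < n"
      then have id: "ideal (N i) R" "L' \<subseteq> N i" "ideal (N (Suc i)) R" "L' \<subseteq> N (Suc i)" "N (Suc i) \<subseteq> K'"
        "N i \<subset> N (Suc i)"
        using N by auto
      then obtain y where y: "y \<in> N (Suc i)" "y \<notin> N i" by blast
      then obtain k where k: "k \<in> K" "y \<ominus> z \<otimes> k \<in> L'" using surj id by blast
      have car: "y \<in> carrier R" "k \<in> carrier R"
        using y k id assms ideal_simps(2) by blast+
      have eq: "z \<otimes> k = y \<ominus> (y \<ominus> z \<otimes> k)" "y = (y \<ominus> z \<otimes> k) \<oplus> z \<otimes> k"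
        using car assms by algebra+
      have "z \<otimes> k \<in> N (Suc i)" using eq(1) y k id ideal_simps(5) by (metis subsetD)
      moreover have "z \<otimes> k \<notin> N i" using eq(2) y k id ideal_simps(3) by (metis subsetD)
      ultimately have "k \<in> M (Suc i)" "k \<notin> M i" unfolding M_def using k car by auto
      moreover have "M i \<subseteq> M (Suc i)" unfolding M_def using id by auto
      ultimately show "M i \<subset> M (Suc i)" by blast
    qed
  qed
qed

lemma ideal_len_inj:
  assumes "ideal K R" "ideal L R" "ideal K' R" "ideal L' R" "L \<subseteq> K" "L' \<subseteq> K'" "z \<in> carrier R"
    and map: "\<And>y. y \<in> K \<Longrightarrow> z \<otimes> y \<in> K'"
    and inj: "\<And>y. y \<in> K \<Longrightarrow> z \<otimes> y \<in> L' \<Longrightarrow> y \<in> L"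
  shows "ideal_len R K L \<le> ideal_len R K' L'"
proof (rule ideal_len_least)
  fix n N assume N: "\<forall>i\<le>n. ideal (N i) R \<and> L \<subseteq> N i \<and> N i \<subseteq> K" "\<forall>i<n. N i \<subset> N (Suc i)"
  \<comment> \<open>Chains are pushed forward: \<open>M i\<close> is the image of \<open>N i\<close>
    together with \<open>L'\<close>. Injectivity keeps the steps strict.\<close>
  define M where "M i = (PIdl z) \<cdot> N i <+> L'" for i
  have zid: "ideal ((PIdl z) \<cdot> N i) R" if "i \<le> n" for i
    using N that assms(7) by (intro ideal_prod_is_ideal cgenideal_ideal) auto
  have zmem: "z \<otimes> y \<in> (PIdl z) \<cdot> N i" if "y \<in> N i" for i y
    using cgenideal_self[OF assms(7)] that by (rule ideal_prod.prod)
  show "enat n \<le> ideal_len R K' L'"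
  proof (rule ideal_len_upper[of _ M])
    show "\<forall>i\<le>n. ideal (M i) R \<and> L' \<subseteq> M i \<and> M i \<subseteq> K'"
    proof (intro allI impI conjI)
      fix i assume i: "i \<le> n"
      show "ideal (M i) R" unfolding M_def by (intro add_ideals zid i assms)
      show "L' \<subseteq> M i" unfolding M_def
        by (intro subset_set_add2 zid i ideal_subset_carrier assms)
      have id: "ideal (N i) R" "N i \<subseteq> K" using N i by auto
      have "(PIdl z) \<cdot> N i \<subseteq> K'"
        using cgenideal_prod_elem[OF assms(7) id(1)] map id(2) by blast
      then show "M i \<subseteq> K'" unfolding M_def by (intro set_add_least assms)
    qed
    show "\<forall>i<n. M i \<subset> M (Suc i)"
    proof (intro allI impI)
      fix i assume i: "i < n"
      then have id: "ideal (N i) R" "L \<subseteq> N i" "ideal (N (Suc i)) R" "N i \<subseteq> K" "N (Suc i) \<subseteq> K" "N i \<subset> N (Suc i)"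
        using N by auto
      then obtain y where y: "y \<in> N (Suc i)" "y \<notin> N i" by blast
      have ycar: "y \<in> carrier R" using y id ideal_simps(2) by blast
      have "z \<otimes> y \<notin> M i"
      proof
        assume "z \<otimes> y \<in> M i"
        then obtain w l where wl: "w \<in> (PIdl z) \<cdot> N i" "l \<in> L'" "z \<otimes> y = w \<oplus> l"
          by (auto simp: M_def set_add_iff)
        then obtain u where ul: "u \<in> N i" "l \<in> L'" "z \<otimes> y = z \<otimes> u \<oplus> l"
          using cgenideal_prod_elem[OF assms(7) id(1)] by blast
        have car: "u \<in> carrier R" "l \<in> carrier R" using ul id assms ideal_simps(2) by blast+
        have "z \<otimes> (y \<ominus> u) = z \<otimes> y \<ominus> z \<otimes> u" using car ycar assms(7) by algebra
        also have "\<dots> = l" unfolding ul(3) using car ycar assms(7) by algebra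
        finally have "z \<otimes> (y \<ominus> u) \<in> L'" using ul by simp
        moreover have "y \<ominus> u \<in> K" using y ul id assms(1) ideal_simps(5) by (meson subsetD)
        ultimately have "y \<ominus> u \<in> N i" using inj id by blast
        then have "(y \<ominus> u) \<oplus> u \<in> N i" using ul id ideal_simps(3) by blast
        moreover have "(y \<ominus> u) \<oplus> u = y" using car ycar by algebra
        ultimately show False using y by simp
      qed
      moreover have "z \<otimes> y \<in> M (Suc i)"
      proof -
        have "z \<otimes> y = z \<otimes> y \<oplus> \<zero>" using ycar assms(7) by simp
        then show ?thesis unfolding M_def set_add_iff
          using zmem[OF y(1)] ideal_simps(1)[OF assms(4)] by blast
      qed
      moreover have "M i \<subseteq> M (Suc i)" unfolding M_def
        using id by (intro set_add_mono ideal_prod_mono) auto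
      ultimately show "M i \<subset> M (Suc i)" by blast
    qed
  qed
qed

text \<open>The second isomorphism theorem on lengths: multiplication by \<open>\<one>\<close> is
  both surjective and injective in the sense of the two preceding lemmas.\<close>

lemma ideal_len_second_iso:
  assumes "ideal A R" "ideal B R"
  shows "ideal_len R (A <+> B) B = ideal_len R A (A \<inter> B)"
proof (rule antisym)
  have sub: "A \<inter> B \<subseteq> A" "B \<subseteq> A <+> B" using assms subset_set_add2 ideal_subset_carrier by blast+
  have id: "ideal (A <+> B) R" "ideal (A \<inter> B) R" using assms add_ideals i_intersect by auto
  show "ideal_len R (A <+> B) B \<le> ideal_len R A (A \<inter> B)"
  proof (rule ideal_len_surj[where z = \<one>])
    fix y assume "y \<in> A <+> B"
    then obtain a b where ab: "a \<in> A" "b \<in> B" "y = a \<oplus> b" by (auto simp: set_add_iff)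
    then have "a \<in> carrier R" "b \<in> carrier R" using assms ideal_simps(2) by blast+
    then have "\<one> \<otimes> a = a" "y \<ominus> \<one> \<otimes> a = b" "a \<in> A <+> B"
      using ab assms subset_set_add1[of B A] ideal_subset_carrier[of A] by (auto, algebra)
    then show "\<exists>k\<in>A. \<one> \<otimes> k \<in> A <+> B \<and> y \<ominus> \<one> \<otimes> k \<in> B" using ab by metis
  qed (use assms sub id ideal_simps in auto)
  show "ideal_len R A (A \<inter> B) \<le> ideal_len R (A <+> B) B"
    by (rule ideal_len_inj[where z = \<one>])
      (use assms sub id ideal_simps subset_set_add1[of B A] ideal_subset_carrier[of A] in auto)
qed

text \<open>The correspondence theorem: submodules of \<open>I / J\<close> match the ideals between
  \<open>J\<close> and \<open>I\<close>, in both directions monotonically. Most of the work is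
  computing the module operations on cosets.\<close>

lemma quot_length_eq:
  assumes I: "ideal I R" and J: "ideal J R" and JI: "J \<subseteq> I"
  shows "quot_length R I J = ideal_len R I J"
proof -
  define Q where "Q = quotient_module (ideal_module R I) J"
  note sI = ideal_simps[OF I] and sJ = ideal_simps[OF J]
  have car: "carrier Q = {J +> y | y. y \<in> I}"
    by (auto simp: Q_def quotient_module_def ideal_module_def A_RCOSETS_def RCOSETS_def
        a_r_coset_def r_coset_def)
  have zero: "\<zero>\<^bsub>Q\<^esub> = J" by (simp add: Q_def quotient_module_def)
  have eq_iff: "J +> x = J +> y \<longleftrightarrow> x \<ominus> y \<in> J" if "x \<in> carrier R" "y \<in> carrier R" for x y
    using quotient_eq_iff_same_a_r_cos[OF J that] by simp
  have Jzero: "J +> \<zero> = J" using a_rcos_zero[OF J] sJ by simp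
  have add: "(J +> x) \<oplus>\<^bsub>Q\<^esub> (J +> y) = J +> (x \<oplus> y)" if "x \<in> I" "y \<in> I" for x y
    using ideal.a_rcos_sum[OF J, of x y] that sI
    by (simp add: Q_def quotient_module_def ideal_module_def set_add_def set_mult_def)
  have smult: "r \<odot>\<^bsub>Q\<^esub> (J +> y) = J +> (r \<otimes> y)" if "r \<in> carrier R" "y \<in> I" for r y
  proof -
    have "y \<in> carrier R" using that sI by blast
    \<comment> \<open>Scalar multiplication is a union over representatives; all members of this
      union are the same coset.\<close>
    have "J +> (r \<otimes> x) = J +> (r \<otimes> y)" if xin: "x \<in> J +> y" for x
    proof -
      obtain j where j: "j \<in> J" "x = j \<oplus> y" using xin unfolding a_r_coset_def' by blast
      then have "j \<in> carrier R" using sJ by blast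
      then have "r \<otimes> x \<ominus> r \<otimes> y = r \<otimes> j" using j \<open>y \<in> carrier R\<close> \<open>r \<in> carrier R\<close> by algebra
      then have "r \<otimes> x \<ominus> r \<otimes> y \<in> J" using sJ j \<open>r \<in> carrier R\<close> by metis
      then show ?thesis using eq_iff j \<open>j \<in> carrier R\<close> \<open>y \<in> carrier R\<close> \<open>r \<in> carrier R\<close> by simp
    qed
    then have "(\<Union>x\<in>J +> y. J +> (r \<otimes> x)) = (\<Union>x\<in>J +> y. J +> (r \<otimes> y))"
      by (intro SUP_cong refl)
    moreover have "J +> y \<noteq> {}" using sJ(1) unfolding a_r_coset_def' by blast
    moreover have "r \<odot>\<^bsub>Q\<^esub> (J +> y) = (\<Union>x\<in>J +> y. J +> (r \<otimes> x))"
      by (simp add: Q_def quotient_module_def ideal_module_def a_r_coset_def r_coset_def)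
    ultimately show ?thesis by (simp only: UN_constant if_False)
  qed
  have grp: "group (add_monoid Q)"
  proof (rule groupI)
    show "\<one>\<^bsub>add_monoid Q\<^esub> \<in> carrier (add_monoid Q)"
      using zero Jzero sI(1) by (auto simp: car)
    fix X assume "X \<in> carrier (add_monoid Q)"
    then obtain x where x: "x \<in> I" "X = J +> x" by (auto simp: car)
    then have xc: "x \<in> carrier R" using sI by blast
    show "\<one>\<^bsub>add_monoid Q\<^esub> \<otimes>\<^bsub>add_monoid Q\<^esub> X = X"
      using x xc sI(1) add[of \<zero> x] zero Jzero by simp
    have "(J +> \<ominus> x) \<oplus>\<^bsub>Q\<^esub> X = J" using x xc sI add[of "\<ominus> x" x] Jzero by (simp add: l_neg)
    then show "\<exists>Y\<in>carrier (add_monoid Q). Y \<otimes>\<^bsub>add_monoid Q\<^esub> X = \<one>\<^bsub>add_monoid Q\<^esub>"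
      using x sI zero by (auto simp: car intro!: exI[of _ "J +> \<ominus> x"])
    fix Y assume "Y \<in> carrier (add_monoid Q)"
    then obtain y where y: "y \<in> I" "Y = J +> y" by (auto simp: car)
    show "X \<otimes>\<^bsub>add_monoid Q\<^esub> Y \<in> carrier (add_monoid Q)"
      using x y add sI by (auto simp: car)
    fix Z assume "Z \<in> carrier (add_monoid Q)"
    then obtain z where z: "z \<in> I" "Z = J +> z" by (auto simp: car)
    show "X \<otimes>\<^bsub>add_monoid Q\<^esub> Y \<otimes>\<^bsub>add_monoid Q\<^esub> Z = X \<otimes>\<^bsub>add_monoid Q\<^esub> (Y \<otimes>\<^bsub>add_monoid Q\<^esub> Z)"
      using x y z add sI by (simp add: a_assoc)
  qed
  \<comment> \<open>\<open>f\<close> takes images and \<open>g\<close> preimages under the quotient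
    map; they turn out to be mutually inverse.\<close>
  define f where "f N = {J +> y | y. y \<in> N}" for N
  define g where "g P = {y \<in> I. J +> y \<in> P}" for P
  have f: "submodule (f N) R Q" if N: "ideal N R" "J \<subseteq> N" "N \<subseteq> I" for N
  proof -
    note sN = ideal_simps[OF N(1)]
    have inN: "y \<in> N \<Longrightarrow> y \<in> I" for y using N by blast
    show ?thesis
    proof (intro submodule.intro submodule_axioms.intro group.subgroupI[OF grp])
      show "f N \<subseteq> carrier (add_monoid Q)" using N by (auto simp: f_def car)
      show "f N \<noteq> {}" using sN(1) by (auto simp: f_def)
      fix X assume "X \<in> f N"
      then obtain x where x: "x \<in> N" "X = J +> x" by (auto simp: f_def)
      then have xc: "x \<in> carrier R" using sN by blast
      have "(J +> \<ominus> x) \<oplus>\<^bsub>Q\<^esub> X = J"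
        using x xc sI sN inN add[of "\<ominus> x" x] Jzero by (simp add: l_neg)
      moreover have "X \<in> carrier Q" "J +> \<ominus> x \<in> carrier Q" using x sN(4) inN unfolding car by blast+
      ultimately have "inv\<^bsub>add_monoid Q\<^esub> X = J +> \<ominus> x"
        using group.inv_equality[OF grp, of "J +> \<ominus> x" X] zero by simp
      then show "inv\<^bsub>add_monoid Q\<^esub> X \<in> f N" using x sN by (auto simp: f_def)
      {
        fix Y assume "Y \<in> f N"
        then obtain y where y: "y \<in> N" "Y = J +> y" by (auto simp: f_def)
        then show "X \<otimes>\<^bsub>add_monoid Q\<^esub> Y \<in> f N" using x add sN inN by (auto simp: f_def)
      }
      fix r assume "r \<in> carrier R"
      then show "r \<odot>\<^bsub>Q\<^esub> X \<in> f N" using x smult sN inN by (auto simp: f_def)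
    qed
  qed
  have g: "ideal (g P) R \<and> J \<subseteq> g P \<and> g P \<subseteq> I" if P: "submodule P R Q" for P
  proof -
    have Psub: "subgroup P (add_monoid Q)" and Psm: "\<And>r X. r \<in> carrier R \<Longrightarrow> X \<in> P \<Longrightarrow> r \<odot>\<^bsub>Q\<^esub> X \<in> P"
      using submodule.axioms(1)[OF P] submodule.smult_closed[OF P] by simp_all
    have JP: "J \<in> P" using subgroup.one_closed[OF Psub] zero by simp
    have "ideal (g P) R"
    proof (rule cring_idealI)
      show "g P \<subseteq> carrier R" using sI by (auto simp: g_def)
      show "\<zero> \<in> g P" using sI JP Jzero by (auto simp: g_def)
      show "x \<oplus> y \<in> g P" if "x \<in> g P" "y \<in> g P" for x y
        using that add sI subgroup.m_closed[OF Psub, of "J +> x" "J +> y"] by (auto simp: g_def)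
      show "r \<otimes> x \<in> g P" if "r \<in> carrier R" "x \<in> g P" for r x
        using that smult sI Psm[of r "J +> x"] by (auto simp: g_def)
    qed
    moreover have "J \<subseteq> g P" using JP JI a_rcos_zero[OF J] by (auto simp: g_def)
    ultimately show ?thesis by (auto simp: g_def)
  qed
  have fg: "f (g P) = P" if P: "submodule P R Q" for P
  proof -
    have "P \<subseteq> carrier Q" using subgroup.subset[OF submodule.axioms(1)[OF P]] by simp
    then show ?thesis by (auto simp: f_def g_def car)
  qed
  have gf: "g (f N) = N" if N: "ideal N R" "J \<subseteq> N" "N \<subseteq> I" for N
  proof
    show "g (f N) \<subseteq> N"
    proof
      fix y assume "y \<in> g (f N)"
      then obtain y' where y: "y \<in> I" "y' \<in> N" "J +> y = J +> y'" by (auto simp: f_def g_def)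
      then have c: "y \<in> carrier R" "y' \<in> carrier R" using sI(2) ideal_simps(2)[OF N(1)] by simp_all
      then have "y \<ominus> y' \<in> N" using y(3) eq_iff[OF c] N(2) by auto
      then have "(y \<ominus> y') \<oplus> y' \<in> N" using ideal_simps(3)[OF N(1)] y(2) by simp
      moreover have "(y \<ominus> y') \<oplus> y' = y" using c by algebra
      ultimately show "y \<in> N" by simp
    qed
    show "N \<subseteq> g (f N)" using N by (auto simp: f_def g_def)
  qed
  have fmono: "f N \<subseteq> f N'" if "N \<subseteq> N'" for N N' using that by (auto simp: f_def)
  have gmono: "g N \<subseteq> g N'" if "N \<subseteq> N'" for N N' using that by (auto simp: g_def)
  have "(\<exists>P. (\<forall>i\<le>n. submodule (P i) R Q) \<and> (\<forall>i<n. P i \<subset> P (Suc i))) \<longleftrightarrow>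
        (\<exists>N. (\<forall>i\<le>n. ideal (N i) R \<and> J \<subseteq> N i \<and> N i \<subseteq> I) \<and> (\<forall>i<n. N i \<subset> N (Suc i)))" for n :: nat
  proof
    assume "\<exists>P. (\<forall>i\<le>n. submodule (P i) R Q) \<and> (\<forall>i<n. P i \<subset> P (Suc i))"
    then obtain P where P: "\<forall>i\<le>n. submodule (P i) R Q" "\<forall>i<n. P i \<subset> P (Suc i)" by blast
    have "g (P i) \<subset> g (P (Suc i))" if "i < n" for i
    proof -
      have "f (g (P i)) = P i" "f (g (P (Suc i))) = P (Suc i)" "P i \<subset> P (Suc i)" using that P fg by auto
      then show ?thesis using gmono by (metis psubset_eq)
    qed
    then show "\<exists>N. (\<forall>i\<le>n. ideal (N i) R \<and> J \<subseteq> N i \<and> N i \<subseteq> I) \<and> (\<forall>i<n. N i \<subset> N (Suc i))"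
      using g P by (intro exI[of _ "\<lambda>i. g (P i)"]) simp
  next
    assume "\<exists>N. (\<forall>i\<le>n. ideal (N i) R \<and> J \<subseteq> N i \<and> N i \<subseteq> I) \<and> (\<forall>i<n. N i \<subset> N (Suc i))"
    then obtain N where N: "\<forall>i\<le>n. ideal (N i) R \<and> J \<subseteq> N i \<and> N i \<subseteq> I" "\<forall>i<n. N i \<subset> N (Suc i)" by blast
    have "f (N i) \<subset> f (N (Suc i))" if "i < n" for i
    proof -
      have "g (f (N i)) = N i" "g (f (N (Suc i))) = N (Suc i)" "N i \<subset> N (Suc i)" using that N gf by auto
      then show ?thesis using fmono by (metis psubset_eq)
    qed
    then show "\<exists>P. (\<forall>i\<le>n. submodule (P i) R Q) \<and> (\<forall>i<n. P i \<subset> P (Suc i))"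
      using f N by (intro exI[of _ "\<lambda>i. f (N i)"]) simp
  qed
  then show ?thesis unfolding quot_length_def module_length_def ideal_len_def Q_def[symmetric] by simp
qed

section \<open>Criteria for finite length\<close>

lemma ideal_set_add_upper:
  assumes "ideal A R" "ideal B R"
  shows "A \<subseteq> A <+> B" "B \<subseteq> A <+> B"
  using subset_set_add1[OF assms(2)] subset_set_add2[OF assms(1)] assms ideal_subset_carrier
  by simp_all

lemma ideal_len_mono:
  assumes "J' \<subseteq> J" "K \<subseteq> K'"
  shows "ideal_len R K J \<le> ideal_len R K' J'"
proof (rule ideal_len_least)
  fix n N assume "\<forall>i\<le>n. ideal (N i) R \<and> J \<subseteq> N i \<and> N i \<subseteq> K" "\<forall>i<n. N i \<subset> N (Suc i)"
  then show "enat n \<le> ideal_len R K' J'" using assms by (intro ideal_len_upper[of n N]) blast+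
qed

lemma ideal_len_finite_trans:
  assumes "ideal J R" "ideal K R" "ideal L R" "J \<subseteq> K" "K \<subseteq> L"
    and "ideal_len R L K \<noteq> \<infinity>" "ideal_len R K J \<noteq> \<infinity>"
  shows "ideal_len R L J \<noteq> \<infinity>"
  using ideal_len_add[OF assms(1-5)] assms(6,7) by auto

lemma ideal_len_maximal:
  assumes "maximalideal M R"
  shows "ideal_len R (carrier R) M \<le> 1"
proof (rule ideal_len_least)
  fix n N assume N: "\<forall>i\<le>n. ideal (N i) R \<and> M \<subseteq> N i \<and> N i \<subseteq> carrier R" "\<forall>i<n. N i \<subset> N (Suc i)"
  have dich: "N i = M \<or> N i = carrier R" if "i \<le> n" for i
    using maximalideal.I_maximal[OF assms] N that by blast
  have "n \<le> 1"
  proof (rule ccontr)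
    assume "\<not> n \<le> 1"
    then have "N 0 \<subset> N 1" "N 1 \<subset> N 2" "N 0 = M \<or> N 0 = carrier R" "N 1 = M \<or> N 1 = carrier R"
      "N 2 = M \<or> N 2 = carrier R" "M \<subseteq> carrier R"
      using N(2)[rule_format, of 0] N(2)[rule_format, of 1] dich N(1)
      by (auto simp: numeral_2_eq_2)
    then show False by auto
  qed
  then show "enat n \<le> 1" by (simp add: one_enat_def)
qed

lemma genideal_insert_eq:
  assumes "A \<subseteq> carrier R" "z \<in> carrier R"
  shows "Idl (insert z A) = Idl A <+> PIdl z"
proof -
  have id: "ideal (Idl A) R" "ideal (PIdl z) R" using assms genideal_ideal cgenideal_ideal by auto
  have z: "z \<in> Idl (insert z A)" "A \<subseteq> Idl (insert z A)" "ideal (Idl (insert z A)) R"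
    using assms genideal_ideal genideal_self[of "insert z A"] by auto
  show ?thesis
  proof
    show "Idl (insert z A) \<subseteq> Idl A <+> PIdl z"
      using genideal_self[OF assms(1)] cgenideal_self[OF assms(2)] ideal_set_add_upper[OF id]
      by (intro genideal_minimal add_ideals id) auto
    show "Idl A <+> PIdl z \<subseteq> Idl (insert z A)"
      using z by (intro set_add_least genideal_minimal cgenideal_minimal) auto
  qed
qed

lemma genideal_insertD:
  assumes "A \<subseteq> carrier R" "z \<in> carrier R" "y \<in> Idl (insert z A)"
  shows "\<exists>r\<in>carrier R. y \<ominus> r \<otimes> z \<in> Idl A"
proof -
  obtain a r where ar: "a \<in> Idl A" "r \<in> carrier R" "y = a \<oplus> r \<otimes> z"
    using assms(3) unfolding genideal_insert_eq[OF assms(1,2)] set_add_iff cgenideal_def by blast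
  moreover have "a \<in> carrier R" using ar ideal_simps(2) genideal_ideal[OF assms(1)] by blast
  then have "y \<ominus> r \<otimes> z = a" unfolding ar(3) using ar assms by algebra
  ultimately show ?thesis by metis
qed

text \<open>Multiplication by \<open>z\<close> maps \<open>R / M\<close> onto this cyclic quotient,
  and \<open>R / M\<close> has length at most 1.\<close>

lemma ideal_len_insert_le:
  assumes "maximalideal M R" "A \<subseteq> carrier R" "z \<in> carrier R" "\<And>y. y \<in> M \<Longrightarrow> z \<otimes> y \<in> Idl A"
  shows "ideal_len R (Idl (insert z A)) (Idl A) \<le> 1"
proof -
  have id: "ideal (Idl A) R" "ideal (Idl (insert z A)) R" "A \<subseteq> Idl (insert z A)" "z \<in> Idl (insert z A)"
    using assms genideal_ideal genideal_self[of "insert z A"] by auto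
  interpret M: maximalideal M R by fact
  have "ideal_len R (Idl (insert z A)) (Idl A) \<le> ideal_len R (carrier R) M"
  proof (rule ideal_len_surj[where z = z])
    show "Idl A \<subseteq> Idl (insert z A)" using id genideal_minimal by blast
    fix y assume y: "y \<in> Idl (insert z A)"
    then obtain r where "r \<in> carrier R" "y \<ominus> r \<otimes> z \<in> Idl A"
      using genideal_insertD assms(2,3) by blast
    then show "\<exists>k\<in>carrier R. z \<otimes> k \<in> Idl (insert z A) \<and> y \<ominus> z \<otimes> k \<in> Idl A"
      using ideal_simps(7)[OF id(2,4), of r] assms(3) by (metis m_comm)
  qed (use assms id M.is_ideal oneideal M.a_subset in auto)
  also have "\<dots> \<le> 1" using assms(1) by (rule ideal_len_maximal)
  finally show ?thesis .
qed

text \<open>Adjoining the generators one at a time adds at most 1 to the length at each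
  step.\<close>

lemma ideal_len_generated_finite:
  assumes "maximalideal M R" "finite A" "A \<subseteq> carrier R" "ideal J R"
    and "\<And>z y. z \<in> A \<Longrightarrow> y \<in> M \<Longrightarrow> z \<otimes> y \<in> J"
  shows "ideal_len R (Idl (A \<union> J)) J \<noteq> \<infinity>"
  using assms(2,3,5)
proof (induction A)
  case empty
  have "Idl J = J" using assms(4) by (metis genideal_minimal genideal_self ideal_subset_carrier subset_antisym order_refl)
  then show ?case by (simp add: ideal_len_refl)
next
  case (insert z A)
  have car: "A \<union> J \<subseteq> carrier R" using insert.prems ideal_subset_carrier[OF assms(4)] by auto
  have sub: "J \<subseteq> Idl (A \<union> J)" "Idl (A \<union> J) \<subseteq> Idl (insert z (A \<union> J))"
    using genideal_self[OF car] subset_Idl_subset[of "insert z (A \<union> J)" "A \<union> J"] car insert.prems by auto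
  have "ideal_len R (Idl (insert z (A \<union> J))) (Idl (A \<union> J)) \<le> 1"
    using car insert.prems sub by (intro ideal_len_insert_le[OF assms(1)]) auto
  then have "ideal_len R (Idl (insert z (A \<union> J))) (Idl (A \<union> J)) \<noteq> \<infinity>"
    by (metis enat_ord_simps(5) infinity_ne_i1)
  moreover have "ideal_len R (Idl (A \<union> J)) J \<noteq> \<infinity>" using insert by auto
  ultimately show ?case
    using ideal_len_finite_trans[OF assms(4) _ _ sub] genideal_ideal car insert.prems by simp
qed

end

section \<open>Hilbert functions\<close>

text \<open>Compatibility with addition makes the lexicographic order a monomial order.\<close>

lemma list_add_less:
  fixes \<alpha> \<beta> \<gamma> :: "nat list"
  assumes "length \<alpha> = length \<gamma>" "length \<beta> = length \<gamma>" "\<alpha> < \<beta>"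
  shows "map2 (+) \<gamma> \<alpha> < map2 (+) \<gamma> \<beta>"
  using assms
proof (induction \<gamma> arbitrary: \<alpha> \<beta>)
  case (Cons c \<gamma>)
  then show ?case by (cases \<alpha>; cases \<beta>) auto
qed simp

lemma sum_list_add:
  fixes \<alpha> \<beta> :: "nat list"
  assumes "length \<alpha> = length \<beta>"
  shows "sum_list (map2 (+) \<alpha> \<beta>) = sum_list \<alpha> + sum_list \<beta>"
  using assms by (induction \<alpha> \<beta> rule: list_induct2) auto

lemma list_add_comps:
  assumes "\<alpha> \<in> comps g n" "\<beta> \<in> comps g m"
  shows "map2 (+) \<alpha> \<beta> \<in> comps g (n + m)"
  using assms sum_list_add[of \<alpha> \<beta>] by (auto simp: comps_def)

lemma list_diff_exists:
  fixes \<alpha> \<beta> :: "nat list"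
  assumes "list_all2 (\<le>) \<alpha> \<beta>"
  shows "\<exists>\<gamma>. length \<gamma> = length \<alpha> \<and> \<beta> = map2 (+) \<gamma> \<alpha>"
  using assms
proof (induction rule: list_all2_induct)
  case (Cons a \<alpha> b \<beta>)
  then obtain \<gamma> where "length \<gamma> = length \<alpha>" "\<beta> = map2 (+) \<gamma> \<alpha>" by blast
  with Cons show ?case by (intro exI[of _ "(b - a) # \<gamma>"]) auto
qed simp

lemma sum_enat_finite:
  assumes "\<And>x. x \<in> S \<Longrightarrow> f x \<noteq> (\<infinity>::enat)"
  shows "(\<Sum>x\<in>S. f x) = enat (\<Sum>x\<in>S. the_enat (f x))"
proof (cases "finite S")
  case True
  then show ?thesis using assms
  proof (induction S rule: finite_induct)
    case (insert x S)
    then obtain k where "f x = enat k" by (meson insertI1 not_infinity_eq)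
    with insert show ?case by simp
  qed (simp add: enat_0)
qed (simp add: enat_0)

text \<open>Surplus entries of the longer list are ignored, so \<open>mon_closed\<close> needs no
  condition on lengths.\<close>

fun mon :: "('a, 'b) ring_scheme \<Rightarrow> 'a list \<Rightarrow> nat list \<Rightarrow> 'a" where
  "mon R (z # zs) (k # ks) = (z [^]\<^bsub>R\<^esub> k) \<otimes>\<^bsub>R\<^esub> mon R zs ks"
| "mon R _ _ = \<one>\<^bsub>R\<^esub>"

context cring
begin

lemma mon_closed: "set zs \<subseteq> carrier R \<Longrightarrow> mon R zs \<alpha> \<in> carrier R"
proof (induction zs arbitrary: \<alpha>)
  case (Cons z zs)
  then show ?case by (cases \<alpha>) auto
qed simp

lemma mon_add:
  assumes "set zs \<subseteq> carrier R" "length \<alpha> = length zs" "length \<beta> = length zs"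
  shows "mon R zs (map2 (+) \<alpha> \<beta>) = mon R zs \<alpha> \<otimes> mon R zs \<beta>"
  using assms
proof (induction zs arbitrary: \<alpha> \<beta>)
  case (Cons z zs)
  then obtain k \<alpha>' l \<beta>' where "\<alpha> = k # \<alpha>'" "\<beta> = l # \<beta>'" by (metis length_Suc_conv)
  with Cons show ?case using mon_closed[of zs] by (simp add: nat_pow_mult[symmetric] m_ac)
qed simp

lemma mon_replicate_zero: "set zs \<subseteq> carrier R \<Longrightarrow> mon R zs (replicate (length zs) 0) = \<one>"
  by (induction zs) auto

lemma mon_unit:
  assumes "set zs \<subseteq> carrier R" "z \<in> set zs"
  shows "\<exists>\<gamma>\<in>comps (length zs) 1. mon R zs \<gamma> = z"
  using assms
proof (induction zs)
  case (Cons w zs)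
  show ?case
  proof (cases "z = w")
    case True
    then show ?thesis using Cons.prems
      by (intro bexI[of _ "1 # replicate (length zs) 0"]) (auto simp: mon_replicate_zero comps_def sum_list_replicate)
  next
    case False
    then obtain \<gamma> where "\<gamma> \<in> comps (length zs) 1" "mon R zs \<gamma> = z" using Cons by auto
    then show ?thesis using Cons.prems by (intro bexI[of _ "0 # \<gamma>"]) (auto simp: comps_def)
  qed
qed simp

lemma mon_graded:
  assumes "set zs \<subseteq> carrier R" "\<And>n. ideal (V n) R"
    and V: "\<And>z v n. z \<in> set zs \<Longrightarrow> v \<in> V n \<Longrightarrow> z \<otimes> v \<in> V (Suc n)"
    and "length \<gamma> = length zs" "v \<in> V n"
  shows "mon R zs \<gamma> \<otimes> v \<in> V (n + sum_list \<gamma>)"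
  using assms(1,3-5)
proof (induction zs arbitrary: \<gamma> n v)
  case (Cons z zs)
  have Vc: "x \<in> V m \<Longrightarrow> x \<in> carrier R" for x m using assms(2) ideal_simps(2) by blast
  obtain k \<gamma>' where \<gamma>: "\<gamma> = k # \<gamma>'" "length \<gamma>' = length zs" using Cons.prems(3) by (metis length_Suc_conv)
  have pow: "z [^] k \<otimes> x \<in> V (m + k)" if "x \<in> V m" for k m x
  proof (induction k)
    case (Suc k)
    have "z [^] Suc k \<otimes> x = z \<otimes> (z [^] k \<otimes> x)" using Vc[OF that] Cons.prems(1) by (simp add: m_ac)
    then show ?case using Cons.prems(2) Suc by simp
  qed (use that Vc in simp)
  have "mon R zs \<gamma>' \<otimes> v \<in> V (n + sum_list \<gamma>')" using Cons \<gamma> by auto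
  from pow[OF this, of k] show ?case
    using \<gamma> mon_closed[of zs] Cons.prems(1) Vc[OF Cons.prems(4)] by (simp add: m_assoc add_ac)
qed (use ideal_simps(2)[OF assms(2)] in simp)

text \<open>Adjoining the generators in increasing order of their indices filters the quotient by
  cyclic steps, whose lengths add up.\<close>

lemma ideal_len_sum:
  fixes S :: "('c :: linorder) set"
  assumes "finite S" "e ` S \<subseteq> carrier R" "ideal V R"
  shows "ideal_len R (Idl (V \<union> e ` S)) V =
    (\<Sum>\<alpha>\<in>S. ideal_len R (Idl (V \<union> e ` {\<beta>\<in>S. \<beta> \<le> \<alpha>})) (Idl (V \<union> e ` {\<beta>\<in>S. \<beta> < \<alpha>})))"
  using assms(1,2)
proof (induction S rule: finite_linorder_max_induct)
  case empty
  have "Idl V = V"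
    using assms(3) by (metis genideal_minimal genideal_self ideal_subset_carrier subset_antisym order_refl)
  then show ?case by (simp add: ideal_len_refl)
next
  case (insert b A)
  have sets: "{\<beta> \<in> insert b A. \<beta> \<le> \<alpha>} = {\<beta> \<in> A. \<beta> \<le> \<alpha>}" "{\<beta> \<in> insert b A. \<beta> < \<alpha>} = {\<beta> \<in> A. \<beta> < \<alpha>}"
    if "\<alpha> \<in> A" for \<alpha> using insert.hyps that by force+
  have setb: "{\<beta> \<in> insert b A. \<beta> \<le> b} = insert b A" "{\<beta> \<in> insert b A. \<beta> < b} = A"
    using insert.hyps by (auto simp: less_le)
  have car: "V \<union> e ` insert b A \<subseteq> carrier R" using insert.prems assms(3) ideal_subset_carrier by blast
  have "ideal_len R (Idl (V \<union> e ` insert b A)) V =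
      ideal_len R (Idl (V \<union> e ` insert b A)) (Idl (V \<union> e ` A)) + ideal_len R (Idl (V \<union> e ` A)) V"
  proof (rule ideal_len_add)
    show "V \<subseteq> Idl (V \<union> e ` A)" using genideal_self[of "V \<union> e ` A"] car by auto
    show "Idl (V \<union> e ` A) \<subseteq> Idl (V \<union> e ` insert b A)" using car by (intro subset_Idl_subset) auto
  qed (use car assms(3) genideal_ideal in auto)
  moreover have "b \<notin> A" using insert.hyps by blast
  ultimately show ?case using insert sets setb by simp
qed

text \<open>The leading-monomial argument: for exponents \<open>\<alpha>\<close> in lexicographic order, the length of the
  step of the filtration belonging to \<open>\<alpha>\<close> is antitone in \<open>\<alpha>\<close>.\<close>

theorem graded_length_ev_poly:
  assumes zs: "set zs \<subseteq> carrier R" and Vid: "\<And>n. ideal (V n) R"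
    and V: "\<And>z v n. z \<in> set zs \<Longrightarrow> v \<in> V n \<Longrightarrow> z \<otimes> v \<in> V (Suc n)"
  defines "U \<equiv> \<lambda>n. Idl (V n \<union> mon R zs ` comps (length zs) n)"
  assumes fin: "\<And>n. ideal_len R (U n) (V n) \<noteq> \<infinity>"
    and growth: "poly_growth D (\<lambda>n. int (the_enat (ideal_len R (U n) (V n))))"
  shows "ev_poly D (\<lambda>n. int (the_enat (ideal_len R (U n) (V n))))"
proof -
  let ?g = "length zs"
  let ?m = "mon R zs"
  have mcar: "?m \<alpha> \<in> carrier R" for \<alpha> using mon_closed[OF zs] .
  \<comment> \<open>\<open>F \<alpha>\<close> holds the monomials of the same degree strictly below
    \<open>\<alpha>\<close>, and \<open>G \<alpha>\<close> admits \<open>\<alpha>\<close> too;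
    \<open>G \<alpha> / F \<alpha>\<close> is the cyclic step belonging to
    \<open>\<alpha>\<close>.\<close>
  define F where "F \<alpha> = Idl (V (sum_list \<alpha>) \<union> ?m ` {\<beta> \<in> comps ?g (sum_list \<alpha>). \<beta> < \<alpha>})" for \<alpha>
  define G where "G \<alpha> = Idl (V (sum_list \<alpha>) \<union> ?m ` {\<beta> \<in> comps ?g (sum_list \<alpha>). \<beta> \<le> \<alpha>})" for \<alpha>
  have genF: "V (sum_list \<alpha>) \<union> ?m ` {\<beta> \<in> comps ?g (sum_list \<alpha>). \<beta> < \<alpha>} \<subseteq> carrier R"
    and genG: "V (sum_list \<alpha>) \<union> ?m ` {\<beta> \<in> comps ?g (sum_list \<alpha>). \<beta> \<le> \<alpha>} \<subseteq> carrier R" for \<alpha>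
    using mcar ideal_subset_carrier[OF Vid] by auto
  have idF: "ideal (F \<alpha>) R" and idG: "ideal (G \<alpha>) R" for \<alpha>
    unfolding F_def G_def using genF genG genideal_ideal by auto
  have FG: "F \<alpha> \<subseteq> G \<alpha>" for \<alpha>
    unfolding F_def G_def using genG by (intro subset_Idl_subset) auto
  have VF: "V (sum_list \<alpha>) \<subseteq> F \<alpha>" for \<alpha> unfolding F_def using genideal_self[OF genF] by auto
  define lam where "lam \<alpha> = the_enat (ideal_len R (G \<alpha>) (F \<alpha>))" for \<alpha>
  have GU: "G \<alpha> \<subseteq> U (sum_list \<alpha>)" for \<alpha>
    unfolding G_def U_def
  proof (intro subset_Idl_subset)
    show "V (sum_list \<alpha>) \<union> mon R zs ` comps (length zs) (sum_list \<alpha>) \<subseteq> carrier R"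
      using mcar ideal_subset_carrier[OF Vid] by auto
  qed auto
  have finGF: "ideal_len R (G \<alpha>) (F \<alpha>) \<noteq> \<infinity>" for \<alpha>
    using ideal_len_mono[OF VF GU, of \<alpha> \<alpha>] fin[of "sum_list \<alpha>"] by (metis enat_ord_simps(5))
  have total: "the_enat (ideal_len R (U n) (V n)) = (\<Sum>\<alpha>\<in>comps ?g n. lam \<alpha>)" for n
  proof -
    have "ideal_len R (U n) (V n) = (\<Sum>\<alpha>\<in>comps ?g n. ideal_len R (G \<alpha>) (F \<alpha>))"
      unfolding U_def
      by (subst ideal_len_sum) (use mcar Vid finite_comps in \<open>auto simp: F_def G_def comps_def intro!: sum.cong\<close>)
    also have "\<dots> = enat (\<Sum>\<alpha>\<in>comps ?g n. lam \<alpha>)"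
      unfolding lam_def by (rule sum_enat_finite) (rule finGF)
    finally show ?thesis by simp
  qed
  have "antitone_lists ?g lam"
    unfolding antitone_lists_def
  proof (intro allI impI)
    fix \<alpha> \<beta> :: "nat list" assume len: "length \<alpha> = ?g" and le: "list_all2 (\<le>) \<alpha> \<beta>"
    \<comment> \<open>\<open>\<gamma>\<close> is the exponent of the quotient monomial.
      Multiplication by \<open>?w\<close> preserves the order, so it carries the ideal below
      \<open>\<alpha>\<close> into the ideal below \<open>\<beta>\<close>.\<close>
    obtain \<gamma> where \<gamma>: "length \<gamma> = ?g" "\<beta> = map2 (+) \<gamma> \<alpha>" using list_diff_exists[OF le] len by auto
    let ?w = "?m \<gamma>"
    have wc: "?w \<in> carrier R" by (rule mcar)
    have sum\<beta>: "sum_list \<beta> = sum_list \<alpha> + sum_list \<gamma>" using sum_list_add[of \<gamma> \<alpha>] \<gamma> len by simp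
    have len\<beta>: "length \<beta> = ?g" using \<gamma> len by simp
    have wm: "?w \<otimes> ?m \<delta> = ?m (map2 (+) \<gamma> \<delta>)" if "length \<delta> = ?g" for \<delta>
      using mon_add[OF zs \<gamma>(1) that] by simp
    have comp: "map2 (+) \<gamma> \<delta> \<in> comps ?g (sum_list \<beta>)" if "\<delta> \<in> comps ?g (sum_list \<alpha>)" for \<delta>
      using list_add_comps[of \<gamma> ?g "sum_list \<gamma>" \<delta> "sum_list \<alpha>"] that \<gamma> sum\<beta> by (simp add: comps_def add.commute)
    have wV: "?w \<otimes> v \<in> V (sum_list \<beta>)" if "v \<in> V (sum_list \<alpha>)" for v
      using mon_graded[OF zs Vid V \<gamma>(1) that] sum\<beta> by simp
    have wF: "F \<alpha> \<subseteq> {y \<in> carrier R. ?w \<otimes> y \<in> F \<beta>}"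
      unfolding F_def[of \<alpha>]
    proof (rule genideal_minimal[OF ideal_colon[OF idF wc]])
      have "?w \<otimes> ?m \<delta> \<in> F \<beta>" if "\<delta> \<in> comps ?g (sum_list \<alpha>)" "\<delta> < \<alpha>" for \<delta>
      proof -
        have l: "length \<delta> = ?g" using that by (simp add: comps_def)
        have "map2 (+) \<gamma> \<delta> < \<beta>" using list_add_less[of \<delta> \<gamma> \<alpha>] that l len \<gamma> by simp
        then show ?thesis unfolding wm[OF l] F_def[of \<beta>]
          using genideal_self[OF genF, of \<beta>] comp[OF that(1)] by auto
      qed
      then show "V (sum_list \<alpha>) \<union> ?m ` {\<beta> \<in> comps ?g (sum_list \<alpha>). \<beta> < \<alpha>}
          \<subseteq> {y \<in> carrier R. ?w \<otimes> y \<in> F \<beta>}"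
        using genF[of \<alpha>] wV VF[of \<beta>] by auto
    qed
    have \<alpha>\<alpha>: "\<alpha> \<in> comps ?g (sum_list \<alpha>)" using len by (simp add: comps_def)
    have m\<alpha>: "?m \<alpha> \<in> G \<alpha>" unfolding G_def using genideal_self[OF genG, of \<alpha>] \<alpha>\<alpha> by auto
    have m\<beta>: "?w \<otimes> ?m \<alpha> = ?m \<beta>" using wm[OF len] \<gamma> by simp
    have "?m \<beta> \<in> G \<beta>" unfolding G_def using genideal_self[OF genG, of \<beta>] len\<beta> by (auto simp: comps_def)
    have Ginsert: "G \<beta> = Idl (insert (?m \<beta>) (V (sum_list \<beta>) \<union> ?m ` {\<delta> \<in> comps ?g (sum_list \<beta>). \<delta> < \<beta>}))"
    proof -
      have "{\<delta> \<in> comps ?g (sum_list \<beta>). \<delta> \<le> \<beta>} = insert \<beta> {\<delta> \<in> comps ?g (sum_list \<beta>). \<delta> < \<beta>}"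
        using len\<beta> by (auto simp: comps_def le_less)
      then show ?thesis unfolding G_def by simp
    qed
    \<comment> \<open>Modulo \<open>F \<beta>\<close> the ideal \<open>G \<beta>\<close> is
      generated by \<open>?m \<beta> = ?w \<otimes> ?m \<alpha>\<close>, so multiplication by
      \<open>?w\<close> maps the step at \<open>\<alpha>\<close> onto the step at
      \<open>\<beta>\<close>.\<close>
    have "ideal_len R (G \<beta>) (F \<beta>) \<le> ideal_len R (G \<alpha>) (F \<alpha>)"
    proof (rule ideal_len_surj[where z = ?w])
      show "?w \<otimes> y \<in> F \<beta>" if "y \<in> F \<alpha>" for y using wF that by auto
      fix y assume "y \<in> G \<beta>"
      then obtain r where r: "r \<in> carrier R" "y \<ominus> r \<otimes> ?m \<beta> \<in> F \<beta>"
        using genideal_insertD[OF genF mcar] unfolding Ginsert F_def by blast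
      have eq: "?w \<otimes> (r \<otimes> ?m \<alpha>) = r \<otimes> ?m \<beta>"
        unfolding m\<beta>[symmetric] using r(1) mcar by (simp add: m_lcomm)
      show "\<exists>k\<in>G \<alpha>. ?w \<otimes> k \<in> G \<beta> \<and> y \<ominus> ?w \<otimes> k \<in> F \<beta>"
      proof (intro bexI conjI)
        show "r \<otimes> ?m \<alpha> \<in> G \<alpha>" using ideal_simps(6)[OF idG] m\<alpha> r by blast
        show "?w \<otimes> (r \<otimes> ?m \<alpha>) \<in> G \<beta>" unfolding eq using ideal_simps(6)[OF idG] \<open>?m \<beta> \<in> G \<beta>\<close> r by blast
        show "y \<ominus> ?w \<otimes> (r \<otimes> ?m \<alpha>) \<in> F \<beta>" unfolding eq by (rule r)
      qed
    qed (use idF idG FG wc in auto)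
    then show "lam \<beta> \<le> lam \<alpha>"
      unfolding lam_def using finGF[of \<alpha>] finGF[of \<beta>] by auto
  qed
  then show ?thesis using antitone_sum_ev_poly[of ?g lam D] growth unfolding total by blast
qed

subsection \<open>Powers of ideals\<close>

lemma ideal_pow_ideal: "ideal I R \<Longrightarrow> ideal (ideal_pow R I n) R"
  using monoid.nat_pow_closed[OF comm_monoid.axioms(1)[OF ideals_set_is_comm_monoid], of I n]
  by (simp add: ideals_set_def)

lemma ideal_pow_0: "ideal_pow R I 0 = carrier R"
  using monoid.nat_pow_0[OF comm_monoid.axioms(1)[OF ideals_set_is_comm_monoid]]
  by (simp add: ideals_set_def)

lemma ideal_pow_Suc: "ideal_pow R I (Suc n) = ideal_pow R I n \<cdot> I"
  using monoid.nat_pow_Suc[OF comm_monoid.axioms(1)[OF ideals_set_is_comm_monoid]]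
  by (simp add: ideals_set_def)

lemma ideal_pow_Suc2: "ideal I R \<Longrightarrow> ideal_pow R I (Suc n) = I \<cdot> ideal_pow R I n"
  unfolding ideal_pow_Suc by (rule ideal_prod_commute[OF ideal_pow_ideal])

lemma ideal_pow_add:
  assumes "ideal I R"
  shows "ideal_pow R I (m + n) = ideal_pow R I m \<cdot> ideal_pow R I n"
proof (induction n)
  case 0
  show ?case by (simp only: add_0_right ideal_pow_0 ideal_prod_one[OF ideal_pow_ideal[OF assms]])
next
  case (Suc n)
  then show ?case
    by (simp only: add_Suc_right ideal_pow_Suc ideal_prod_assoc[OF ideal_pow_ideal[OF assms] ideal_pow_ideal[OF assms] assms])
qed

lemma ideal_prod_least:
  assumes "ideal C R" "\<And>a b. a \<in> A \<Longrightarrow> b \<in> B \<Longrightarrow> a \<otimes> b \<in> C"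
  shows "A \<cdot> B \<subseteq> C"
proof
  fix x assume "x \<in> A \<cdot> B"
  then show "x \<in> C"
    by (induction x rule: ideal_prod.induct) (use assms ideal_simps(3) in auto)
qed

lemma ideal_pow_mono: "I \<subseteq> J \<Longrightarrow> ideal_pow R I n \<subseteq> ideal_pow R J n"
proof (induction n)
  case (Suc n)
  then show ?case unfolding ideal_pow_Suc by (blast intro: ideal_prod_mono[THEN subsetD])
qed (simp only: ideal_pow_0)

lemma ideal_pow_antimono:
  assumes "ideal I R" "m \<le> n"
  shows "ideal_pow R I n \<subseteq> ideal_pow R I m"
proof -
  have "ideal_pow R I n = ideal_pow R I m \<cdot> ideal_pow R I (n - m)"
    using ideal_pow_add[OF assms(1), of m "n - m"] assms(2) by simp
  also have "\<dots> \<subseteq> ideal_pow R I m" using ideal_prod_inter assms(1) ideal_pow_ideal by blast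
  finally show ?thesis .
qed

lemma ideal_pow_pow:
  assumes "ideal I R"
  shows "ideal_pow R (ideal_pow R I m) n = ideal_pow R I (m * n)"
proof (induction n)
  case (Suc n)
  then show ?case
    by (simp only: ideal_pow_Suc ideal_pow_add[OF assms, symmetric] mult_Suc_right add.commute)
qed (simp only: ideal_pow_0 mult_0_right)

text \<open>With one factor fixed, the admissible other factors form a colon ideal, which contains a
  generated ideal as soon as it contains the generators. This is applied once to each
  factor.\<close>

lemma genideal_prod_least:
  assumes "ideal C R" "A \<subseteq> carrier R" "B \<subseteq> carrier R" "\<And>a b. a \<in> A \<Longrightarrow> b \<in> B \<Longrightarrow> a \<otimes> b \<in> C"
  shows "(Idl A) \<cdot> (Idl B) \<subseteq> C"
proof (rule ideal_prod_least[OF assms(1)])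
  fix a b assume ab: "a \<in> Idl A" "b \<in> Idl B"
  have car: "a \<in> carrier R" using ab assms genideal_ideal ideal_simps(2) by blast
  have "a \<otimes> b' \<in> C" if b': "b' \<in> B" for b'
  proof -
    have car': "b' \<in> carrier R" using b' assms by blast
    have "A \<subseteq> {y \<in> carrier R. b' \<otimes> y \<in> C}"
    proof
      fix y assume "y \<in> A"
      then have "y \<in> carrier R" "y \<otimes> b' \<in> C" using assms b' by auto
      then show "y \<in> {y \<in> carrier R. b' \<otimes> y \<in> C}" using m_comm[OF _ car'] by simp
    qed
    then have "Idl A \<subseteq> {y \<in> carrier R. b' \<otimes> y \<in> C}"
      by (rule genideal_minimal[OF ideal_colon[OF assms(1) car']])
    then show ?thesis using ab(1) m_comm[OF car car'] by auto
  qed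
  then have "B \<subseteq> {y \<in> carrier R. a \<otimes> y \<in> C}" using assms(3) by auto
  then have "Idl B \<subseteq> {y \<in> carrier R. a \<otimes> y \<in> C}"
    by (rule genideal_minimal[OF ideal_colon[OF assms(1) car]])
  then show "a \<otimes> b \<in> C" using ab by blast
qed

lemma mon_in_pow:
  assumes "set zs \<subseteq> carrier R" "length \<alpha> = length zs"
  shows "mon R zs \<alpha> \<in> ideal_pow R (Idl (set zs)) (sum_list \<alpha>)"
proof -
  have id: "ideal (Idl (set zs)) R" using assms genideal_ideal by blast
  have "mon R zs \<alpha> \<otimes> \<one> \<in> ideal_pow R (Idl (set zs)) (0 + sum_list \<alpha>)"
  proof (rule mon_graded[OF assms(1) _ _ assms(2)])
    show "ideal (ideal_pow R (Idl (set zs)) n) R" for n using id by (rule ideal_pow_ideal)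
    show "z \<otimes> v \<in> ideal_pow R (Idl (set zs)) (Suc n)"
      if "z \<in> set zs" "v \<in> ideal_pow R (Idl (set zs)) n" for z v n
      unfolding ideal_pow_Suc2[OF id]
      using that genideal_self[OF assms(1)] by (auto intro: ideal_prod.prod)
    show "\<one> \<in> ideal_pow R (Idl (set zs)) 0" unfolding ideal_pow_0 by simp
  qed
  then show ?thesis using mon_closed[OF assms(1)] by simp
qed

lemma ideal_pow_generators:
  assumes "set zs \<subseteq> carrier R"
  shows "ideal_pow R (Idl (set zs)) n \<subseteq> Idl (mon R zs ` comps (length zs) n)"
proof (induction n)
  case 0
  have "mon R zs (replicate (length zs) 0) = \<one>" using mon_replicate_zero[OF assms] .
  then have "\<one> \<in> mon R zs ` comps (length zs) 0"
    by (intro image_eqI[of _ _ "replicate (length zs) 0"]) (auto simp: comps_def sum_list_replicate)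
  moreover have car: "mon R zs ` comps (length zs) 0 \<subseteq> carrier R" using mon_closed[OF assms] by auto
  ultimately have "\<one> \<in> Idl (mon R zs ` comps (length zs) 0)" using genideal_self by blast
  then show ?case using ideal.one_imp_carrier[OF genideal_ideal[OF car]] unfolding ideal_pow_0 by simp
next
  case (Suc n)
  have id: "ideal (Idl (set zs)) R" using assms genideal_ideal by blast
  have car: "mon R zs ` comps (length zs) n \<subseteq> carrier R" for n using mon_closed[OF assms] by auto
  have "ideal_pow R (Idl (set zs)) (Suc n) \<subseteq> (Idl (set zs)) \<cdot> (Idl (mon R zs ` comps (length zs) n))"
    unfolding ideal_pow_Suc2[OF id] using Suc by (rule ideal_prod_mono[OF order_refl])
  also have "\<dots> \<subseteq> Idl (mon R zs ` comps (length zs) (Suc n))"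
  proof (rule genideal_prod_least[OF genideal_ideal[OF car] assms car])
    fix z b assume "z \<in> set zs" "b \<in> mon R zs ` comps (length zs) n"
    then obtain \<gamma> \<alpha> where *: "\<gamma> \<in> comps (length zs) 1" "mon R zs \<gamma> = z" "\<alpha> \<in> comps (length zs) n" "b = mon R zs \<alpha>"
      using mon_unit[OF assms] by blast
    then have "z \<otimes> b = mon R zs (map2 (+) \<gamma> \<alpha>)" using mon_add[OF assms, of \<gamma> \<alpha>] by (auto simp: comps_def)
    moreover have "map2 (+) \<gamma> \<alpha> \<in> comps (length zs) (Suc n)" using list_add_comps[OF *(1,3)] by simp
    ultimately show "z \<otimes> b \<in> Idl (mon R zs ` comps (length zs) (Suc n))"
      using genideal_self[OF car] by auto
  qed
  finally show ?case .
qed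

end

section \<open>Noetherian local rings\<close>

context cring
begin

text \<open>Pigeonhole: if the degree exceeds \<open>N\<close> times the number of variables, some
  exponent is at least \<open>N\<close>.\<close>

lemma mon_in_ideal:
  assumes "ideal Q R" "set zs \<subseteq> carrier R" "\<And>z n. z \<in> set zs \<Longrightarrow> N \<le> n \<Longrightarrow> z [^] n \<in> Q"
    and "length \<alpha> = length zs" "N * length zs < sum_list \<alpha>"
  shows "mon R zs \<alpha> \<in> Q"
  using assms(2-5)
proof (induction zs arbitrary: \<alpha>)
  case (Cons z zs)
  obtain k \<alpha>' where \<alpha>: "\<alpha> = k # \<alpha>'" "length \<alpha>' = length zs" using Cons.prems(3) by (metis length_Suc_conv)
  show ?case
  proof (cases "N \<le> k")
    case True
    then have "z [^] k \<in> Q" using Cons.prems(2) by simp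
    then show ?thesis using \<alpha> ideal_simps(7)[OF assms(1)] mon_closed[of zs] Cons.prems(1) by simp
  next
    case False
    then have "mon R zs \<alpha>' \<in> Q" using Cons \<alpha> by simp
    then show ?thesis using \<alpha> ideal_simps(6)[OF assms(1)] Cons.prems(1) by simp
  qed
qed simp

lemma ideal_pow_subset_of_nilpotent:
  assumes "ideal Q R" "set zs \<subseteq> carrier R" "\<And>z. z \<in> set zs \<Longrightarrow> \<exists>n::nat. z [^] n \<in> Q"
  shows "\<exists>k. ideal_pow R (Idl (set zs)) k \<subseteq> Q"
proof -
  obtain f where f: "\<And>z. z \<in> set zs \<Longrightarrow> z [^] (f z :: nat) \<in> Q" using assms(3) by metis
  define N where "N = Max (insert 0 (f ` set zs))"
  have N: "z [^] n \<in> Q" if "z \<in> set zs" "N \<le> n" for z n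
  proof -
    have "f z \<le> N" unfolding N_def using that by (intro Max_ge) auto
    then have "f z \<le> n" using that by simp
    have zc: "z \<in> carrier R" using that assms(2) by blast
    have "z [^] n = z [^] f z \<otimes> z [^] (n - f z)" using zc \<open>f z \<le> n\<close> by (simp add: nat_pow_mult)
    then show ?thesis using ideal_simps(7)[OF assms(1) f[OF that(1)]] zc by simp
  qed
  let ?k = "Suc (N * length zs)"
  have "ideal_pow R (Idl (set zs)) ?k \<subseteq> Idl (mon R zs ` comps (length zs) ?k)"
    by (rule ideal_pow_generators[OF assms(2)])
  also have "\<dots> \<subseteq> Q"
    by (rule genideal_minimal[OF assms(1)])
      (use mon_in_ideal[OF assms(1,2) N] in \<open>auto simp: comps_def\<close>)
  finally show ?thesis by blast
qed

text \<open>Regularity of \<open>a\<close> on \<open>R / J\<close>, phrased in \<open>R\<close> so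
  that no quotient ring has to be formed.\<close>

definition reg_mod :: "'a set \<Rightarrow> 'a \<Rightarrow> bool" where
  "reg_mod J a \<longleftrightarrow> a \<in> carrier R \<and> (\<forall>y\<in>carrier R. a \<otimes> y \<in> J \<longrightarrow> y \<in> J)"

lemma reg_mod_pow:
  assumes "reg_mod J c" "y \<in> carrier R" "c [^] (k::nat) \<otimes> y \<in> J"
  shows "y \<in> J"
  using assms(2,3)
proof (induction k arbitrary: y)
  case (Suc k)
  have c: "c \<in> carrier R" using assms(1) by (simp add: reg_mod_def)
  have "c [^] k \<otimes> (c \<otimes> y) \<in> J" using Suc.prems c by (simp add: m_assoc)
  then have "c \<otimes> y \<in> J" using Suc.IH Suc.prems c by simp
  then show ?case using assms(1) Suc.prems by (simp add: reg_mod_def)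
qed simp

text \<open>The value is meaningful only when the length is finite; \<open>ideal_len_colen\<close>
  guarantees this for open ideals.\<close>

definition colen :: "'a set \<Rightarrow> nat" where
  "colen K = the_enat (ideal_len R (carrier R) K)"

text \<open>Here \<open>L\<close> is the colon ideal of \<open>a\<close> into \<open>L'\<close>, so
  multiplication by \<open>a\<close> induces an isomorphism from \<open>R / L\<close> onto
  \<open>((a) + L') / L'\<close>.\<close>

lemma ideal_len_mult:
  assumes "ideal L R" "ideal L' R" "a \<in> carrier R"
    and "\<And>y. y \<in> L \<Longrightarrow> a \<otimes> y \<in> L'" "\<And>y. y \<in> carrier R \<Longrightarrow> a \<otimes> y \<in> L' \<Longrightarrow> y \<in> L"
  shows "ideal_len R (PIdl a <+> L') L' = ideal_len R (carrier R) L"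
proof (rule antisym)
  have ida: "ideal (PIdl a) R" using assms cgenideal_ideal by blast
  have id: "ideal (PIdl a <+> L') R" "L' \<subseteq> PIdl a <+> L'" "PIdl a \<subseteq> PIdl a <+> L'"
    using add_ideals[OF ida assms(2)] ideal_set_add_upper[OF ida assms(2)] by simp_all
  have mem: "a \<otimes> y \<in> PIdl a <+> L'" if "y \<in> carrier R" for y
  proof -
    have "a \<otimes> y = y \<otimes> a" using m_comm[OF assms(3) that] .
    then have "a \<otimes> y \<in> PIdl a" unfolding cgenideal_def using that by blast
    then show ?thesis using id(3) by blast
  qed
  show "ideal_len R (PIdl a <+> L') L' \<le> ideal_len R (carrier R) L"
  proof (rule ideal_len_surj[where z = a])
    fix y assume "y \<in> PIdl a <+> L'"
    then obtain r l where rl: "r \<in> carrier R" "l \<in> L'" "y = r \<otimes> a \<oplus> l"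
      by (auto simp: set_add_iff cgenideal_def)
    have "l \<in> carrier R" using rl ideal_simps(2)[OF assms(2)] by simp
    then have "y \<ominus> a \<otimes> r = l" using rl assms(3) by algebra
    then show "\<exists>k\<in>carrier R. a \<otimes> k \<in> PIdl a <+> L' \<and> y \<ominus> a \<otimes> k \<in> L'" using rl mem by metis
  qed (use assms id oneideal ideal_subset_carrier in auto)
  show "ideal_len R (carrier R) L \<le> ideal_len R (PIdl a <+> L') L'"
    by (rule ideal_len_inj[where z = a]) (use assms id oneideal ideal_subset_carrier mem in auto)
qed

end

section \<open>Primes, radicals and full regular sequences\<close>

context noetherian_local_ring
begin

lemma m_maximal: "maximalideal \<mm> R" using maximal_iff by simp
lemma m_ideal: "ideal \<mm> R" using m_maximal maximalideal.axioms(1) by blast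
lemma ideal_list_generated:
  assumes "ideal Q R"
  shows "\<exists>zs. set zs \<subseteq> carrier R \<and> Q = Idl (set zs)"
  using finetely_gen[OF assms] finite_list by metis

text \<open>Zorn's lemma applies because in a noetherian ring a nonempty chain of ideals contains
  its own union.\<close>

lemma exists_maximal_avoiding:
  assumes "ideal J R" "J \<inter> S = {}"
  shows "\<exists>M. ideal M R \<and> J \<subseteq> M \<and> M \<inter> S = {} \<and> (\<forall>X. ideal X R \<longrightarrow> M \<subseteq> X \<longrightarrow> X \<inter> S = {} \<longrightarrow> X = M)"
proof -
  let ?A = "{X. ideal X R \<and> J \<subseteq> X \<and> X \<inter> S = {}}"
  have "\<exists>M\<in>?A. \<forall>X\<in>?A. M \<subseteq> X \<longrightarrow> X = M"
  proof (rule subset_Zorn_nonempty)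
    show "?A \<noteq> {}" using assms by blast
    fix C assume C: "C \<noteq> {}" "subset.chain ?A C"
    then have "subset.chain {I. ideal I R} C" by (auto simp: subset_chain_def)
    then have "\<Union>C \<in> C" using ideal_chain_is_trivial C by blast
    then show "\<Union>C \<in> ?A" using C by (auto simp: subset_chain_def)
  qed
  then obtain M where M: "M \<in> ?A" "\<forall>X\<in>?A. M \<subseteq> X \<longrightarrow> X = M" by (elim bexE)
  have "X = M" if "ideal X R" "M \<subseteq> X" "X \<inter> S = {}" for X
  proof -
    have "X \<in> ?A" using M(1) that by auto
    then show ?thesis using M(2) that(2) by simp
  qed
  then show ?thesis using M(1) by (intro exI[of _ M]) simp
qed

text \<open>An ideal maximal among those missing a multiplicative set is prime: if \<open>a\<close>
  and \<open>b\<close> lie outside it, both enlargements meet \<open>S\<close>, and the product of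
  the two elements found would lie in the ideal once \<open>a \<otimes> b\<close> does.\<close>

lemma exists_prime_avoiding:
  assumes "ideal J R" "J \<inter> S = {}" "S \<subseteq> carrier R" "\<one> \<in> S" "\<And>a b. a \<in> S \<Longrightarrow> b \<in> S \<Longrightarrow> a \<otimes> b \<in> S"
  shows "\<exists>P. primeideal P R \<and> J \<subseteq> P \<and> P \<inter> S = {}"
proof -
  obtain M where M: "ideal M R" "J \<subseteq> M" "M \<inter> S = {}"
    "\<And>X. ideal X R \<Longrightarrow> M \<subseteq> X \<Longrightarrow> X \<inter> S = {} \<Longrightarrow> X = M"
    using exists_maximal_avoiding[OF assms(1,2)] by metis
  have Mc: "M \<subseteq> carrier R" using M ideal_subset_carrier by blast
  have meet: "\<exists>s\<in>S. \<exists>r\<in>carrier R. s \<ominus> r \<otimes> a \<in> M" if "a \<in> carrier R" "a \<notin> M" for a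
  proof -
    have sub: "insert a M \<subseteq> carrier R" using Mc that by simp
    have "Idl (insert a M) \<noteq> M" using genideal_self[OF sub] that by auto
    moreover have "ideal (Idl (insert a M)) R" "M \<subseteq> Idl (insert a M)"
      using genideal_ideal[OF sub] genideal_self[OF sub] by auto
    ultimately have "Idl (insert a M) \<inter> S \<noteq> {}" using M(4) by metis
    then obtain s where s: "s \<in> S" "s \<in> Idl (insert a M)" by blast
    have ac: "a \<in> carrier R" by fact
    obtain r where "r \<in> carrier R" "s \<ominus> r \<otimes> a \<in> Idl M"
      using genideal_insertD[OF Mc ac s(2)] by blast
    moreover have "Idl M \<subseteq> M" using M(1) by (rule genideal_minimal) simp
    ultimately show ?thesis using s by auto
  qed
  have "primeideal M R"
  proof (rule primeidealI[OF M(1) cring_axioms])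
    show "carrier R \<noteq> M" using M(3) assms(3,4) by blast
    fix a b assume ab: "a \<in> carrier R" "b \<in> carrier R" "a \<otimes> b \<in> M"
    show "a \<in> M \<or> b \<in> M"
    proof (rule ccontr)
      assume "\<not> (a \<in> M \<or> b \<in> M)"
      then obtain s r t u where *: "s \<in> S" "r \<in> carrier R" "s \<ominus> r \<otimes> a \<in> M"
        "t \<in> S" "u \<in> carrier R" "t \<ominus> u \<otimes> b \<in> M"
        using meet[OF ab(1)] meet[OF ab(2)] by auto
      define p q where "p = s \<ominus> r \<otimes> a" and "q = t \<ominus> u \<otimes> b"
      have car: "s \<in> carrier R" "t \<in> carrier R" using * assms(3) by blast+
      have pq: "p \<in> M" "q \<in> M" "p \<in> carrier R" "q \<in> carrier R" using * car ab unfolding p_def q_def by auto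
      have "s \<otimes> t = p \<otimes> t \<oplus> (r \<otimes> a) \<otimes> q \<oplus> (r \<otimes> u) \<otimes> (a \<otimes> b)"
        unfolding p_def q_def using car ab * by algebra
      moreover have "p \<otimes> t \<in> M" "(r \<otimes> a) \<otimes> q \<in> M" "(r \<otimes> u) \<otimes> (a \<otimes> b) \<in> M"
        using ideal_simps(6,7)[OF M(1)] pq car ab * by simp_all
      ultimately have "s \<otimes> t \<in> M" using ideal_simps(3)[OF M(1)] by simp
      then show False using M(3) assms(5) * by blast
    qed
  qed
  then show ?thesis using M by blast
qed

text \<open>Avoiding \<open>{\<one>}\<close> yields a maximal ideal above \<open>J\<close>, and the
  only maximal ideal is \<open>\<mm>\<close>.\<close>

lemma proper_ideal_subset_m:
  assumes "ideal J R" "J \<noteq> carrier R"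
  shows "J \<subseteq> \<mm>"
proof -
  have notone: "X = carrier R" if "ideal X R" "\<one> \<in> X" for X
    using that ideal.one_imp_carrier by blast
  then have "J \<inter> {\<one>} = {}" using assms by blast
  then obtain M where M: "ideal M R" "J \<subseteq> M" "M \<inter> {\<one>} = {}"
    "\<And>X. ideal X R \<Longrightarrow> M \<subseteq> X \<Longrightarrow> X \<inter> {\<one>} = {} \<Longrightarrow> X = M"
    using exists_maximal_avoiding[OF assms(1), of "{\<one>}"] by metis
  have "maximalideal M R"
  proof (rule maximalidealI[OF M(1)])
    show "carrier R \<noteq> M" using M(3) by auto
    fix X assume "ideal X R" "M \<subseteq> X" "X \<subseteq> carrier R"
    then show "X = M \<or> X = carrier R" using M(4) notone[of X] by blast
  qed
  then show ?thesis using maximal_iff M(2) by simp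
qed

text \<open>An element regular modulo \<open>J\<close> lies in no minimal prime of \<open>J\<close>.
  So a prime above \<open>J\<close> that contains such an element has a smaller prime above
  \<open>J\<close> beneath it.\<close>

lemma prime_descend:
  assumes "primeideal P R" "ideal J R" "J \<subseteq> P" "c \<in> P" "reg_mod J c"
  shows "\<exists>Q. primeideal Q R \<and> J \<subseteq> Q \<and> Q \<subset> P"
proof -
  interpret P: primeideal P R by fact
  \<comment> \<open>Missing the complement of \<open>P\<close> forces
    \<open>Q \<subseteq> P\<close>, and missing the powers of \<open>c\<close> makes the inclusion
    proper. Regularity of \<open>c\<close> keeps this set away from \<open>J\<close>.\<close>
  let ?S = "{s \<otimes> c [^] k | s k. s \<in> carrier R - P \<and> k \<in> (UNIV :: nat set)}"
  have c: "c \<in> carrier R" using assms(5) by (simp add: reg_mod_def)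
  have one: "\<one> \<notin> P" using P.I_notcarr P.one_imp_carrier by blast
  have SI: "s \<otimes> c [^] k \<in> ?S" if "s \<in> carrier R" "s \<notin> P" for s and k :: nat using that by blast
  have "\<exists>Q. primeideal Q R \<and> J \<subseteq> Q \<and> Q \<inter> ?S = {}"
  proof (rule exists_prime_avoiding[OF assms(2)])
    show "J \<inter> ?S = {}"
    proof -
      have False if "s \<in> carrier R" "s \<notin> P" "s \<otimes> c [^] k \<in> J" for s and k :: nat
      proof -
        have "c [^] k \<otimes> s \<in> J" using that c by (simp add: m_comm)
        then show False using reg_mod_pow[OF assms(5) that(1)] that assms(3) by blast
      qed
      then show ?thesis by auto
    qed
    show "?S \<subseteq> carrier R" using c by auto
    show "\<one> \<in> ?S" using SI[OF one_closed one, of 0] by simp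
    fix a b assume "a \<in> ?S" "b \<in> ?S"
    then obtain s t and k l :: nat where st: "s \<in> carrier R" "s \<notin> P" "t \<in> carrier R" "t \<notin> P"
      "a = s \<otimes> c [^] k" "b = t \<otimes> c [^] l" by auto
    have "s \<otimes> t \<notin> P" using P.I_prime st by blast
    then have "(s \<otimes> t) \<otimes> c [^] (k + l) \<in> ?S" using SI st by simp
    moreover have "(s \<otimes> t) \<otimes> c [^] (k + l) = a \<otimes> b"
      using st c by (simp add: nat_pow_mult[symmetric] m_ac)
    ultimately show "a \<otimes> b \<in> ?S" by simp
  qed
  then obtain Q where Q: "primeideal Q R" "J \<subseteq> Q" "Q \<inter> ?S = {}" by blast
  have Qc: "Q \<subseteq> carrier R" using Q(1) primeideal.axioms(1) ideal_subset_carrier by blast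
  have "Q \<subseteq> P"
  proof
    fix s assume "s \<in> Q"
    then have "s \<in> carrier R" using Qc by blast
    then show "s \<in> P" using SI[of s 0] Q(3) \<open>s \<in> Q\<close> by auto
  qed
  moreover have "c \<notin> Q" using SI[OF one_closed one, of 1] Q(3) c by auto
  ultimately show ?thesis using Q assms(4) by blast
qed

text \<open>Dropping the elements one by one from the end, each drop descends to a strictly smaller
  prime; this bounds the height of \<open>P\<close> from below.\<close>

lemma prime_chain_of_regular:
  assumes "set as \<subseteq> carrier R" "\<And>i. i < length as \<Longrightarrow> reg_mod (Idl (set (take i as))) (as ! i)"
    and "n \<le> length as" "primeideal P R" "Idl (set (take n as)) \<subseteq> P"
  shows "\<exists>p. (\<forall>i\<le>n. primeideal (p i) R) \<and> (\<forall>i<n. p i \<subset> p (Suc i)) \<and> p n = P"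
  using assms(3-5)
proof (induction n arbitrary: P)
  case 0
  then show ?case by (intro exI[of _ "\<lambda>_. P"]) auto
next
  case (Suc n)
  let ?J = "Idl (set (take n as))"
  have car: "set (take k as) \<subseteq> carrier R" for k using assms(1) set_take_subset by fastforce
  have n: "n < length as" using Suc.prems by simp
  have take: "take (Suc n) as = take n as @ [as ! n]" using n by (simp add: take_Suc_conv_app_nth)
  have sub: "?J \<subseteq> P" "as ! n \<in> P"
    using Suc.prems(3) genideal_self[OF car, of "Suc n"] subset_Idl_subset[OF car, of "set (take n as)" "Suc n"]
    by (auto simp: take)
  obtain Q where Q: "primeideal Q R" "?J \<subseteq> Q" "Q \<subset> P"
    using prime_descend[OF Suc.prems(2) genideal_ideal[OF car] sub assms(2)[OF n]] by blast
  obtain p where p: "\<forall>i\<le>n. primeideal (p i) R" "\<forall>i<n. p i \<subset> p (Suc i)" "p n = Q"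
    using Suc.IH[OF _ Q(1,2)] n by auto
  show ?case
  proof (intro exI[of _ "p(Suc n := P)"] conjI allI impI)
    fix i assume "i \<le> Suc n"
    then show "primeideal ((p(Suc n := P)) i) R" using p Suc.prems by (cases "i = Suc n") auto
  next
    fix i assume "i < Suc n"
    then show "(p(Suc n := P)) i \<subset> (p(Suc n := P)) (Suc i)" using p Q by (cases "i = n") auto
  qed simp
qed

text \<open>No prime other than \<open>\<mm>\<close> can contain the sequence, so every element of
  \<open>\<mm>\<close> has a power in the generated ideal. Finite generation of \<open>\<mm>\<close>
  makes one exponent serve for all.\<close>

lemma regular_sequence_open:
  assumes "set as \<subseteq> carrier R" "\<And>i. i < length as \<Longrightarrow> reg_mod (Idl (set (take i as))) (as ! i)"
    and "krull_dim R = enat (length as)"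
  shows "\<exists>k. ideal_pow R \<mm> k \<subseteq> Idl (set as)"
proof -
  let ?Q = "Idl (set as)"
  have Q: "ideal ?Q R" using assms(1) by (rule genideal_ideal)
  have only_m: "P = \<mm>" if P: "primeideal P R" "?Q \<subseteq> P" for P
  proof (rule ccontr)
    assume "P \<noteq> \<mm>"
    have "P \<subset> \<mm>"
      using proper_ideal_subset_m[OF primeideal.axioms(1)[OF P(1)]] primeideal.I_notcarr[OF P(1)] \<open>P \<noteq> \<mm>\<close>
      by auto
    let ?d = "length as"
    obtain p where p: "\<forall>i\<le>?d. primeideal (p i) R" "\<forall>i<?d. p i \<subset> p (Suc i)" "p ?d = P"
      using prime_chain_of_regular[OF assms(1,2) order_refl P(1)] P(2) by auto
    \<comment> \<open>Appending \<open>\<mm>\<close> to the chain ending in \<open>P\<close> gives a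
      chain longer than the dimension permits.\<close>
    let ?p = "p(Suc ?d := \<mm>)"
    have "(\<forall>i\<le>Suc ?d. primeideal (?p i) R) \<and> (\<forall>i<Suc ?d. ?p i \<subset> ?p (Suc i))"
      using p \<open>P \<subset> \<mm>\<close> maximalideal_prime[OF m_maximal] by (auto simp: le_Suc_eq less_Suc_eq)
    then have "enat (Suc ?d) \<le> krull_dim R"
      unfolding krull_dim_def by (intro Sup_upper) blast
    then show False using assms(3) by simp
  qed
  have "\<exists>n::nat. y [^] n \<in> ?Q" if y: "y \<in> \<mm>" for y
  proof (rule ccontr)
    assume no: "\<nexists>n::nat. y [^] n \<in> ?Q"
    have yc: "y \<in> carrier R" using y ideal_simps(2)[OF m_ideal] by blast
    have "\<exists>P. primeideal P R \<and> ?Q \<subseteq> P \<and> P \<inter> range (\<lambda>n::nat. y [^] n) = {}"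
    proof (rule exists_prime_avoiding[OF Q])
      show "\<one> \<in> range (\<lambda>n::nat. y [^] n)" by (rule image_eqI[of _ _ 0]) auto
      show "a \<otimes> b \<in> range (\<lambda>n::nat. y [^] n)"
        if "a \<in> range (\<lambda>n::nat. y [^] n)" "b \<in> range (\<lambda>n::nat. y [^] n)" for a b
        using that yc by (auto simp: nat_pow_mult)
    qed (use no yc in auto)
    then obtain P where P: "primeideal P R" "?Q \<subseteq> P" "P \<inter> range (\<lambda>n::nat. y [^] n) = {}" by blast
    then have "P = \<mm>" using only_m by blast
    moreover have "y \<in> range (\<lambda>n::nat. y [^] n)" using yc by (intro image_eqI[of _ _ 1]) auto
    ultimately show False using P y by blast
  qed
  moreover obtain zs where zs: "set zs \<subseteq> carrier R" "\<mm> = Idl (set zs)"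
    using ideal_list_generated[OF m_ideal] by blast
  moreover have "set zs \<subseteq> \<mm>" using genideal_self[OF zs(1)] zs(2) by simp
  ultimately show ?thesis using ideal_pow_subset_of_nilpotent[OF Q zs(1)] by auto
qed

section \<open>Open ideals and colengths\<close>

definition open_ideal :: "'a set \<Rightarrow> bool" where
  "open_ideal K \<longleftrightarrow> ideal K R \<and> (\<exists>k. ideal_pow R \<mm> k \<subseteq> K)"

lemma open_ideal_mono: "open_ideal K \<Longrightarrow> ideal L R \<Longrightarrow> K \<subseteq> L \<Longrightarrow> open_ideal L"
  unfolding open_ideal_def by blast

lemma open_ideal_m: "open_ideal \<mm>"
proof -
  have "ideal_pow R \<mm> (Suc 0) \<subseteq> \<mm>"
    unfolding ideal_pow_Suc ideal_pow_0 using ideal_prod_inter[OF oneideal m_ideal] by blast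
  then show ?thesis unfolding open_ideal_def using m_ideal by blast
qed

text \<open>Unlike being \<open>\<mm>\<close>-primary, openness admits the unit ideal, which occurs
  here as a zeroth power.\<close>

lemma open_ideal_carrier: "open_ideal (carrier R)"
  using open_ideal_mono[OF open_ideal_m oneideal] ideal_subset_carrier[OF m_ideal] by blast

lemma open_ideal_prod:
  assumes "open_ideal K" "open_ideal L"
  shows "open_ideal (K \<cdot> L)"
proof -
  obtain k l where "ideal_pow R \<mm> k \<subseteq> K" "ideal_pow R \<mm> l \<subseteq> L"
    using assms by (auto simp: open_ideal_def)
  then have "ideal_pow R \<mm> (k + l) \<subseteq> K \<cdot> L"
    unfolding ideal_pow_add[OF m_ideal] by (rule ideal_prod_mono)
  then show ?thesis using assms ideal_prod_is_ideal unfolding open_ideal_def by blast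
qed

lemma open_ideal_pow: "open_ideal K \<Longrightarrow> open_ideal (ideal_pow R K n)"
proof (induction n)
  case 0
  show ?case unfolding ideal_pow_0 by (rule open_ideal_carrier)
next
  case (Suc n)
  then show ?case unfolding ideal_pow_Suc using open_ideal_prod by blast
qed

lemma open_ideal_ideal: "open_ideal K \<Longrightarrow> ideal K R"
  by (simp add: open_ideal_def)

lemma open_ideal_add: "open_ideal K \<Longrightarrow> ideal L R \<Longrightarrow> open_ideal (K <+> L)"
  using open_ideal_mono add_ideals ideal_set_add_upper(1) open_ideal_ideal by metis

text \<open>Each layer \<open>\<mm>^k / \<mm>^(k+1)\<close> is finitely generated and annihilated by
  \<open>\<mm>\<close>, hence of finite length.\<close>

lemma ideal_len_pow_finite: "ideal_len R (carrier R) (ideal_pow R \<mm> k) \<noteq> \<infinity>"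
proof (induction k)
  case 0
  show ?case unfolding ideal_pow_0 using ideal_len_refl[of "carrier R"] by simp
next
  case (Suc k)
  note id = ideal_pow_ideal[OF m_ideal]
  obtain zs where zs: "set zs \<subseteq> carrier R" "ideal_pow R \<mm> k = Idl (set zs)"
    using ideal_list_generated[OF id] by blast
  have sub: "ideal_pow R \<mm> (Suc k) \<subseteq> ideal_pow R \<mm> k"
    by (rule ideal_pow_antimono[OF m_ideal]) simp
  have zsub: "set zs \<subseteq> ideal_pow R \<mm> k" using genideal_self[OF zs(1)] zs(2) by simp
  have "ideal_len R (Idl (set zs \<union> ideal_pow R \<mm> (Suc k))) (ideal_pow R \<mm> (Suc k)) \<noteq> \<infinity>"
  proof (rule ideal_len_generated_finite[OF m_maximal _ zs(1) id])
    fix z y assume "z \<in> set zs" "y \<in> \<mm>"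
    then show "z \<otimes> y \<in> ideal_pow R \<mm> (Suc k)"
      unfolding ideal_pow_Suc using zsub by (auto intro: ideal_prod.prod)
  qed simp
  moreover have "Idl (set zs \<union> ideal_pow R \<mm> (Suc k)) = ideal_pow R \<mm> k"
  proof
    show "Idl (set zs \<union> ideal_pow R \<mm> (Suc k)) \<subseteq> ideal_pow R \<mm> k"
      by (rule genideal_minimal[OF id]) (use zsub sub in blast)
    show "ideal_pow R \<mm> k \<subseteq> Idl (set zs \<union> ideal_pow R \<mm> (Suc k))"
      unfolding zs(2) by (rule subset_Idl_subset) (use zs(1) ideal_subset_carrier[OF id, of "Suc k"] in blast)+
  qed
  ultimately have "ideal_len R (ideal_pow R \<mm> k) (ideal_pow R \<mm> (Suc k)) \<noteq> \<infinity>" by simp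
  then show ?case
    using ideal_len_finite_trans[OF id id oneideal sub ideal_subset_carrier[OF id] Suc] by simp
qed

lemma ideal_len_colen:
  assumes "open_ideal K"
  shows "ideal_len R (carrier R) K = enat (colen K)"
proof -
  obtain k where k: "ideal_pow R \<mm> k \<subseteq> K" using assms by (auto simp: open_ideal_def)
  have "ideal_len R (carrier R) K \<le> ideal_len R (carrier R) (ideal_pow R \<mm> k)"
    by (rule ideal_len_mono[OF k order_refl])
  then have "ideal_len R (carrier R) K \<noteq> \<infinity>" using ideal_len_pow_finite[of k] by (metis enat_ord_simps(5))
  then show ?thesis by (auto simp: colen_def)
qed

lemma ideal_len_colen_diff:
  assumes "open_ideal K" "ideal L R" "K \<subseteq> L"
  shows "ideal_len R L K = enat (colen K - colen L)" "colen L \<le> colen K"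
proof -
  have L: "open_ideal L" using open_ideal_mono[OF assms] .
  have K: "ideal K R" using assms(1) by (rule open_ideal_ideal)
  have eq: "enat (colen K) = enat (colen L) + ideal_len R L K"
    using ideal_len_add[OF K assms(2) oneideal assms(3) ideal_subset_carrier[OF assms(2)]]
    by (simp add: ideal_len_colen assms(1) L)
  then obtain n where n: "ideal_len R L K = enat n" by (cases "ideal_len R L K") auto
  then have "colen K = colen L + n" using eq by simp
  then show "ideal_len R L K = enat (colen K - colen L)" "colen L \<le> colen K" using n by auto
qed

text \<open>Lengths in the exact sequence \<open>0 -> R/L -> R/L' -> R/((a) + L') -> 0\<close>,
  whose first map is multiplication by \<open>a\<close>. Every colength recursion below is an
  instance.\<close>

lemma colen_mult:
  assumes "open_ideal L'" "ideal L R" "a \<in> carrier R"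
    and "\<And>y. y \<in> L \<Longrightarrow> a \<otimes> y \<in> L'" "\<And>y. y \<in> carrier R \<Longrightarrow> a \<otimes> y \<in> L' \<Longrightarrow> y \<in> L"
  shows "colen L' = colen (PIdl a <+> L') + colen L"
proof -
  have L': "ideal L' R" using assms(1) by (rule open_ideal_ideal)
  have ida: "ideal (PIdl a) R" using assms cgenideal_ideal by blast
  have "L' \<subseteq> L"
  proof
    fix y assume y: "y \<in> L'"
    then have "y \<in> carrier R" using ideal_simps(2)[OF L'] by blast
    moreover have "a \<otimes> y \<in> L'" using ideal_simps(6)[OF L' y assms(3)] .
    ultimately show "y \<in> L" using assms(5) by blast
  qed
  then have L: "open_ideal L" using open_ideal_mono assms by blast
  have "enat (colen L' - colen (PIdl a <+> L')) = enat (colen L)"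
    using ideal_len_mult[OF assms(2) L' assms(3-5)] ideal_len_colen[OF L]
      ideal_len_colen_diff(1)[OF assms(1) add_ideals[OF ida L'] ideal_set_add_upper(2)[OF ida L']] by simp
  then show ?thesis
    using ideal_len_colen_diff(2)[OF assms(1) add_ideals[OF ida L'] ideal_set_add_upper(2)[OF ida L']] by simp
qed

text \<open>Regularity of \<open>x\<close> modulo \<open>J\<close> identifies the colon of
  \<open>x\<close> into \<open>x K + J\<close> as \<open>K + J\<close>, so \<open>colen_mult\<close>
  applies.\<close>

lemma colen_reg_mult:
  assumes "ideal J R" "reg_mod J x" "open_ideal (PIdl x <+> J)" "open_ideal K"
  shows "open_ideal ((PIdl x) \<cdot> K <+> J)"
    and "colen ((PIdl x) \<cdot> K <+> J) = colen (PIdl x <+> J) + colen (K <+> J)"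
proof -
  have xc: "x \<in> carrier R" using assms(2) by (simp add: reg_mod_def)
  have idx: "ideal (PIdl x) R" using xc cgenideal_ideal by blast
  have K: "ideal K R" using assms(4) by (rule open_ideal_ideal)
  have idxK: "ideal ((PIdl x) \<cdot> K) R" using idx K by (rule ideal_prod_is_ideal)
  have id: "ideal ((PIdl x) \<cdot> K <+> J) R" using idxK assms(1) by (rule add_ideals)
  \<comment> \<open>A product of two open ideals is open, and this one lies inside the ideal in
    question.\<close>
  have "(PIdl x <+> J) \<cdot> K \<subseteq> (PIdl x) \<cdot> K <+> J"
    unfolding ideal_prod_distr(2)[OF K idx assms(1)]
    using ideal_prod_inter[OF assms(1) K] by (intro set_add_mono) auto
  then show op: "open_ideal ((PIdl x) \<cdot> K <+> J)"
    using open_ideal_mono[OF open_ideal_prod[OF assms(3,4)] id] by blast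
  note elem = cgenideal_prod_elem[OF xc K]
  have "colen ((PIdl x) \<cdot> K <+> J) = colen (PIdl x <+> ((PIdl x) \<cdot> K <+> J)) + colen (K <+> J)"
  proof (rule colen_mult[OF op add_ideals[OF K assms(1)] xc])
    fix y assume "y \<in> K <+> J"
    then show "x \<otimes> y \<in> (PIdl x) \<cdot> K <+> J"
      using cgenideal_self[OF xc] by (intro mult_set_add[OF K assms(1) xc] ideal_prod.prod)
  next
    fix y assume y: "y \<in> carrier R" "x \<otimes> y \<in> (PIdl x) \<cdot> K <+> J"
    then obtain w j where wj: "w \<in> (PIdl x) \<cdot> K" "j \<in> J" "x \<otimes> y = w \<oplus> j" by (auto simp: set_add_iff)
    obtain k where k: "k \<in> K" "w = x \<otimes> k" using elem[OF wj(1)] by blast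
    have car: "k \<in> carrier R" "j \<in> carrier R" using k wj ideal_simps(2) K assms(1) by blast+
    have "x \<otimes> (y \<ominus> k) = x \<otimes> y \<ominus> x \<otimes> k" using car y xc by algebra
    also have "\<dots> = j" unfolding wj(3) k(2) using car xc by algebra
    finally have "y \<ominus> k \<in> J" using assms(2) wj car y by (simp add: reg_mod_def)
    moreover have "y = k \<oplus> (y \<ominus> k)" using car y by algebra
    ultimately show "y \<in> K <+> J" unfolding set_add_iff using k by blast
  qed
  moreover have "PIdl x <+> ((PIdl x) \<cdot> K <+> J) = PIdl x <+> J"
  proof
    have "(PIdl x) \<cdot> K \<subseteq> PIdl x" using ideal_prod_inter[OF idx K] by blast
    then show "PIdl x <+> ((PIdl x) \<cdot> K <+> J) \<subseteq> PIdl x <+> J"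
      using add_ideals[OF idx assms(1)] ideal_set_add_upper[OF idx assms(1)]
      by (intro set_add_least set_add_mono) auto
    show "PIdl x <+> J \<subseteq> PIdl x <+> ((PIdl x) \<cdot> K <+> J)"
      using ideal_set_add_upper(2)[OF idxK assms(1)] by (intro set_add_mono) auto
  qed
  ultimately show "colen ((PIdl x) \<cdot> K <+> J) = colen (PIdl x <+> J) + colen (K <+> J)" by simp
qed

end

section \<open>Rees-superficial elements\<close>

context cring
begin

lemma quot_coset_eq_zero_iff:
  assumes "ideal J R" "y \<in> carrier R"
  shows "J +> y = J \<longleftrightarrow> y \<in> J"
  using a_rcos_zero[OF assms(1)] ideal.rcos_const_imp_mem[OF assms(1,2)] by blast

lemma quot_image_prod:
  assumes J: "ideal J R" and A: "A \<subseteq> carrier R" and B: "B \<subseteq> carrier R"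
  shows "(+>) J ` (A \<cdot> B) = ideal_prod (R Quot J) ((+>) J ` A) ((+>) J ` B)"
proof
  note h = ring_hom_mult[OF ideal.rcos_ring_hom[OF J]] ring_hom_add[OF ideal.rcos_ring_hom[OF J]]
  have AB: "x \<in> carrier R" if "x \<in> A \<cdot> B" for x
    using that by (induction x rule: ideal_prod.induct) (use A B in auto)
  show "(+>) J ` (A \<cdot> B) \<subseteq> ideal_prod (R Quot J) ((+>) J ` A) ((+>) J ` B)"
  proof
    fix X assume "X \<in> (+>) J ` (A \<cdot> B)"
    then obtain x where x: "x \<in> A \<cdot> B" "X = J +> x" by blast
    from x(1) have "J +> x \<in> ideal_prod (R Quot J) ((+>) J ` A) ((+>) J ` B)"
    proof (induction x rule: ideal_prod.induct)
      case (prod i j)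
      then have "J +> (i \<otimes> j) = (J +> i) \<otimes>\<^bsub>R Quot J\<^esub> (J +> j)" using A B by (intro h(1)) auto
      then show ?case using prod by (auto intro!: ideal_prod.prod)
    next
      case (sum s t)
      then have "J +> (s \<oplus> t) = (J +> s) \<oplus>\<^bsub>R Quot J\<^esub> (J +> t)" using AB by (intro h(2)) auto
      then show ?case using sum by (auto intro!: ideal_prod.sum)
    qed
    then show "X \<in> ideal_prod (R Quot J) ((+>) J ` A) ((+>) J ` B)" using x by simp
  qed
  show "ideal_prod (R Quot J) ((+>) J ` A) ((+>) J ` B) \<subseteq> (+>) J ` (A \<cdot> B)"
  proof
    fix X assume "X \<in> ideal_prod (R Quot J) ((+>) J ` A) ((+>) J ` B)"
    then show "X \<in> (+>) J ` (A \<cdot> B)"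
    proof (induction X rule: ideal_prod.induct)
      case (prod X Y)
      then obtain i j where ij: "i \<in> A" "j \<in> B" "X = J +> i" "Y = J +> j" by blast
      then have "J +> (i \<otimes> j) = (J +> i) \<otimes>\<^bsub>R Quot J\<^esub> (J +> j)" using A B by (intro h(1)) auto
      moreover have "i \<otimes> j \<in> A \<cdot> B" using ij by (intro ideal_prod.prod)
      ultimately show ?case using ij by (metis imageI)
    next
      case (sum X Y)
      then obtain s t where st: "s \<in> A \<cdot> B" "t \<in> A \<cdot> B" "X = J +> s" "Y = J +> t" by blast
      then have "J +> (s \<oplus> t) = (J +> s) \<oplus>\<^bsub>R Quot J\<^esub> (J +> t)" using AB by (intro h(2)) auto
      moreover have "s \<oplus> t \<in> A \<cdot> B" using st by (intro ideal_prod.sum)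
      ultimately show ?case using st by (metis imageI)
    qed
  qed
qed

lemma quot_image_pow:
  assumes J: "ideal J R" and I: "ideal I R"
  shows "(+>) J ` (ideal_pow R I n) = ideal_pow (R Quot J) ((+>) J ` I) n"
proof -
  interpret S: cring "R Quot J" using ideal.quotient_is_cring[OF J cring_axioms] .
  show ?thesis
  proof (induction n)
    case 0
    have "(+>) J ` carrier R = carrier (R Quot J)"
      by (auto simp: FactRing_def A_RCOSETS_def RCOSETS_def a_r_coset_def)
    then show ?case unfolding ideal_pow_0 S.ideal_pow_0 .
  next
    case (Suc n)
    show ?case unfolding ideal_pow_Suc S.ideal_pow_Suc
      using quot_image_prod[OF J ideal_subset_carrier[OF ideal_pow_ideal[OF I]] ideal_subset_carrier[OF I]]
        Suc by metis
  qed
qed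

lemma ideal_power_prod_single:
  assumes "ideal K R"
  shows "ideal_power_prod R [K] n = ideal_pow R K (n 0)"
proof -
  interpret M: comm_monoid "ideals_set R" by (rule ideals_set_is_comm_monoid)
  have car: "ideal_pow R K m \<in> carrier (ideals_set R)" for m
    using ideal_pow_ideal[OF assms] by (simp add: ideals_set_def)
  have "ideal_power_prod R [K] n = finprod (ideals_set R) (\<lambda>k. ideal_pow R ([K] ! k) (n k)) (insert 0 {})"
    by (simp add: ideal_power_prod_def lessThan_Suc)
  also have "\<dots> = ideal_pow R K (n 0) \<otimes>\<^bsub>ideals_set R\<^esub> \<one>\<^bsub>ideals_set R\<^esub>"
    by (subst M.finprod_insert) (use car in auto)
  also have "\<dots> = ideal_pow R K (n 0) \<cdot> carrier R"
    by (simp add: ideals_set_def)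
  also have "\<dots> = ideal_pow R K (n 0)" by (rule ideal_prod_one[OF ideal_pow_ideal[OF assms]])
  finally show ?thesis .
qed

text \<open>Setting the inner exponents to 0 leaves one copy of \<open>I\<close> and the final
  \<open>\<mm>\<close>, which reduces the multigraded condition to the ideals
  \<open>\<mm>^r I^s\<close>.\<close>

lemma ideal_power_prod_ends:
  assumes "\<And>K. K \<in> set Is \<Longrightarrow> ideal K R" "length Is = Suc (Suc q)"
    and "\<And>j. 0 < j \<Longrightarrow> j < Suc q \<Longrightarrow> n j = 0"
  shows "ideal_power_prod R Is n = ideal_pow R (Is ! 0) (n 0) \<cdot> ideal_pow R (Is ! Suc q) (n (Suc q))"
proof -
  interpret M: comm_monoid "ideals_set R" by (rule ideals_set_is_comm_monoid)
  have mult: "A \<otimes>\<^bsub>ideals_set R\<^esub> B = A \<cdot> B" for A B by (simp add: ideals_set_def)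
  let ?f = "\<lambda>k. ideal_pow R (Is ! k) (n k)"
  have id: "ideal (?f k) R" if "k < Suc (Suc q)" for k
    using that assms by (intro ideal_pow_ideal) simp
  have f: "?f \<in> {..<Suc (Suc q)} \<rightarrow> carrier (ideals_set R)"
    using id by (auto simp: ideals_set_def)
  have one: "?f k = \<one>\<^bsub>ideals_set R\<^esub>" if "k \<in> {..<Suc (Suc q)} - {0, Suc q}" for k
    using that assms(3)[of k] by simp
  have "ideal_power_prod R Is n = finprod (ideals_set R) ?f {..<Suc (Suc q)}"
    by (simp add: ideal_power_prod_def assms(2))
  also have "\<dots> = finprod (ideals_set R) ?f {0, Suc q}"
    by (rule M.finprod_mono_neutral_cong_right) (use f one in auto)
  also have "\<dots> = ?f 0 \<otimes>\<^bsub>ideals_set R\<^esub> finprod (ideals_set R) ?f {Suc q}"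
    by (rule M.finprod_insert) (use f in auto)
  also have "finprod (ideals_set R) ?f {Suc q} = ?f (Suc q) \<otimes>\<^bsub>ideals_set R\<^esub> finprod (ideals_set R) ?f {}"
    by (rule M.finprod_insert) (use f in auto)
  also have "finprod (ideals_set R) ?f {} = carrier R"
    unfolding M.finprod_empty by (simp add: ideals_set_def)
  finally show ?thesis using ideal_prod_one[OF id[of "Suc q"]] unfolding mult by simp
qed

text \<open>Transfers superficiality from \<open>R / J\<close> to a colon condition in
  \<open>R\<close>: modulo \<open>J\<close>, the element \<open>a \<otimes> y\<close> lies in both
  \<open>(a)\<close> and \<open>U\<close>, hence equals \<open>a \<otimes> v\<close> with
  \<open>v\<close> in \<open>U'\<close>, and regularity cancels \<open>a\<close>.\<close>

lemma superficial_colon: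
  assumes J: "ideal J R" and U: "ideal U R" and U': "ideal U' R" and reg: "reg_mod J a"
    and sup: "cgenideal (R Quot J) (J +> a) \<inter> (+>) J ` U \<subseteq>
        ideal_prod (R Quot J) (cgenideal (R Quot J) (J +> a)) ((+>) J ` U')"
    and y: "y \<in> carrier R" "a \<otimes> y \<in> U <+> J"
  shows "y \<in> U' <+> J"
proof -
  interpret S: cring "R Quot J" using ideal.quotient_is_cring[OF J cring_axioms] .
  note h = ring_hom_mult[OF ideal.rcos_ring_hom[OF J]] ring_hom_closed[OF ideal.rcos_ring_hom[OF J]]
  note eq = quotient_eq_iff_same_a_r_cos[OF J]
  have ac: "a \<in> carrier R" using reg by (simp add: reg_mod_def)
  obtain u j where uj: "u \<in> U" "j \<in> J" "a \<otimes> y = u \<oplus> j" using y(2) by (auto simp: set_add_iff)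
  have car: "u \<in> carrier R" "j \<in> carrier R" using uj ideal_simps(2) U J by blast+
  have "a \<otimes> y \<ominus> u = j" unfolding uj(3) using car by algebra
  then have "J +> (a \<otimes> y) = J +> u" using eq[of "a \<otimes> y" u] uj(2) ac y(1) car by simp
  then have "J +> (a \<otimes> y) \<in> (+>) J ` U" using uj(1) by simp
  moreover have "J +> (a \<otimes> y) \<in> cgenideal (R Quot J) (J +> a)"
    using h(1)[OF y(1) ac] h(2)[OF y(1)] m_comm[OF ac y(1)] unfolding cgenideal_def by auto
  ultimately have "J +> (a \<otimes> y) \<in> ideal_prod (R Quot J) (cgenideal (R Quot J) (J +> a)) ((+>) J ` U')"
    using sup by blast
  then obtain v where v: "v \<in> U'" "J +> (a \<otimes> y) = (J +> a) \<otimes>\<^bsub>R Quot J\<^esub> (J +> v)"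
    using S.cgenideal_prod_elem[OF h(2)[OF ac] ring_ideal_imp_quot_ideal[OF J U']] by blast
  have vc: "v \<in> carrier R" using v ideal_simps(2)[OF U'] by blast
  have "J +> (a \<otimes> y) = J +> (a \<otimes> v)" using v(2) h(1)[OF ac vc] by simp
  then have "a \<otimes> y \<ominus> a \<otimes> v \<in> J" using eq ac y(1) vc by simp
  moreover have "a \<otimes> y \<ominus> a \<otimes> v = a \<otimes> (y \<ominus> v)" using ac y(1) vc by algebra
  ultimately have "y \<ominus> v \<in> J" using reg y(1) vc by (simp add: reg_mod_def)
  moreover have "y = v \<oplus> (y \<ominus> v)" using y(1) vc by algebra
  ultimately show ?thesis unfolding set_add_iff using v(1) by blast
qed

lemma regular_sequence_reg_mod:
  assumes "regular_sequence R as" "i < length as"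
  shows "reg_mod (Idl (set (take i as))) (as ! i)"
proof -
  let ?J = "Idl (set (take i as))"
  have car: "set as \<subseteq> carrier R" using assms(1) by (simp add: regular_sequence_def)
  then have J: "ideal ?J R" by (intro genideal_ideal) (use set_take_subset in fastforce)
  have ac: "as ! i \<in> carrier R" using car assms(2) by auto
  note h = ring_hom_mult[OF ideal.rcos_ring_hom[OF J]] ring_hom_closed[OF ideal.rcos_ring_hom[OF J]]
  have nz: "nonzerodivisor (R Quot ?J) (?J +> as ! i)"
    using assms by (simp add: regular_sequence_def Let_def)
  have "y \<in> ?J" if y: "y \<in> carrier R" "as ! i \<otimes> y \<in> ?J" for y
  proof -
    have "(?J +> as ! i) \<otimes>\<^bsub>R Quot ?J\<^esub> (?J +> y) = ?J"
      using h(1)[OF ac y(1)] quot_coset_eq_zero_iff[OF J, of "as ! i \<otimes> y"] y ac by simp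
    then have "?J +> y = ?J" using nz h(2)[OF y(1)] by (simp add: nonzerodivisor_def FactRing_def)
    then show ?thesis using quot_coset_eq_zero_iff[OF J y(1)] by simp
  qed
  then show ?thesis using ac by (simp add: reg_mod_def)
qed

text \<open>The bound on the first exponent is uniform in all others, so one \<open>N\<close> serves
  for every \<open>r\<close>. The later arguments compare \<open>r = 0\<close> with
  \<open>r = 1\<close> and need this uniformity.\<close>

lemma rees_superficial_colon:
  assumes J: "ideal J R" and I: "ideal I R" and M: "ideal M R" and reg: "reg_mod J a"
    and sup: "rees_superficial (R Quot J) (J +> a) (map (\<lambda>K. (\<lambda>y. J +> y) ` K) (replicate (Suc q) I @ [M]))"
  shows "\<exists>N. \<forall>s\<ge>N. \<forall>r. \<forall>y\<in>carrier R. a \<otimes> y \<in> (ideal_pow R M r \<cdot> ideal_pow R I s) <+> J \<longrightarrow>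
     y \<in> (ideal_pow R M r \<cdot> ideal_pow R I (s - 1)) <+> J"
proof -
  interpret S: cring "R Quot J" using ideal.quotient_is_cring[OF J cring_axioms] .
  let ?S = "R Quot J"
  let ?Is = "map (\<lambda>K. (\<lambda>y. J +> y) ` K) (replicate (Suc q) I @ [M])"
  obtain N where N: "\<And>n. n 0 \<ge> N \<Longrightarrow> cgenideal ?S (J +> a) \<inter> ideal_power_prod ?S ?Is n =
        ideal_prod ?S (cgenideal ?S (J +> a)) (ideal_power_prod ?S ?Is (n(0 := n 0 - 1)))"
    using sup unfolding rees_superficial_def by blast
  have ids: "ideal K ?S" if "K \<in> set ?Is" for K
    using that ring_ideal_imp_quot_ideal[OF J] I M by auto
  have len: "length ?Is = Suc (Suc q)" by simp
  have nth: "?Is ! 0 = (+>) J ` I" "?Is ! Suc q = (+>) J ` M" by (simp_all add: nth_append)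
  \<comment> \<open>The first copy of \<open>I\<close> carries \<open>s\<close>, the last slot
    carries \<open>r\<close> for \<open>M\<close>, and the remaining copies of \<open>I\<close> get
    exponent 0.\<close>
  define n where "n s r = (\<lambda>j. if j = 0 then s else if j = Suc q then r else 0)" for s r :: nat
  have prod: "ideal_power_prod ?S ?Is (n s r) = (+>) J ` (ideal_pow R M r \<cdot> ideal_pow R I s)" for s r
  proof -
    have "ideal_power_prod ?S ?Is (n s r) =
        ideal_prod ?S (ideal_pow ?S (?Is ! 0) (n s r 0)) (ideal_pow ?S (?Is ! Suc q) (n s r (Suc q)))"
      by (rule S.ideal_power_prod_ends[OF ids len]) (auto simp: n_def)
    also have "\<dots> = ideal_prod ?S ((+>) J ` ideal_pow R I s) ((+>) J ` ideal_pow R M r)"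
      unfolding nth quot_image_pow[OF J I] quot_image_pow[OF J M] by (simp add: n_def)
    also have "\<dots> = (+>) J ` (ideal_pow R I s \<cdot> ideal_pow R M r)"
      by (rule quot_image_prod[symmetric, OF J])
        (use ideal_subset_carrier ideal_pow_ideal I M in auto)
    finally show ?thesis using ideal_prod_commute[OF ideal_pow_ideal[OF I] ideal_pow_ideal[OF M]] by metis
  qed
  have upd: "(n s r)(0 := n s r 0 - 1) = n (s - 1) r" for s r by (auto simp: n_def)
  have "y \<in> (ideal_pow R M r \<cdot> ideal_pow R I (s - 1)) <+> J"
    if "s \<ge> N" "y \<in> carrier R" "a \<otimes> y \<in> (ideal_pow R M r \<cdot> ideal_pow R I s) <+> J" for s r y
  proof (rule superficial_colon[OF J _ _ reg _ that(2,3)])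
    show "ideal (ideal_pow R M r \<cdot> ideal_pow R I s) R" "ideal (ideal_pow R M r \<cdot> ideal_pow R I (s - 1)) R"
      using ideal_prod_is_ideal ideal_pow_ideal I M by auto
    have "n s r 0 \<ge> N" using that by (simp add: n_def)
    from N[of "n s r", OF this] show "cgenideal ?S (J +> a) \<inter> (+>) J ` (ideal_pow R M r \<cdot> ideal_pow R I s) \<subseteq>
        ideal_prod ?S (cgenideal ?S (J +> a)) ((+>) J ` (ideal_pow R M r \<cdot> ideal_pow R I (s - 1)))"
      unfolding upd prod by (rule equalityD1)
  qed
  then show ?thesis by blast
qed

lemma rees_superficial_colon_single:
  assumes J: "ideal J R" and M: "ideal M R" and reg: "reg_mod J a"
    and sup: "rees_superficial (R Quot J) (J +> a) [(\<lambda>y. J +> y) ` M]"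
  shows "\<exists>N. \<forall>n\<ge>N. \<forall>y\<in>carrier R. a \<otimes> y \<in> ideal_pow R M n <+> J \<longrightarrow> y \<in> ideal_pow R M (n - 1) <+> J"
proof -
  interpret S: cring "R Quot J" using ideal.quotient_is_cring[OF J cring_axioms] .
  let ?S = "R Quot J"
  obtain N where N: "\<And>n. n 0 \<ge> N \<Longrightarrow> cgenideal ?S (J +> a) \<inter> ideal_power_prod ?S [(+>) J ` M] n =
        ideal_prod ?S (cgenideal ?S (J +> a)) (ideal_power_prod ?S [(+>) J ` M] (n(0 := n 0 - 1)))"
    using sup unfolding rees_superficial_def by blast
  have prod: "ideal_power_prod ?S [(+>) J ` M] n = (+>) J ` ideal_pow R M (n 0)" for n
    unfolding S.ideal_power_prod_single[OF ring_ideal_imp_quot_ideal[OF J M]] quot_image_pow[OF J M] ..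
  have "y \<in> ideal_pow R M (n - 1) <+> J"
    if "n \<ge> N" "y \<in> carrier R" "a \<otimes> y \<in> ideal_pow R M n <+> J" for n y
  proof (rule superficial_colon[OF J ideal_pow_ideal[OF M] ideal_pow_ideal[OF M] reg _ that(2,3)])
    show "cgenideal ?S (J +> a) \<inter> (+>) J ` ideal_pow R M n \<subseteq>
        ideal_prod ?S (cgenideal ?S (J +> a)) ((+>) J ` ideal_pow R M (n - 1))"
      using N[of "\<lambda>_. n"] that(1) unfolding prod by simp
  qed
  then show ?thesis by blast
qed

end

section \<open>Superficial sequences and Hilbert coefficients\<close>

context noetherian_local_ring
begin

section \<open>Polynomiality of colength functions\<close>

lemma colen_antimono:
  assumes "open_ideal K" "ideal L R" "K \<subseteq> L"
  shows "colen L \<le> colen K"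
  using ideal_len_colen_diff(2)[OF assms] .

text \<open>The difference is the length of \<open>(Q^n + J) / (W Q^n + J)\<close>, to which the
  leading-monomial argument applies with generators of \<open>Q\<close>. Openness of
  \<open>W\<close> makes these lengths finite.\<close>

lemma colen_diff_ev_poly:
  assumes W: "open_ideal W" and Q: "open_ideal Q" and J: "ideal J R"
    and growth: "poly_growth D (\<lambda>n. int (colen (W \<cdot> ideal_pow R Q n <+> J)) - int (colen (ideal_pow R Q n <+> J)))"
  shows "ev_poly D (\<lambda>n. int (colen (W \<cdot> ideal_pow R Q n <+> J)) - int (colen (ideal_pow R Q n <+> J)))"
proof -
  obtain zs where zs: "set zs \<subseteq> carrier R" "Q = Idl (set zs)"
    using ideal_list_generated[OF open_ideal_ideal[OF Q]] by blast
  note Wi = open_ideal_ideal[OF W] and Qi = open_ideal_ideal[OF Q]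
  note Qn = ideal_pow_ideal[OF Qi]
  define V where "V n = W \<cdot> ideal_pow R Q n <+> J" for n
  define U where "U n = ideal_pow R Q n <+> J" for n
  have Vi: "ideal (V n) R" and Ui: "ideal (U n) R" for n
    unfolding V_def U_def using add_ideals[OF ideal_prod_is_ideal[OF Wi Qn] J] add_ideals[OF Qn J] by auto
  have VU: "V n \<subseteq> U n" for n
    unfolding V_def U_def using ideal_prod_inter[OF Wi Qn] by (intro set_add_mono) auto
  have Vo: "open_ideal (V n)" for n
    unfolding V_def using open_ideal_add[OF open_ideal_prod[OF W open_ideal_pow[OF Q]] J] .
  have gen: "Idl (V n \<union> mon R zs ` comps (length zs) n) = U n" for n
  proof
    have "mon R zs \<alpha> \<in> ideal_pow R Q n" if "\<alpha> \<in> comps (length zs) n" for \<alpha>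
      using mon_in_pow[OF zs(1), of \<alpha>] that zs(2) by (simp add: comps_def)
    then have "mon R zs ` comps (length zs) n \<subseteq> U n"
      unfolding U_def using ideal_set_add_upper(1)[OF Qn J] by blast
    then show "Idl (V n \<union> mon R zs ` comps (length zs) n) \<subseteq> U n"
      using VU by (intro genideal_minimal[OF Ui]) simp
    have car: "V n \<union> mon R zs ` comps (length zs) n \<subseteq> carrier R"
      using ideal_subset_carrier[OF Vi] mon_closed[OF zs(1)] by auto
    note G = genideal_ideal[OF car] genideal_self[OF car]
    have "ideal_pow R Q n \<subseteq> Idl (mon R zs ` comps (length zs) n)"
      unfolding zs(2) by (rule ideal_pow_generators[OF zs(1)])
    also have "\<dots> \<subseteq> Idl (V n \<union> mon R zs ` comps (length zs) n)"
      using car by (intro subset_Idl_subset) auto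
    finally have 1: "ideal_pow R Q n \<subseteq> Idl (V n \<union> mon R zs ` comps (length zs) n)" .
    have "J \<subseteq> V n" unfolding V_def by (rule ideal_set_add_upper(2)[OF ideal_prod_is_ideal[OF Wi Qn] J])
    then have "J \<subseteq> Idl (V n \<union> mon R zs ` comps (length zs) n)" using G(2) by blast
    with 1 show "U n \<subseteq> Idl (V n \<union> mon R zs ` comps (length zs) n)"
      unfolding U_def by (intro set_add_least[OF G(1)])
  qed
  have len: "ideal_len R (U n) (V n) = enat (colen (V n) - colen (U n))" "colen (U n) \<le> colen (V n)" for n
    using ideal_len_colen_diff[OF Vo Ui VU] by auto
  have eq: "int (the_enat (ideal_len R (U n) (V n))) = int (colen (V n)) - int (colen (U n))" for n
    using len by (simp add: of_nat_diff)
  have "ev_poly D (\<lambda>n. int (the_enat (ideal_len R (Idl (V n \<union> mon R zs ` comps (length zs) n)) (V n))))"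
  proof (rule graded_length_ev_poly[OF zs(1) Vi])
    fix z v n assume z: "z \<in> set zs" and v: "v \<in> V n"
    have zQ: "z \<in> Q" using genideal_self[OF zs(1)] z zs(2) by blast
    have zc: "z \<in> carrier R" using z zs(1) by blast
    have "z \<otimes> w \<in> W \<cdot> ideal_pow R Q (Suc n)" if "w \<in> W \<cdot> ideal_pow R Q n" for w
    proof -
      have "z \<otimes> w \<in> Q \<cdot> (W \<cdot> ideal_pow R Q n)" using zQ that by (rule ideal_prod.prod)
      also have "\<dots> = W \<cdot> ideal_pow R Q (Suc n)"
        unfolding ideal_pow_Suc2[OF Qi]
        using ideal_prod_assoc[OF Qi Wi Qn] ideal_prod_assoc[OF Wi Qi Qn] ideal_prod_commute[OF Qi Wi] by metis
      finally show ?thesis .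
    qed
    with v show "z \<otimes> v \<in> V (Suc n)"
      unfolding V_def by (intro mult_set_add[OF ideal_prod_is_ideal[OF Wi Qn] J zc])
  next
    show "ideal_len R (Idl (V n \<union> mon R zs ` comps (length zs) n)) (V n) \<noteq> \<infinity>" for n
      unfolding gen len by simp
    show "poly_growth D (\<lambda>n. int (the_enat (ideal_len R (Idl (V n \<union> mon R zs ` comps (length zs) n)) (V n))))"
      unfolding gen eq using growth unfolding V_def U_def .
  qed
  then show ?thesis unfolding gen eq unfolding V_def U_def .
qed

text \<open>Split the colength at \<open>Q^n + J\<close>. The upper part \<open>h0\<close> has
  differences of the kind just treated, with \<open>W = Q\<close>, so it is polynomial of degree at
  most \<open>D + 1\<close>; the bound \<open>h0 \<le> hW\<close> lowers this to
  \<open>D\<close>.\<close>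

lemma colen_ev_poly:
  assumes W: "open_ideal W" and Q: "open_ideal Q" and J: "ideal J R"
    and growth: "poly_growth D (\<lambda>n. int (colen (W \<cdot> ideal_pow R Q n <+> J)))"
  shows "ev_poly D (\<lambda>n. int (colen (W \<cdot> ideal_pow R Q n <+> J)))"
proof -
  note Wi = open_ideal_ideal[OF W] and Qi = open_ideal_ideal[OF Q]
  note Qn = ideal_pow_ideal[OF Qi]
  define h0 where "h0 n = int (colen (ideal_pow R Q n <+> J))" for n
  define hW where "hW n = int (colen (W \<cdot> ideal_pow R Q n <+> J))" for n
  have h0_nonneg: "0 \<le> h0 n" for n by (simp add: h0_def)
  have h0_le: "h0 n \<le> hW n" for n
    unfolding h0_def hW_def of_nat_le_iff
  proof (rule colen_antimono)
    show "open_ideal (W \<cdot> ideal_pow R Q n <+> J)"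
      using open_ideal_add[OF open_ideal_prod[OF W open_ideal_pow[OF Q]] J] .
    show "ideal (ideal_pow R Q n <+> J) R" by (rule add_ideals[OF Qn J])
    show "W \<cdot> ideal_pow R Q n <+> J \<subseteq> ideal_pow R Q n <+> J"
      using ideal_prod_inter[OF Wi Qn] by (intro set_add_mono) auto
  qed
  have g: "poly_growth D hW" using growth unfolding hW_def .
  have g0: "poly_growth D h0"
  proof (rule poly_growth_mono[OF g])
    show "\<bar>h0 n\<bar> \<le> \<bar>hW n\<bar>" for n using h0_le[of n] h0_nonneg[of n] by linarith
  qed
  have "ev_poly D (\<lambda>n. hW n - h0 n)"
    using colen_diff_ev_poly[OF W Q J] poly_growth_diff[OF g g0] unfolding hW_def h0_def by blast
  moreover have "ev_poly D h0"
  proof -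
    have "Q \<cdot> ideal_pow R Q n = ideal_pow R Q (Suc n)" for n by (simp only: ideal_pow_Suc2[OF Qi])
    then have fd: "forward_diff h0 = (\<lambda>n. int (colen (Q \<cdot> ideal_pow R Q n <+> J)) - int (colen (ideal_pow R Q n <+> J)))"
      by (intro ext) (simp only: forward_diff_def h0_def)
    have "poly_growth D (\<lambda>n. h0 (n + 1))" by (rule poly_growth_shift[OF g0])
    then have "poly_growth D (\<lambda>n. h0 (n + 1) - h0 n)" using g0 by (rule poly_growth_diff)
    then have "poly_growth D (forward_diff h0)" by (simp add: forward_diff_def[abs_def])
    then have "ev_poly D (forward_diff h0)" using colen_diff_ev_poly[OF Q Q J] unfolding fd by blast
    then have "ev_poly (Suc D) h0" by simp
    then show ?thesis using g0 by (rule ev_poly_reduce)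
  qed
  ultimately have "ev_poly D (\<lambda>n. (hW n - h0 n) + h0 n)" by (rule ev_poly_add)
  then show ?thesis by (simp add: hW_def)
qed

end

text \<open>The hypotheses restated as regularity, colon and openness conditions inside
  \<open>R\<close>. Quotient rings and the dimension no longer appear from here on.\<close>

locale superficial_data = noetherian_local_ring +
  fixes I :: "'a set" and as :: "'a list" and x :: 'a
  assumes open_I: "open_ideal I" and I_m: "I \<subseteq> \<mm>" and as_I: "set as \<subseteq> I" and x_m: "x \<in> \<mm>"
    and reg_as: "i < length as \<Longrightarrow> reg_mod (Idl (set (take i as))) (as ! i)"
    and reg_x: "reg_mod (Idl (set as)) x"
    and colon_as: "i < length as \<Longrightarrow> \<exists>N. \<forall>s\<ge>N. \<forall>r. \<forall>y\<in>carrier R.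
      as ! i \<otimes> y \<in> (ideal_pow R \<mm> r \<cdot> ideal_pow R I s) <+> Idl (set (take i as)) \<longrightarrow>
      y \<in> (ideal_pow R \<mm> r \<cdot> ideal_pow R I (s - 1)) <+> Idl (set (take i as))"
    and colon_x: "\<exists>N. \<forall>n\<ge>N. \<forall>y\<in>carrier R.
      x \<otimes> y \<in> ideal_pow R \<mm> n <+> Idl (set as) \<longrightarrow> y \<in> ideal_pow R \<mm> (n - 1) <+> Idl (set as)"
    and open_x: "open_ideal (PIdl x <+> Idl (set as))"
begin

section \<open>Colengths modulo initial segments of the sequence\<close>

definition J :: "nat \<Rightarrow> 'a set" where "J i = Idl (set (take i as))"
definition U :: "nat \<Rightarrow> nat \<Rightarrow> 'a set" where "U r s = ideal_pow R \<mm> r \<cdot> ideal_pow R I s"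
definition b :: "nat \<Rightarrow> nat \<Rightarrow> nat \<Rightarrow> int" where "b i r s = int (colen (U r s <+> J i))"
abbreviation l :: nat where "l \<equiv> length as"
definition c :: nat where "c = colen (PIdl x <+> J l)"

lemma I_ideal: "ideal I R" using open_I by (rule open_ideal_ideal)
lemma I_pow: "ideal (ideal_pow R I n) R" using I_ideal by (rule ideal_pow_ideal)
lemma m_pow: "ideal (ideal_pow R \<mm> n) R" using m_ideal by (rule ideal_pow_ideal)

lemma as_carrier: "set as \<subseteq> carrier R" using as_I ideal_subset_carrier[OF I_ideal] by blast
lemma take_carrier: "set (take i as) \<subseteq> carrier R" using as_carrier set_take_subset[of i as] by blast

lemma J_ideal: "ideal (J i) R" unfolding J_def using take_carrier by (rule genideal_ideal)
lemma J_l: "J l = Idl (set as)" by (simp add: J_def)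

lemma J_0: "J 0 = {\<zero>}"
proof -
  have "Idl {} \<subseteq> {\<zero>}" by (rule genideal_minimal[OF zeroideal]) simp
  moreover have "\<zero> \<in> J 0" by (rule ideal_simps(1)[OF J_ideal])
  ultimately show ?thesis by (auto simp: J_def)
qed

lemma x_carrier: "x \<in> carrier R" using x_m ideal_simps(2)[OF m_ideal] by blast
lemma x_ideal: "ideal (PIdl x) R" using x_carrier by (rule cgenideal_ideal)

lemma U_open: "open_ideal (U r s)"
  unfolding U_def by (intro open_ideal_prod open_ideal_pow open_ideal_m open_I)
lemma U_ideal: "ideal (U r s) R" using U_open by (rule open_ideal_ideal)

lemma U_0: "U r 0 = ideal_pow R \<mm> r" "U 0 s = ideal_pow R I s"
  unfolding U_def ideal_pow_0 using ideal_prod_one m_pow I_pow ideal_prod_commute[OF oneideal]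
  by simp_all

lemma U_1: "U 1 s = \<mm> \<cdot> ideal_pow R I s"
  unfolding U_def One_nat_def ideal_pow_Suc2[OF m_ideal] ideal_pow_0 ideal_prod_one[OF m_ideal] ..

lemma UJ_open: "open_ideal (U r s <+> J i)"
  by (rule open_ideal_add[OF U_open J_ideal])

lemma J_Suc:
  assumes "i < l"
  shows "J (Suc i) = PIdl (as ! i) <+> J i"
proof -
  have "set (take (Suc i) as) = insert (as ! i) (set (take i as))"
    using assms by (simp add: take_Suc_conv_app_nth)
  moreover have ac: "as ! i \<in> carrier R" using assms as_carrier by auto
  ultimately have "J (Suc i) = J i <+> PIdl (as ! i)"
    unfolding J_def using genideal_insert_eq[OF take_carrier ac] by simp
  then show ?thesis
    using set_add_comm[OF ideal_subset_carrier[OF J_ideal] ideal_subset_carrier[OF cgenideal_ideal[OF ac]]] by simp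
qed

lemma U_mult_I:
  assumes "a \<in> I" "y \<in> U r s"
  shows "a \<otimes> y \<in> U r (Suc s)"
proof -
  have "a \<otimes> y \<in> I \<cdot> U r s" using assms by (rule ideal_prod.prod)
  also have "\<dots> = U r (Suc s)"
    unfolding U_def ideal_pow_Suc2[OF I_ideal]
    using ideal_prod_assoc[OF I_ideal m_pow I_pow] ideal_prod_assoc[OF m_pow I_ideal I_pow]
      ideal_prod_commute[OF I_ideal m_pow] by metis
  finally show ?thesis .
qed

text \<open>For large \<open>s\<close> the colon of the next element into
  \<open>U r (Suc s) + J i\<close> is exactly \<open>U r s + J i\<close>: one inclusion is
  multiplication by an element of \<open>I\<close>, the other is superficiality.\<close>

lemma b_step:
  assumes i: "i < l"
  shows "\<exists>N. \<forall>s\<ge>N. \<forall>r. b i r (Suc s) - b i r s = b (Suc i) r (Suc s)"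
proof -
  let ?a = "as ! i"
  obtain N where N: "\<And>s r y. N \<le> s \<Longrightarrow> y \<in> carrier R \<Longrightarrow> ?a \<otimes> y \<in> U r s <+> J i \<Longrightarrow> y \<in> U r (s - 1) <+> J i"
    using colon_as[OF i] unfolding U_def J_def by blast
  have aI: "?a \<in> I" using as_I i by auto
  then have ac: "?a \<in> carrier R" using ideal_simps(2)[OF I_ideal] by blast
  have "b i r (Suc s) - b i r s = b (Suc i) r (Suc s)" if "N \<le> s" for s r
  proof -
    have "colen (U r (Suc s) <+> J i) = colen (PIdl ?a <+> (U r (Suc s) <+> J i)) + colen (U r s <+> J i)"
    proof (rule colen_mult[OF UJ_open add_ideals[OF U_ideal J_ideal] ac])
      fix y assume "y \<in> U r s <+> J i"
      then show "?a \<otimes> y \<in> U r (Suc s) <+> J i"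
        using U_mult_I[OF aI] by (intro mult_set_add[OF U_ideal J_ideal ac])
    next
      fix y assume "y \<in> carrier R" "?a \<otimes> y \<in> U r (Suc s) <+> J i"
      then show "y \<in> U r s <+> J i" using N[of "Suc s" y r] that by simp
    qed
    moreover have "PIdl ?a <+> (U r (Suc s) <+> J i) = U r (Suc s) <+> J (Suc i)"
    proof -
      note car = ideal_subset_carrier[OF cgenideal_ideal[OF ac]] ideal_subset_carrier[OF U_ideal[of r "Suc s"]]
        ideal_subset_carrier[OF J_ideal[of i]]
      have "PIdl ?a <+> (U r (Suc s) <+> J i) = (PIdl ?a <+> U r (Suc s)) <+> J i"
        using add.set_mult_assoc[OF car] by (simp add: set_add_def)
      also have "PIdl ?a <+> U r (Suc s) = U r (Suc s) <+> PIdl ?a" by (rule set_add_comm[OF car(1,2)])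
      also have "(U r (Suc s) <+> PIdl ?a) <+> J i = U r (Suc s) <+> (PIdl ?a <+> J i)"
        using add.set_mult_assoc[OF car(2,1,3)] by (simp add: set_add_def)
      finally show ?thesis unfolding J_Suc[OF i] .
    qed
    ultimately show ?thesis unfolding b_def by simp
  qed
  then show ?thesis by blast
qed

text \<open>Reindexed from the one-dimensional end: in the inductions below, \<open>l - i\<close>
  stands for \<open>i\<close> summations starting from \<open>J l\<close>, which gives degree
  \<open>Suc i\<close>.\<close>

lemma b_step_down:
  assumes "Suc i \<le> l"
  obtains N where
    "\<And>r s. N \<le> s \<Longrightarrow> b (l - Suc i) r (Suc s) - b (l - Suc i) r s = b (l - i) r (Suc s)"
proof -
  have "l - Suc i < l" "Suc (l - Suc i) = l - i" using assms by auto
  then show ?thesis using b_step[of "l - Suc i"] that by auto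
qed

text \<open>For large \<open>r\<close>, an element of \<open>\<mm>^(r+1)\<close> lies in
  \<open>(x) + J\<close>, and the colon condition puts its cofactor of \<open>x\<close> into
  \<open>\<mm>^r + J\<close>. Multiplying by \<open>I^s\<close> makes the resulting identity uniform
  in \<open>s\<close>.\<close>

lemma b_top_r: "\<exists>N. \<forall>r\<ge>N. \<forall>s. b l (Suc r) s = int c + b l r s"
proof -
  obtain k where k: "ideal_pow R \<mm> k \<subseteq> PIdl x <+> J l"
    using open_x unfolding open_ideal_def J_l by blast
  obtain N where N: "\<And>n y. N \<le> n \<Longrightarrow> y \<in> carrier R \<Longrightarrow> x \<otimes> y \<in> ideal_pow R \<mm> n <+> J l \<Longrightarrow>
      y \<in> ideal_pow R \<mm> (n - 1) <+> J l"
    using colon_x unfolding J_l by blast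
  have "b l (Suc r) s = int c + b l r s" if r: "max k N \<le> r" for r s
  proof -
    have idxr: "ideal ((PIdl x) \<cdot> ideal_pow R \<mm> r) R" by (rule ideal_prod_is_ideal[OF x_ideal m_pow])
    have idxU: "ideal ((PIdl x) \<cdot> U r s) R" by (rule ideal_prod_is_ideal[OF x_ideal U_ideal])
    have sub: "ideal_pow R \<mm> (Suc r) \<subseteq> (PIdl x) \<cdot> ideal_pow R \<mm> r <+> J l"
    proof
      fix y assume y: "y \<in> ideal_pow R \<mm> (Suc r)"
      have "y \<in> PIdl x <+> J l"
        using y k ideal_pow_antimono[OF m_ideal, of k "Suc r"] r by auto
      then obtain t j where tj: "t \<in> carrier R" "j \<in> J l" "y = t \<otimes> x \<oplus> j"
        by (auto simp: set_add_iff cgenideal_def)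
      have jc: "j \<in> carrier R" using ideal_simps(2)[OF J_ideal tj(2)] .
      have yc: "y \<in> carrier R" using tj jc x_carrier by simp
      have "x \<otimes> t = y \<oplus> \<ominus> j" using tj jc x_carrier by algebra
      moreover have "\<ominus> j \<in> J l" using ideal_simps(4)[OF J_ideal tj(2)] .
      ultimately have "x \<otimes> t \<in> ideal_pow R \<mm> (Suc r) <+> J l" unfolding set_add_iff using y by blast
      then have "t \<in> ideal_pow R \<mm> r <+> J l" using N[of "Suc r" t] r tj(1) by simp
      then obtain w j' where wj: "w \<in> ideal_pow R \<mm> r" "j' \<in> J l" "t = w \<oplus> j'" by (auto simp: set_add_iff)
      have car: "w \<in> carrier R" "j' \<in> carrier R"
        using wj ideal_simps(2)[OF m_pow] ideal_simps(2)[OF J_ideal] by auto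
      have "y = x \<otimes> w \<oplus> (x \<otimes> j' \<oplus> j)" using tj(3) wj(3) car jc x_carrier by algebra
      moreover have "x \<otimes> w \<in> (PIdl x) \<cdot> ideal_pow R \<mm> r"
        using cgenideal_self[OF x_carrier] wj(1) by (rule ideal_prod.prod)
      moreover have "x \<otimes> j' \<oplus> j \<in> J l"
        using ideal_simps(3,6)[OF J_ideal] wj(2) tj(2) x_carrier by simp
      ultimately show "y \<in> (PIdl x) \<cdot> ideal_pow R \<mm> r <+> J l" unfolding set_add_iff by blast
    qed
    have "U (Suc r) s <+> J l = (PIdl x) \<cdot> U r s <+> J l"
    proof
      have "U (Suc r) s \<subseteq> ((PIdl x) \<cdot> ideal_pow R \<mm> r <+> J l) \<cdot> ideal_pow R I s"
        unfolding U_def by (rule ideal_prod_mono[OF sub order_refl])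
      also have "\<dots> = ((PIdl x) \<cdot> ideal_pow R \<mm> r) \<cdot> ideal_pow R I s <+> J l \<cdot> ideal_pow R I s"
        by (rule ideal_prod_distr(2)[OF I_pow idxr J_ideal])
      also have "((PIdl x) \<cdot> ideal_pow R \<mm> r) \<cdot> ideal_pow R I s = (PIdl x) \<cdot> U r s"
        unfolding U_def by (rule ideal_prod_assoc[OF x_ideal m_pow I_pow])
      also have "(PIdl x) \<cdot> U r s <+> J l \<cdot> ideal_pow R I s \<subseteq> (PIdl x) \<cdot> U r s <+> J l"
        using ideal_prod_inter[OF J_ideal I_pow] by (intro set_add_mono) auto
      finally show "U (Suc r) s <+> J l \<subseteq> (PIdl x) \<cdot> U r s <+> J l"
        using add_ideals[OF idxU J_ideal] ideal_set_add_upper(2)[OF idxU J_ideal] by (intro set_add_least)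
      have "(PIdl x) \<cdot> U r s \<subseteq> \<mm> \<cdot> U r s"
        using cgenideal_minimal[OF m_ideal x_m] by (intro ideal_prod_mono) auto
      also have "\<dots> = U (Suc r) s"
        unfolding U_def ideal_pow_Suc2[OF m_ideal] by (rule ideal_prod_assoc[symmetric, OF m_ideal m_pow I_pow])
      finally show "(PIdl x) \<cdot> U r s <+> J l \<subseteq> U (Suc r) s <+> J l" by (intro set_add_mono order_refl)
    qed
    then show ?thesis
      using colen_reg_mult(2)[OF J_ideal[of l] _ _ U_open, of x r s] reg_x open_x
      by (simp add: b_def c_def J_l)
  qed
  then show ?thesis by blast
qed

text \<open>Iterates \<open>colen_reg_mult\<close>. The powers of \<open>(x)\<close> are the
  yardstick of linear growth modulo \<open>J\<close>. The induction carries openness along because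
  its step requires it.\<close>

lemma x_pow_colen: "open_ideal (ideal_pow R (PIdl x) n <+> J l)" "colen (ideal_pow R (PIdl x) n <+> J l) = n * c"
proof -
  have "open_ideal (ideal_pow R (PIdl x) n <+> J l) \<and> colen (ideal_pow R (PIdl x) n <+> J l) = n * c"
  proof (induction n)
    case 0
    have eq: "carrier R <+> J l = carrier R"
      using set_add_least[OF oneideal order_refl ideal_subset_carrier[OF J_ideal]]
        ideal_set_add_upper(1)[OF oneideal J_ideal] by blast
    have "colen (carrier R) = 0" by (simp add: colen_def ideal_len_refl flip: enat_0)
    then show ?case unfolding ideal_pow_0 eq using open_ideal_carrier by simp
  next
    case (Suc n)
    let ?K = "ideal_pow R (PIdl x) n <+> J l"
    note Xn = ideal_pow_ideal[OF x_ideal, of n]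
    have idX: "ideal ((PIdl x) \<cdot> ideal_pow R (PIdl x) n) R" by (rule ideal_prod_is_ideal[OF x_ideal Xn])
    have "(PIdl x) \<cdot> ?K <+> J l = ideal_pow R (PIdl x) (Suc n) <+> J l"
    proof
      have "(PIdl x) \<cdot> ?K = (PIdl x) \<cdot> ideal_pow R (PIdl x) n <+> (PIdl x) \<cdot> J l"
        by (rule ideal_prod_distr(1)[OF x_ideal Xn J_ideal])
      also have "\<dots> \<subseteq> (PIdl x) \<cdot> ideal_pow R (PIdl x) n <+> J l"
        using ideal_prod_inter[OF x_ideal J_ideal] by (intro set_add_mono) auto
      finally show "(PIdl x) \<cdot> ?K <+> J l \<subseteq> ideal_pow R (PIdl x) (Suc n) <+> J l"
        unfolding ideal_pow_Suc2[OF x_ideal]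
        using add_ideals[OF idX J_ideal] ideal_set_add_upper(2)[OF idX J_ideal] by (intro set_add_least)
      show "ideal_pow R (PIdl x) (Suc n) <+> J l \<subseteq> (PIdl x) \<cdot> ?K <+> J l"
        unfolding ideal_pow_Suc2[OF x_ideal]
        by (intro set_add_mono ideal_prod_mono order_refl ideal_set_add_upper(1)[OF Xn J_ideal])
    qed
    moreover have "?K <+> J l = ?K"
    proof
      have id: "ideal ?K R" by (rule add_ideals[OF Xn J_ideal])
      show "?K <+> J l \<subseteq> ?K"
        by (intro set_add_least[OF id] order_refl ideal_set_add_upper(2)[OF Xn J_ideal])
      show "?K \<subseteq> ?K <+> J l" by (rule ideal_set_add_upper(1)[OF id J_ideal])
    qed
    ultimately show ?case
      using colen_reg_mult[OF J_ideal[of l] _ _ conjunct1[OF Suc], of x] reg_x open_x Suc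
      by (simp add: c_def J_l)
  qed
  then show "open_ideal (ideal_pow R (PIdl x) n <+> J l)" "colen (ideal_pow R (PIdl x) n <+> J l) = n * c" by auto
qed

text \<open>Since \<open>x^k\<close> lies in \<open>I\<close> for some \<open>k\<close>, the ideal
  \<open>(x)^(k n)\<close> lies in \<open>I^n\<close>, and its colength modulo \<open>J\<close> is
  known.\<close>

lemma b_top_growth: "poly_growth 1 (\<lambda>n. b l 0 n)"
proof -
  obtain k where k: "ideal_pow R \<mm> k \<subseteq> I" using open_I by (auto simp: open_ideal_def)
  have "ideal_pow R (PIdl x) k \<subseteq> I"
    using k ideal_pow_mono[OF cgenideal_minimal[OF m_ideal x_m], of k] by blast
  have "colen (U 0 n <+> J l) \<le> (k * n) * c" for n
  proof -
    have "ideal_pow R (PIdl x) (k * n) = ideal_pow R (ideal_pow R (PIdl x) k) n"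
      by (rule ideal_pow_pow[symmetric, OF x_ideal])
    also have "\<dots> \<subseteq> ideal_pow R I n" using \<open>ideal_pow R (PIdl x) k \<subseteq> I\<close> by (rule ideal_pow_mono)
    finally have "ideal_pow R (PIdl x) (k * n) <+> J l \<subseteq> U 0 n <+> J l"
      unfolding U_0 by (intro set_add_mono order_refl)
    from colen_antimono[OF x_pow_colen(1) open_ideal_ideal[OF UJ_open] this]
    show ?thesis unfolding x_pow_colen(2) .
  qed
  then have *: "real (colen (U 0 n <+> J l)) \<le> real (k * c) * real n" for n
    by (metis (no_types) mult.assoc mult.commute of_nat_le_iff of_nat_mult)
  have "\<bar>real_of_int (b l 0 n)\<bar> \<le> real (k * c) * real (Suc n) ^ 1" for n
  proof -
    have "real (k * c) * real n \<le> real (k * c) * real (Suc n)" by (intro mult_left_mono) auto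
    then show ?thesis using *[of n] by (simp only: b_def of_int_of_nat_eq abs_of_nat power_one_right)
  qed
  then show ?thesis unfolding poly_growth_def by blast
qed

lemma b_growth: "i \<le> l \<Longrightarrow> poly_growth (Suc i) (\<lambda>n. b (l - i) 0 n)"
proof (induction i)
  case 0
  then show ?case using b_top_growth by simp
next
  case (Suc i)
  obtain N where "\<And>r s. N \<le> s \<Longrightarrow> b (l - Suc i) r (Suc s) - b (l - Suc i) r s = b (l - i) r (Suc s)"
    using b_step_down[OF Suc.prems] by blast
  then show ?case using Suc by (intro poly_growth_antidiff[of "Suc i" "\<lambda>n. b (l - i) 0 n" N]) auto
qed

text \<open>From \<open>I \<subseteq> \<mm>\<close> follows
  \<open>I^(r+s) \<subseteq> \<mm>^r I^s\<close>, so growth bounds for powers of \<open>I\<close>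
  control both variables.\<close>

lemma b_le: "b i r s \<le> b i 0 (r + s)"
proof -
  have "U 0 (r + s) \<subseteq> U r s"
    unfolding U_0 ideal_pow_add[OF I_ideal] unfolding U_def
    by (intro ideal_prod_mono ideal_pow_mono I_m order_refl)
  then have "U 0 (r + s) <+> J i \<subseteq> U r s <+> J i" by (intro set_add_mono order_refl)
  from colen_antimono[OF UJ_open open_ideal_ideal[OF UJ_open] this] show ?thesis by (simp add: b_def)
qed

lemma b_growth_both:
  assumes "i \<le> l"
  shows "poly_growth (Suc i) (\<lambda>s. b (l - i) r s)" "poly_growth (Suc i) (\<lambda>r. b (l - i) r s)"
proof -
  have nonneg: "0 \<le> b i r s" for i r s by (simp add: b_def)
  have le: "\<bar>b (l - i) r s\<bar> \<le> \<bar>b (l - i) 0 (r + s)\<bar>" for r s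
    using b_le[of "l - i" r s] nonneg[of "l - i" r s] by linarith
  show "poly_growth (Suc i) (\<lambda>s. b (l - i) r s)"
    using poly_growth_shift[OF b_growth[OF assms], of r]
  proof (rule poly_growth_mono)
    show "\<bar>b (l - i) r n\<bar> \<le> \<bar>b (l - i) 0 (n + r)\<bar>" for n
      using le[of r n] by (simp only: add.commute)
  qed
  show "poly_growth (Suc i) (\<lambda>r. b (l - i) r s)"
    using poly_growth_shift[OF b_growth[OF assms], of s]
    by (rule poly_growth_mono) (rule le)
qed

text \<open>The same theorem serves both variables, with \<open>\<mm>\<close> and \<open>I\<close>
  exchanging the roles of fixed factor and varying power.\<close>

lemma b_ev_poly:
  assumes "i \<le> l"
  shows "ev_poly (Suc i) (\<lambda>s. b (l - i) r s)" "ev_poly (Suc i) (\<lambda>r. b (l - i) r s)"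
proof -
  show "ev_poly (Suc i) (\<lambda>s. b (l - i) r s)"
    unfolding b_def U_def
    by (rule colen_ev_poly[OF open_ideal_pow[OF open_ideal_m] open_I J_ideal
          b_growth_both(1)[OF assms, unfolded b_def U_def]])
  have eq: "b (l - i) r s = int (colen (ideal_pow R I s \<cdot> ideal_pow R \<mm> r <+> J (l - i)))" for r
    unfolding b_def U_def using ideal_prod_commute[OF m_pow I_pow] by simp
  show "ev_poly (Suc i) (\<lambda>r. b (l - i) r s)"
    unfolding eq
    by (rule colen_ev_poly[OF open_ideal_pow[OF open_I] open_ideal_m J_ideal
          b_growth_both(2)[OF assms, of s, unfolded eq]])
qed

end

section \<open>Reading multiplicities off eventual formulas\<close>

lemma alternating_eq_binom_poly:
  "(\<Sum>i\<le>l. (-1) ^ i * f i * int ((n + l - i) choose (l - i))) = binom_poly (\<lambda>j. (-1) ^ (l - j) * f (l - j)) l n"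
  unfolding binom_poly_def
  by (rule sum.reindex_bij_witness[of _ "\<lambda>j. l - j" "\<lambda>i. l - i"]) auto

text \<open>The alternating form numbers coefficients from the top degree down, so its index 0 is
  index \<open>D\<close> of \<open>binom_poly\<close>, with sign 1.\<close>

lemma the_leading_coeff:
  assumes "\<forall>\<^sub>F n in sequentially. \<exists>k::nat. len n = enat k \<and> int k = binom_poly g D n"
  shows "(THE c. \<exists>f. (\<forall>\<^sub>F n in sequentially. \<exists>k::nat. len n = enat k \<and>
      int k = (\<Sum>i\<le>D. (-1) ^ i * f i * int ((n + D - i) choose (D - i)))) \<and> f 0 = c) = g D"
    (is "(THE c. \<exists>f. ?P f \<and> f 0 = c) = _")
proof -
  define f where "f i = (-1) ^ i * g (D - i)" for i
  have "binom_poly (\<lambda>j. (-1) ^ (D - j) * f (D - j)) D n = binom_poly g D n" for n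
    unfolding binom_poly_def f_def by (rule sum.cong) (auto simp flip: power_add mult.assoc)
  then have "?P f" unfolding alternating_eq_binom_poly using assms by simp
  moreover have "f 0 = g D" by (simp add: f_def)
  moreover have "f' 0 = g D" if "?P f'" for f'
  proof -
    have "\<forall>\<^sub>F n in sequentially. binom_poly (\<lambda>j. (-1) ^ (D - j) * f' (D - j)) D n = binom_poly g D n"
      using that[unfolded alternating_eq_binom_poly] assms by eventually_elim auto
    from binom_poly_eq_imp_lead_eq[OF this] show ?thesis by simp
  qed
  ultimately show ?thesis by (intro the_equality) blast+
qed

lemma fiber_multiplicity_eqI:
  assumes "\<forall>\<^sub>F n in sequentially. \<exists>k::nat.
      quot_length R (ideal_pow R I n) (ideal_prod R \<mm> (ideal_pow R I n)) = enat k \<and> int k = binom_poly g l n"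
  shows "fiber_multiplicity R \<mm> (Suc l) I = g l"
  using the_leading_coeff[OF assms]
  by (simp add: fiber_multiplicity_def fiber_coeffs_def lessThan_Suc_atMost)

text \<open>At \<open>Suc n\<close> the binomials with \<open>n + d - 1 - i\<close> on top turn into
  those with \<open>n + d - i\<close>; hence the shifted hypothesis.\<close>

lemma hilbert_samuel_multiplicity_eqI:
  assumes "\<forall>\<^sub>F n in sequentially. \<exists>k::nat.
      quot_length R (carrier R) (ideal_pow R I (Suc n)) = enat k \<and> int k = binom_poly g d n"
  shows "hilbert_samuel_multiplicity R d I = g d"
proof -
  have "hilbert_samuel_coeffs R d I f \<longleftrightarrow> (\<forall>\<^sub>F n in sequentially. \<exists>k::nat.
      quot_length R (carrier R) (ideal_pow R I (Suc n)) = enat k \<and>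
      int k = (\<Sum>i\<le>d. (-1) ^ i * f i * int ((n + d - i) choose (d - i))))" for f
    unfolding hilbert_samuel_coeffs_def
    by (subst eventually_sequentially_Suc[symmetric]) (simp del: nat_pow_Suc)
  then show ?thesis unfolding hilbert_samuel_multiplicity_def using the_leading_coeff[OF assms] by simp
qed

lemma mixed_multiplicity_eqI:
  assumes "\<And>r s. N \<le> r \<Longrightarrow> N \<le> s \<Longrightarrow> \<exists>k::nat.
      quot_length R (carrier R) (ideal_prod R (ideal_pow R \<mm> r) (ideal_pow R I s)) = enat k \<and>
      int k = biv_poly e (Suc l) r s"
  shows "mixed_multiplicity R \<mm> (Suc l) I = e 1 l"
proof -
  have coeffs: "mixed_coeffs R \<mm> (Suc l) I f \<longleftrightarrow> (\<exists>N. \<forall>r\<ge>N. \<forall>s\<ge>N. \<exists>k::nat.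
      quot_length R (carrier R) (ideal_prod R (ideal_pow R \<mm> r) (ideal_pow R I s)) = enat k \<and>
      int k = biv_poly f (Suc l) r s)" for f
    unfolding mixed_coeffs_def biv_poly_eq_sum ..
  have "mixed_coeffs R \<mm> (Suc l) I e" unfolding coeffs using assms by blast
  moreover have "f 1 l = e 1 l" if f: "mixed_coeffs R \<mm> (Suc l) I f" for f
  proof -
    obtain M where M: "\<And>r s. M \<le> r \<Longrightarrow> M \<le> s \<Longrightarrow> \<exists>k::nat.
        quot_length R (carrier R) (ideal_prod R (ideal_pow R \<mm> r) (ideal_pow R I s)) = enat k \<and>
        int k = biv_poly f (Suc l) r s"
      using f[unfolded coeffs] by metis
    have "biv_poly f (Suc l) r s = biv_poly e (Suc l) r s" if "max M N \<le> r" "max M N \<le> s" for r s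
      using M[of r s] assms[of r s] that by auto
    then show ?thesis
      by (rule biv_poly_eq_imp_eq[where D = "Suc l" and N = "max M N"]) simp_all
  qed
  ultimately show ?thesis unfolding mixed_multiplicity_def diff_Suc_1 by (intro the_equality) blast+
qed

section \<open>Leading coefficients of the Hilbert functions\<close>

context superficial_data
begin

lemma U_1_sub: "U 1 n \<subseteq> U 0 n"
  unfolding U_1 U_0 using ideal_prod_inter[OF m_ideal I_pow] by blast

lemma x_U_sub: "(PIdl x) \<cdot> ideal_pow R I n \<subseteq> \<mm> \<cdot> ideal_pow R I n"
  by (intro ideal_prod_mono cgenideal_minimal[OF m_ideal x_m] order_refl)

lemma colen_x_pow_I:
  "open_ideal ((PIdl x) \<cdot> ideal_pow R I n <+> J l)"
  "int (colen ((PIdl x) \<cdot> ideal_pow R I n <+> J l)) = int c + b l 0 n"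
  using colen_reg_mult[OF J_ideal[of l] _ _ U_open, of x 0 n] reg_x open_x
  by (simp_all add: c_def b_def J_l U_0)

lemma fiber_nonneg: "b i 0 n \<le> b i 1 n"
  unfolding b_def of_nat_le_iff
  by (rule colen_antimono[OF UJ_open open_ideal_ideal[OF UJ_open] set_add_mono[OF U_1_sub order_refl]])

lemma fiber_top_le: "b l 1 n - b l 0 n \<le> int c"
proof -
  have "(PIdl x) \<cdot> ideal_pow R I n <+> J l \<subseteq> U 1 n <+> J l"
    unfolding U_1 by (rule set_add_mono[OF x_U_sub order_refl])
  from colen_antimono[OF colen_x_pow_I(1) open_ideal_ideal[OF UJ_open] this]
  have "b l 1 n \<le> int (colen ((PIdl x) \<cdot> ideal_pow R I n <+> J l))" by (simp add: b_def)
  then show ?thesis using colen_x_pow_I(2)[of n] by simp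
qed

text \<open>The function has degree at most 1 and stays between 0 and \<open>c\<close>, the upper
  bound coming from \<open>x I^n \<subseteq> \<mm> I^n\<close>; boundedness removes the linear
  term.\<close>

lemma fiber_top_const: "\<exists>h. \<forall>\<^sub>F n in sequentially. b l 1 n - b l 0 n = h"
proof -
  have "ev_poly 1 (\<lambda>n. b l 1 n - b l 0 n)"
    using b_ev_poly(1)[of 0 1] b_ev_poly(1)[of 0 0] by (simp del: ev_poly.simps add: ev_poly_diff)
  moreover have "poly_growth 0 (\<lambda>n. b l 1 n - b l 0 n)"
  proof -
    have "\<bar>real_of_int (b l 1 n - b l 0 n)\<bar> \<le> real c * real (Suc n) ^ 0" for n
    proof -
      have "\<bar>b l 1 n - b l 0 n\<bar> \<le> int c" using fiber_top_le[of n] fiber_nonneg[of l n] by simp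
      then have "real_of_int \<bar>b l 1 n - b l 0 n\<bar> \<le> real_of_int (int c)" by (simp only: of_int_le_iff)
      then show ?thesis by simp
    qed
    then show ?thesis unfolding poly_growth_def by blast
  qed
  ultimately have "ev_poly 0 (\<lambda>n. b l 1 n - b l 0 n)" using ev_poly_reduce[of 0] by simp
  then show ?thesis by simp
qed

text \<open>Subtracting \<open>b_step\<close> at \<open>r = 0\<close> from \<open>b_step\<close> at
  \<open>r = 1\<close> shows that the fiber function obeys the same recursion, so summation carries
  \<open>h\<close> up as leading coefficient.\<close>

lemma fiber_poly:
  assumes h: "\<forall>\<^sub>F n in sequentially. b l 1 n - b l 0 n = h" and "i \<le> l"
  shows "\<exists>f. (\<forall>\<^sub>F n in sequentially. b (l - i) 1 n - b (l - i) 0 n = binom_poly f i n) \<and> f i = h"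
  using assms(2)
proof (induction i)
  case 0
  show ?case using h by (intro exI[of _ "\<lambda>_. h"]) (simp add: binom_poly_def)
next
  case (Suc i)
  obtain f where f: "\<forall>\<^sub>F n in sequentially. b (l - i) 1 n - b (l - i) 0 n = binom_poly f i n" "f i = h"
    using Suc by auto
  obtain N where N: "\<And>r s. N \<le> s \<Longrightarrow> b (l - Suc i) r (Suc s) - b (l - Suc i) r s = b (l - i) r (Suc s)"
    using b_step_down[OF Suc.prems] by blast
  let ?H = "\<lambda>n. b (l - Suc i) 1 n - b (l - Suc i) 0 n"
  have "\<forall>\<^sub>F n in sequentially. ?H (Suc n) - ?H n = binom_poly f i (Suc n)"
    using eventually_ge_at_top[of N] f(1)[folded eventually_sequentially_Suc[of "\<lambda>n. b (l - i) 1 n - b (l - i) 0 n = binom_poly f i n"]]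
  proof eventually_elim
    case (elim n)
    have "b (l - Suc i) 1 (Suc n) - b (l - Suc i) 1 n = b (l - i) 1 (Suc n)"
      "b (l - Suc i) 0 (Suc n) - b (l - Suc i) 0 n = b (l - i) 0 (Suc n)"
      using N elim(1) by auto
    then show ?case using elim(2) by linarith
  qed
  then obtain k where "\<forall>\<^sub>F n in sequentially. ?H n = binom_poly (case_nat k f) (Suc i) n"
    using binom_poly_antidiff[of ?H] by blast
  then show ?case using f(2) by (intro exI[of _ "case_nat k f"]) simp
qed

text \<open>Summation in \<open>s\<close> raises only the second index, so the slope
  \<open>c\<close> in \<open>r\<close>, found modulo \<open>J l\<close>, ends up as the coefficient
  with index \<open>(1, i)\<close>.\<close>

lemma mixed_poly:
  "i \<le> l \<Longrightarrow> \<exists>e N. (\<forall>r\<ge>N. \<forall>s\<ge>N. b (l - i) r s = biv_poly e (Suc i) r s) \<and> e 1 i = int c"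
proof (induction i)
  case 0
  obtain N where N: "\<And>r s. N \<le> r \<Longrightarrow> b l (Suc r) s = int c + b l r s" using b_top_r by blast
  obtain a where "\<forall>\<^sub>F s in sequentially. b l N s = binom_poly a 1 s"
    using ev_poly_imp_binom_poly[of 1] b_ev_poly(1)[of 0 N] by auto
  then obtain M where M: "\<And>s. M \<le> s \<Longrightarrow> b l N s = binom_poly a 1 s" by (auto simp: eventually_sequentially)
  have r: "b l r s = b l N s + (int r - int N) * int c" if "N \<le> r" for r s
    using that
  proof (induction r rule: dec_induct)
    case (step r)
    then show ?case using N[of r s] by (simp add: algebra_simps)
  qed simp
  \<comment> \<open>Rewrites \<open>a 0 + a 1 (s + 1) + (r - N) c\<close> in terms of
    \<open>r + 1\<close> and \<open>s + 1\<close>, the degree-one binomials; this accounts for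
    \<open>N + 1\<close> in the constant term.\<close>
  define e where "e i j = (if j = 1 then a 1 else if i = 1 then int c else a 0 - (int N + 1) * int c)" for i j :: nat
  have "b l r s = biv_poly e 1 r s" if "max M N \<le> r" "max M N \<le> s" for r s
    using r[of r s] M[of s] that
    by (simp add: biv_poly_def binom_poly_def e_def algebra_simps)
  moreover have "e 1 0 = int c" by (simp add: e_def)
  ultimately show ?case by (intro exI[of _ e] exI[of _ "max M N"]) simp
next
  case (Suc i)
  obtain e M where e: "\<And>r s. M \<le> r \<Longrightarrow> M \<le> s \<Longrightarrow> b (l - i) r s = biv_poly e (Suc i) r s" "e 1 i = int c"
    using Suc by auto
  obtain N where N: "\<And>r s. N \<le> s \<Longrightarrow> b (l - Suc i) r (Suc s) - b (l - Suc i) r s = b (l - i) r (Suc s)"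
    using b_step_down[OF Suc.prems] by blast
  obtain e' N' where e': "\<forall>r\<ge>N'. \<forall>s\<ge>N'. b (l - Suc i) r s = biv_poly e' (Suc (Suc i)) r s"
      "\<forall>i j. e' i (Suc j) = e i j"
  proof -
    have "b (l - Suc i) r (Suc s) - b (l - Suc i) r s = biv_poly e (Suc i) r (Suc s)"
      if "max M N \<le> r" "max M N \<le> s" for r s
      using that N e(1)[of r "Suc s"] by simp
    then show ?thesis using biv_poly_antidiff[of "max M N" "b (l - Suc i)" e "Suc i"] b_ev_poly(2)[OF Suc.prems] that
      by blast
  qed
  then show ?case using e(2) by (intro exI[of _ e'] exI[of _ N']) simp
qed

text \<open>If \<open>x \<in> I\<close>, then \<open>(x\<^sup>n) \<subseteq> I\<^sup>n \<subseteq> \<mm>\<^sup>n\<close>, and modulo \<open>(a\<^sub>1, \<dots>, a\<^sub>l)\<close> the colengths of the outer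
  two ideals are both \<open>n c\<close> up to a bounded error.\<close>

lemma hilbert_samuel_top:
  assumes "x \<in> I"
  shows "\<exists>\<kappa>. \<forall>\<^sub>F n in sequentially. b l 0 n = \<kappa> + int c * int n"
proof -
  obtain N where N: "\<And>r s. N \<le> r \<Longrightarrow> b l (Suc r) s = int c + b l r s" using b_top_r by blast
  \<comment> \<open>Iteration of \<open>b_top_r\<close> starts at \<open>N\<close> from a
    nonnegative value; below \<open>N\<close> the left side is not positive.\<close>
  have lower_m: "(int n - int N) * int c \<le> b l n 0" for n
  proof (cases "N \<le> n")
    case True
    then show ?thesis
    proof (induction n rule: dec_induct)
      case base
      show ?case by (simp add: b_def)
    next
      case (step n)
      then show ?case using N[of n 0] by (simp add: algebra_simps)
    qed
  next
    case False
    then have "(int n - int N) * int c \<le> 0" by (intro mult_nonpos_nonneg) auto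
    then show ?thesis by (simp add: b_def order_trans)
  qed
  have "b l n 0 \<le> b l 0 n" for n using b_le[of l n 0] by simp
  then have lower: "(int n - int N) * int c \<le> b l 0 n" for n using lower_m order_trans by blast
  have upper: "b l 0 n \<le> int n * int c" for n
  proof -
    have "ideal_pow R (PIdl x) n <+> J l \<subseteq> U 0 n <+> J l"
      unfolding U_0 by (intro set_add_mono ideal_pow_mono cgenideal_minimal[OF I_ideal assms] order_refl)
    from colen_antimono[OF x_pow_colen(1) open_ideal_ideal[OF UJ_open] this]
    have "colen (U 0 n <+> J l) \<le> n * c" unfolding x_pow_colen(2) .
    then show ?thesis unfolding b_def by (metis of_nat_le_iff of_nat_mult)
  qed
  \<comment> \<open>This deviation lies between \<open>- N c\<close> and 0. A polynomial of degree
    at most 1 that stays bounded is constant.\<close>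
  let ?g = "\<lambda>n. b l 0 n - int c * int n"
  have "ev_poly 1 (\<lambda>n. int n)"
    by (auto simp: forward_diff_def)
  then have "ev_poly 1 ?g"
    using b_ev_poly(1)[of 0 0] ev_poly_cmult[of 1 "\<lambda>n. int n" "int c"]
    by (simp del: ev_poly.simps add: ev_poly_diff)
  moreover have "poly_growth 0 ?g"
  proof -
    have "\<bar>real_of_int (?g n)\<bar> \<le> real (N * c) * real (Suc n) ^ 0" for n
    proof -
      have "\<bar>?g n\<bar> \<le> int (N * c)" using lower[of n] upper[of n] by (simp add: algebra_simps abs_le_iff)
      then have "real_of_int \<bar>?g n\<bar> \<le> real_of_int (int (N * c))" by (simp only: of_int_le_iff)
      then show ?thesis by simp
    qed
    then show ?thesis unfolding poly_growth_def by blast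
  qed
  ultimately have "ev_poly 0 ?g" using ev_poly_reduce[of 0] by simp
  then obtain \<kappa> where "\<forall>\<^sub>F n in sequentially. ?g n = \<kappa>" by auto
  then have "\<forall>\<^sub>F n in sequentially. b l 0 n = \<kappa> + int c * int n" by eventually_elim simp
  then show ?thesis by blast
qed

lemma hilbert_samuel_poly:
  assumes "x \<in> I"
  shows "i \<le> l \<Longrightarrow> \<exists>e. (\<forall>\<^sub>F n in sequentially. b (l - i) 0 (Suc n) = binom_poly e (Suc i) n) \<and> e (Suc i) = int c"
proof (induction i)
  case 0
  obtain \<kappa> where \<kappa>: "\<forall>\<^sub>F n in sequentially. b l 0 n = \<kappa> + int c * int n"
    using hilbert_samuel_top[OF assms] by blast
  then have "\<forall>\<^sub>F n in sequentially. b l 0 (Suc n) = \<kappa> + int c * int (Suc n)"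
    by (subst eventually_sequentially_Suc[of "\<lambda>n. b l 0 n = \<kappa> + int c * int n"])
  then have "\<forall>\<^sub>F n in sequentially. b l 0 (Suc n) = binom_poly (\<lambda>i. if i = 0 then \<kappa> else int c) 1 n"
    by eventually_elim (simp add: binom_poly_def algebra_simps)
  then show ?case by (intro exI[of _ "\<lambda>i. if i = 0 then \<kappa> else int c"]) simp
next
  case (Suc i)
  obtain e where e: "\<forall>\<^sub>F n in sequentially. b (l - i) 0 (Suc n) = binom_poly e (Suc i) n" "e (Suc i) = int c"
    using Suc by auto
  obtain N where N: "\<And>r s. N \<le> s \<Longrightarrow> b (l - Suc i) r (Suc s) - b (l - Suc i) r s = b (l - i) r (Suc s)"
    using b_step_down[OF Suc.prems] by blast
  let ?H = "\<lambda>n. b (l - Suc i) 0 (Suc n)"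
  have "\<forall>\<^sub>F n in sequentially. ?H (Suc n) - ?H n = binom_poly e (Suc i) (Suc n)"
    using eventually_ge_at_top[of N]
      e(1)[folded eventually_sequentially_Suc[of "\<lambda>n. b (l - i) 0 (Suc n) = binom_poly e (Suc i) n"]]
    by eventually_elim (use N in simp)
  then obtain k where "\<forall>\<^sub>F n in sequentially. ?H n = binom_poly (case_nat k e) (Suc (Suc i)) n"
    using binom_poly_antidiff[of ?H] by blast
  then show ?case using e(2) by (intro exI[of _ "case_nat k e"]) simp
qed

section \<open>From colengths back to module lengths\<close>

lemma colen_U: "int (colen (U r s)) = b 0 r s"
proof -
  have "U r s <+> {\<zero>} = U r s"
  proof
    show "U r s <+> {\<zero>} \<subseteq> U r s"
      by (rule set_add_least[OF U_ideal order_refl]) (simp add: ideal_simps(1)[OF U_ideal])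
    show "U r s \<subseteq> U r s <+> {\<zero>}" by (rule ideal_set_add_upper(1)[OF U_ideal zeroideal])
  qed
  then show ?thesis by (simp add: b_def J_0)
qed

lemma quot_length_carrier_U: "quot_length R (carrier R) (U r s) = enat (colen (U r s))"
  using quot_length_eq[OF oneideal U_ideal ideal_subset_carrier[OF U_ideal]] ideal_len_colen[OF U_open] by simp

lemma quot_length_fiber:
  "\<exists>k. quot_length R (ideal_pow R I n) (\<mm> \<cdot> ideal_pow R I n) = enat k \<and> int k = b 0 1 n - b 0 0 n"
proof -
  have "quot_length R (U 0 n) (U 1 n) = enat (colen (U 1 n) - colen (U 0 n))" "colen (U 0 n) \<le> colen (U 1 n)"
    using quot_length_eq[OF U_ideal U_ideal U_1_sub] ideal_len_colen_diff[OF U_open U_ideal U_1_sub] by auto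
  then show ?thesis
    unfolding U_1[symmetric] colen_U[symmetric] unfolding U_0(2)[symmetric]
    by (intro exI[of _ "colen (U 1 n) - colen (U 0 n)"] conjI) (simp_all only: of_nat_diff)
qed

text \<open>Superficiality rewrites the multiple of the new generator with a cofactor from
  \<open>U 1 (n - 1)\<close>, at the cost of a term in \<open>J i\<close>. The remainder falls into
  \<open>J i \<inter> U 1 n\<close>, where the induction hypothesis takes over.\<close>

lemma J_inter:
  "i \<le> l \<Longrightarrow> \<exists>N. \<forall>n\<ge>N. J i \<inter> U 1 n \<subseteq> J i \<cdot> U 1 (n - 1)"
proof (induction i)
  case 0
  have "{\<zero>} \<subseteq> J 0 \<cdot> U 1 n" for n
    using ideal_simps(1)[OF ideal_prod_is_ideal[OF J_ideal U_ideal]] by simp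
  then show ?case unfolding J_0 by blast
next
  case (Suc i)
  then have i: "i < l" by simp
  let ?a = "as ! i"
  obtain N where N: "\<And>s r y. N \<le> s \<Longrightarrow> y \<in> carrier R \<Longrightarrow> ?a \<otimes> y \<in> U r s <+> J i \<Longrightarrow> y \<in> U r (s - 1) <+> J i"
    using colon_as[OF i] unfolding U_def J_def by blast
  obtain M where M: "\<And>n. M \<le> n \<Longrightarrow> J i \<inter> U 1 n \<subseteq> J i \<cdot> U 1 (n - 1)" using Suc by auto
  have aI: "?a \<in> I" using as_I i by auto
  then have ac: "?a \<in> carrier R" using ideal_simps(2)[OF I_ideal] by blast
  have aJ: "?a \<in> J (Suc i)" unfolding J_Suc[OF i]
    using ideal_set_add_upper(1)[OF cgenideal_ideal[OF ac] J_ideal] cgenideal_self[OF ac] by blast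
  have JJ: "J i \<subseteq> J (Suc i)" unfolding J_Suc[OF i]
    by (rule ideal_set_add_upper(2)[OF cgenideal_ideal[OF ac] J_ideal])
  have "J (Suc i) \<inter> U 1 n \<subseteq> J (Suc i) \<cdot> U 1 (n - 1)" if n: "max (max M N) 1 \<le> n" for n
  proof
    fix y assume y: "y \<in> J (Suc i) \<inter> U 1 n"
    then obtain t j where tj: "t \<in> carrier R" "j \<in> J i" "y = t \<otimes> ?a \<oplus> j"
      unfolding J_Suc[OF i] by (auto simp: set_add_iff cgenideal_def)
    have jc: "j \<in> carrier R" using ideal_simps(2)[OF J_ideal tj(2)] .
    have yc: "y \<in> carrier R" using tj jc ac by simp
    have "?a \<otimes> t = y \<oplus> \<ominus> j" unfolding tj(3) using tj(1) jc ac by algebra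
    moreover have "\<ominus> j \<in> J i" using ideal_simps(4)[OF J_ideal tj(2)] .
    ultimately have "?a \<otimes> t \<in> U 1 n <+> J i" unfolding set_add_iff using y by blast
    then have "t \<in> U 1 (n - 1) <+> J i" using N[of n t 1] n tj(1) by simp
    then obtain w j' where wj: "w \<in> U 1 (n - 1)" "j' \<in> J i" "t = w \<oplus> j'" by (auto simp: set_add_iff)
    have car: "w \<in> carrier R" "j' \<in> carrier R"
      using wj ideal_simps(2)[OF U_ideal] ideal_simps(2)[OF J_ideal] by auto
    \<comment> \<open>This collects what is left of \<open>y\<close> after
      \<open>?a \<otimes> w\<close>: it is in \<open>J i\<close> by construction, and in
      \<open>U 1 n\<close> because \<open>y\<close> and \<open>?a \<otimes> w\<close> both
      are.\<close>
    define j'' where "j'' = ?a \<otimes> j' \<oplus> j"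
    have j''J: "j'' \<in> J i" unfolding j''_def
      using ideal_simps(3)[OF J_ideal ideal_simps(6)[OF J_ideal wj(2) ac] tj(2)] .
    have j''c: "j'' \<in> carrier R" using ideal_simps(2)[OF J_ideal j''J] .
    have y_eq: "y = ?a \<otimes> w \<oplus> j''" unfolding j''_def tj(3) wj(3) using car jc ac by algebra
    have "?a \<otimes> w \<in> U 1 n" using U_mult_I[OF aI wj(1)] n by simp
    moreover have "j'' = y \<ominus> ?a \<otimes> w" unfolding y_eq using car j''c ac by algebra
    ultimately have "j'' \<in> U 1 n" using y ideal_simps(5)[OF U_ideal] by simp
    then have "j'' \<in> J i \<cdot> U 1 (n - 1)" using M[of n] n j''J by auto
    then have "j'' \<in> J (Suc i) \<cdot> U 1 (n - 1)" using ideal_prod_mono[OF JJ order_refl] by blast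
    moreover have "?a \<otimes> w \<in> J (Suc i) \<cdot> U 1 (n - 1)" using aJ wj(1) by (rule ideal_prod.prod)
    ultimately show "y \<in> J (Suc i) \<cdot> U 1 (n - 1)" unfolding y_eq by (intro ideal_prod.sum)
  qed
  then show ?case by blast
qed

abbreviation limit_len :: "nat \<Rightarrow> enat" where
  "limit_len n \<equiv> quot_length R (\<mm> \<cdot> ideal_pow R I n)
     (((PIdl x) \<cdot> ideal_pow R I n) <+> ((Idl (set as)) \<cdot> \<mm> \<cdot> ideal_pow R I (n - 1)))"

text \<open>The second isomorphism theorem for \<open>\<mm> I^n\<close> and \<open>x I^n + J\<close>
  turns the length into a difference of two colengths, both already expressed through
  \<open>c\<close> and \<open>b l\<close>.\<close>

lemma quot_length_limit:
  "\<forall>\<^sub>F n in sequentially. \<exists>k. limit_len n = enat k \<and>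
     int k = int c - (b l 1 n - b l 0 n)"
proof -
  obtain N where N: "\<And>n. N \<le> n \<Longrightarrow> J l \<inter> U 1 n \<subseteq> J l \<cdot> U 1 (n - 1)" using J_inter[of l] by auto
  have main: "\<exists>k. limit_len n = enat k \<and>
     int k = int c - (b l 1 n - b l 0 n)" if n: "max N 1 \<le> n" for n
  proof -
    let ?X = "(PIdl x) \<cdot> ideal_pow R I n"
    let ?T = "?X <+> J l \<cdot> U 1 (n - 1)"
    let ?B = "?X <+> J l"
    have Xi: "ideal ?X R" by (rule ideal_prod_is_ideal[OF x_ideal I_pow])
    have JU: "ideal (J l \<cdot> U 1 (n - 1)) R" by (rule ideal_prod_is_ideal[OF J_ideal U_ideal])
    have Ti: "ideal ?T R" by (rule add_ideals[OF Xi JU])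
    have Bi: "ideal ?B R" by (rule add_ideals[OF Xi J_ideal])
    have XU: "?X \<subseteq> U 1 n" unfolding U_1 by (rule x_U_sub)
    have T_eq: "((PIdl x) \<cdot> ideal_pow R I n) <+> ((Idl (set as)) \<cdot> \<mm> \<cdot> ideal_pow R I (n - 1)) = ?T"
      unfolding U_1 J_l[symmetric] ideal_prod_assoc[OF J_ideal m_ideal I_pow] ..
    have JUU: "J l \<cdot> U 1 (n - 1) \<subseteq> U 1 n"
    proof (rule ideal_prod_least[OF U_ideal])
      fix a y assume "a \<in> J l" "y \<in> U 1 (n - 1)"
      moreover have "J l \<subseteq> I" unfolding J_l using as_I by (rule genideal_minimal[OF I_ideal])
      ultimately show "a \<otimes> y \<in> U 1 n" using U_mult_I[of a y 1 "n - 1"] n by auto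
    qed
    have TU: "?T \<subseteq> U 1 n" by (rule set_add_least[OF U_ideal XU JUU])
    \<comment> \<open>As \<open>?X \<subseteq> U 1 n\<close>, the modular law leaves
      \<open>?X + (J l \<inter> U 1 n)\<close>; \<open>J_inter\<close> replaces the intersection by
      the product.\<close>
    have inter: "U 1 n \<inter> ?B = ?T"
    proof
      show "U 1 n \<inter> ?B \<subseteq> ?T"
      proof
        fix y assume y: "y \<in> U 1 n \<inter> ?B"
        then obtain w j where wj: "w \<in> ?X" "j \<in> J l" "y = w \<oplus> j" by (auto simp: set_add_iff)
        have car: "w \<in> carrier R" "j \<in> carrier R"
          using wj ideal_simps(2)[OF Xi] ideal_simps(2)[OF J_ideal] by auto
        have "j = y \<ominus> w" unfolding wj(3) using car by algebra
        then have "j \<in> U 1 n" using ideal_simps(5)[OF U_ideal] y wj(1) XU by blast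
        then have "j \<in> J l \<cdot> U 1 (n - 1)" using N[of n] n wj(2) by auto
        then show "y \<in> ?T" unfolding set_add_iff using wj by blast
      qed
      have "?T \<subseteq> ?B" using ideal_prod_inter[OF J_ideal U_ideal] by (intro set_add_mono) auto
      then show "?T \<subseteq> U 1 n \<inter> ?B" using TU by blast
    qed
    have sum: "U 1 n <+> ?B = U 1 n <+> J l"
    proof
      have id: "ideal (U 1 n <+> J l) R" by (rule add_ideals[OF U_ideal J_ideal])
      note up = ideal_set_add_upper[OF U_ideal[of 1 n] J_ideal[of l]]
      show "U 1 n <+> ?B \<subseteq> U 1 n <+> J l"
        by (intro set_add_least[OF id] up) (use XU up in auto)
      show "U 1 n <+> J l \<subseteq> U 1 n <+> ?B"
        by (intro set_add_mono order_refl ideal_set_add_upper(2)[OF Xi J_ideal])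
    qed
    have BU: "?B \<subseteq> U 1 n <+> J l" by (rule set_add_mono[OF XU order_refl])
    have "quot_length R (U 1 n) ?T = ideal_len R (U 1 n) ?T" by (rule quot_length_eq[OF U_ideal Ti TU])
    also have "\<dots> = ideal_len R (U 1 n <+> J l) ?B"
      using ideal_len_second_iso[OF U_ideal[of 1 n] Bi] unfolding inter sum by simp
    also have "\<dots> = enat (colen ?B - colen (U 1 n <+> J l))"
      by (rule ideal_len_colen_diff(1)[OF colen_x_pow_I(1) open_ideal_ideal[OF UJ_open] BU])
    finally have "quot_length R (U 1 n) ?T = enat (colen ?B - colen (U 1 n <+> J l))" .
    moreover have "int (colen ?B - colen (U 1 n <+> J l)) = int c - (b l 1 n - b l 0 n)"
      using ideal_len_colen_diff(2)[OF colen_x_pow_I(1) open_ideal_ideal[OF UJ_open] BU]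
        colen_x_pow_I(2)[of n] by (simp add: of_nat_diff b_def)
    ultimately show ?thesis unfolding T_eq U_1[symmetric] by blast
  qed
  show ?thesis unfolding eventually_sequentially using main by (intro exI[of _ "max N 1"]) blast
qed

text \<open>With \<open>h\<close> the stable fiber length modulo \<open>J l\<close>, the fiber
  multiplicity is \<open>h\<close>, the other multiplicities are \<open>c\<close>, and the limit is
  \<open>c - h\<close>.\<close>

theorem multiplicities:
  "\<exists>L::nat. limit_len \<longlonglongrightarrow> enat L \<and>
     fiber_multiplicity R \<mm> (Suc l) I = mixed_multiplicity R \<mm> (Suc l) I - int L \<and>
     (x \<in> I \<longrightarrow> fiber_multiplicity R \<mm> (Suc l) I = hilbert_samuel_multiplicity R (Suc l) I - int L)"
proof -
  obtain h where h: "\<forall>\<^sub>F n in sequentially. b l 1 n - b l 0 n = h" using fiber_top_const by blast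
  \<comment> \<open>Since \<open>h\<close> is an actual value, \<open>fiber_top_le\<close> bounds it
    by \<open>c\<close>; hence \<open>nat (int c - h)\<close> truncates nothing.\<close>
  then obtain n where "b l 1 n - b l 0 n = h" by (auto simp: eventually_sequentially)
  then have hc: "h \<le> int c" using fiber_top_le[of n] by simp
  obtain f where f: "\<forall>\<^sub>F n in sequentially. b 0 1 n - b 0 0 n = binom_poly f l n" "f l = h"
    using fiber_poly[OF h order_refl] by auto
  have "\<forall>\<^sub>F n in sequentially. \<exists>k. quot_length R (ideal_pow R I n) (\<mm> \<cdot> ideal_pow R I n) = enat k \<and>
      int k = binom_poly f l n"
    using f(1)
  proof eventually_elim
    case (elim n)
    then show ?case using quot_length_fiber[of n] by simp
  qed
  from fiber_multiplicity_eqI[OF this] have fib: "fiber_multiplicity R \<mm> (Suc l) I = h" unfolding f(2) .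
  obtain e N where e: "\<forall>r\<ge>N. \<forall>s\<ge>N. b 0 r s = biv_poly e (Suc l) r s" "e 1 l = int c"
    using mixed_poly[OF order_refl] by auto
  have "\<exists>k. quot_length R (carrier R) (ideal_pow R \<mm> r \<cdot> ideal_pow R I s) = enat k \<and>
      int k = biv_poly e (Suc l) r s" if "N \<le> r" "N \<le> s" for r s
    using quot_length_carrier_U[of r s] colen_U[of r s] e(1) that unfolding U_def by simp
  from mixed_multiplicity_eqI[of N, OF this] have mix: "mixed_multiplicity R \<mm> (Suc l) I = int c"
    unfolding e(2) .
  have hs: "hilbert_samuel_multiplicity R (Suc l) I = int c" if xI: "x \<in> I"
  proof -
    obtain g where g: "\<forall>\<^sub>F n in sequentially. b 0 0 (Suc n) = binom_poly g (Suc l) n" "g (Suc l) = int c"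
      using hilbert_samuel_poly[OF xI order_refl] by auto
    have "\<forall>\<^sub>F n in sequentially. \<exists>k. quot_length R (carrier R) (ideal_pow R I (Suc n)) = enat k \<and>
        int k = binom_poly g (Suc l) n"
      using g(1)
    proof eventually_elim
      case (elim n)
      have "quot_length R (carrier R) (ideal_pow R I (Suc n)) = enat (colen (ideal_pow R I (Suc n)))"
        by (rule quot_length_carrier_U[of 0 "Suc n", unfolded U_0])
      moreover have "int (colen (ideal_pow R I (Suc n))) = binom_poly g (Suc l) n"
        using colen_U[of 0 "Suc n", unfolded U_0] elim by (rule trans)
      ultimately show ?case by blast
    qed
    from hilbert_samuel_multiplicity_eqI[OF this] show ?thesis unfolding g(2) .
  qed
  have "\<forall>\<^sub>F n in sequentially. limit_len n = enat (nat (int c - h))"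
    using quot_length_limit h
  proof eventually_elim
    case (elim n)
    then obtain k where k: "limit_len n = enat k"
      "int k = int c - h" by auto
    then have "nat (int c - h) = k" by simp
    then show ?case using k(1) by simp
  qed
  then have "limit_len \<longlonglongrightarrow> enat (nat (int c - h))"
    by (rule tendsto_eventually)
  then show ?thesis using fib mix hs hc by (intro exI[of _ "nat (int c - h)"]) simp
qed

end

text \<open>The radical condition makes \<open>I\<close> open because \<open>\<mm>\<close> is
  finitely generated, and the length of the regular sequence, being the dimension, makes
  \<open>(x) + J\<close> open.\<close>

lemma (in noetherian_local_ring) superficial_dataI:
  assumes dim: "krull_dim R = enat d" and prim: "primary_to R \<mm> I" and len: "d = Suc (length as)"
    and as: "set as \<subseteq> I" and x: "x \<in> \<mm>" and reg: "regular_sequence R (as @ [x])"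
    and sup: "rees_superficial_sequence R (as @ [x]) (replicate (length as) I @ [\<mm>])"
  shows "superficial_data R \<mm> I as x"
proof -
  have I: "ideal I R" using prim by (simp add: primary_to_def primary_ideal_def)
  have rad: "ideal_radical R I = \<mm>" using prim by (simp add: primary_to_def)
  have Im: "I \<subseteq> \<mm>"
  proof
    fix y assume y: "y \<in> I"
    then have "y \<in> carrier R" using ideal_simps(2)[OF I] by blast
    then have "y [^] (1::nat) \<in> I" using y by simp
    then have "y \<in> ideal_radical R I" unfolding ideal_radical_def using \<open>y \<in> carrier R\<close> by blast
    then show "y \<in> \<mm>" using rad by simp
  qed
  have openI: "open_ideal I"
  proof -
    obtain zs where zs: "set zs \<subseteq> carrier R" "\<mm> = Idl (set zs)"
      using ideal_list_generated[OF m_ideal] by blast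
    have "\<exists>n::nat. z [^] n \<in> I" if "z \<in> set zs" for z
    proof -
      have "z \<in> \<mm>" using genideal_self[OF zs(1)] zs(2) that by blast
      then show ?thesis using rad by (auto simp: ideal_radical_def)
    qed
    then show ?thesis using ideal_pow_subset_of_nilpotent[OF I zs(1)] I
      unfolding open_ideal_def zs(2)[symmetric] by blast
  qed
  have car: "set (as @ [x]) \<subseteq> carrier R"
    using as x ideal_subset_carrier[OF I] ideal_subset_carrier[OF m_ideal] by auto
  have carT: "set (take i as) \<subseteq> carrier R" for i using car set_take_subset[of i as] by auto
  have Ji: "ideal (Idl (set (take i as))) R" for i using carT by (rule genideal_ideal)
  have reg_as: "reg_mod (Idl (set (take i as))) (as ! i)" if "i < length as" for i
    using regular_sequence_reg_mod[OF reg, of i] that by (simp add: nth_append)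
  have reg_x: "reg_mod (Idl (set as)) x"
    using regular_sequence_reg_mod[OF reg, of "length as"] by simp
  have sup_i: "rees_superficial (R Quot Idl (set (take i (as @ [x])))) (Idl (set (take i (as @ [x]))) +> (as @ [x]) ! i)
      (map (\<lambda>K. (\<lambda>y. Idl (set (take i (as @ [x]))) +> y) ` K) (drop i (replicate (length as) I @ [\<mm>])))"
    if "i < Suc (length as)" for i
    using sup that unfolding rees_superficial_sequence_def Let_def by auto
  show ?thesis
  proof (intro superficial_data.intro superficial_data_axioms.intro)
    show "noetherian_local_ring R \<mm>" by (rule noetherian_local_ring_axioms)
    fix i assume i: "i < length as"
    \<comment> \<open>For \<open>i\<close> below \<open>length as\<close> at least one copy of
      \<open>I\<close> remains in the dropped list, so the distinguished first ideal is
      \<open>I\<close> and not \<open>\<mm>\<close>.\<close>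
    then obtain q where q: "length as - i = Suc q" by (metis Suc_diff_Suc)
    have "rees_superficial (R Quot Idl (set (take i as))) (Idl (set (take i as)) +> as ! i)
      (map (\<lambda>K. (\<lambda>y. Idl (set (take i as)) +> y) ` K) (replicate (Suc q) I @ [\<mm>]))"
      using sup_i[of i] i q by (simp add: nth_append)
    from rees_superficial_colon[OF Ji I m_ideal reg_as[OF i] this]
    show "\<exists>N. \<forall>s\<ge>N. \<forall>r. \<forall>y\<in>carrier R.
      as ! i \<otimes> y \<in> (ideal_pow R \<mm> r \<cdot> ideal_pow R I s) <+> Idl (set (take i as)) \<longrightarrow>
      y \<in> (ideal_pow R \<mm> r \<cdot> ideal_pow R I (s - 1)) <+> Idl (set (take i as))" .
  next
    have "rees_superficial (R Quot Idl (set as)) (Idl (set as) +> x) [(\<lambda>y. Idl (set as) +> y) ` \<mm>]"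
      using sup_i[of "length as"] by simp
    from rees_superficial_colon_single[OF _ m_ideal reg_x this] Ji[of "length as"]
    show "\<exists>N. \<forall>n\<ge>N. \<forall>y\<in>carrier R. x \<otimes> y \<in> ideal_pow R \<mm> n <+> Idl (set as) \<longrightarrow>
      y \<in> ideal_pow R \<mm> (n - 1) <+> Idl (set as)" by simp
  next
    have xc: "x \<in> carrier R" using car by simp
    have ac: "set as \<subseteq> carrier R" using car by simp
    have "Idl (set (as @ [x])) = Idl (set as) <+> PIdl x"
      using genideal_insert_eq[OF ac xc] by simp
    also have "\<dots> = PIdl x <+> Idl (set as)"
      using ideal_subset_carrier[OF cgenideal_ideal[OF xc]] ideal_subset_carrier[OF genideal_ideal[OF ac]]
      by (intro set_add_comm)
    finally have eq: "Idl (set (as @ [x])) = PIdl x <+> Idl (set as)" .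
    have "\<exists>k. ideal_pow R \<mm> k \<subseteq> Idl (set (as @ [x]))"
      by (rule regular_sequence_open[OF car regular_sequence_reg_mod[OF reg]]) (use dim len in auto)
    then show "open_ideal (PIdl x <+> Idl (set as))"
      unfolding eq open_ideal_def using add_ideals[OF cgenideal_ideal[OF xc] genideal_ideal[OF ac]] by blast
  qed (use openI Im as x reg_as reg_x in auto)
qed

theorem theorem2p9:
  fixes R :: "('a, 'b) ring_scheme" (structure)
    and \<mm> I :: "'a set" and d :: nat
  assumes "cohen_macaulay_local_ring R \<mm>"
    and "krull_dim R = enat d" and "d > 0"
    and "primary_to R \<mm> I"
  shows
    "(\<forall>as x. length as = d - 1 \<longrightarrow> set as \<subseteq> I \<longrightarrow> x \<in> \<mm> \<longrightarrow>
        regular_sequence R (as @ [x]) \<longrightarrow>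
        rees_superficial_sequence R (as @ [x]) (replicate (d - 1) I @ [\<mm>]) \<longrightarrow>
        (\<exists>L::nat.
          (\<lambda>n. quot_length R (\<mm> \<cdot> ideal_pow R I n)
                 (((PIdl x) \<cdot> ideal_pow R I n) <+> ((Idl (set as)) \<cdot> \<mm> \<cdot> ideal_pow R I (n - 1))))
            \<longlonglongrightarrow> enat L \<and>
          fiber_multiplicity R \<mm> d I = mixed_multiplicity R \<mm> d I - int L)) \<and>
     (\<forall>as b. length as = d - 1 \<longrightarrow> set as \<subseteq> I \<longrightarrow> b \<in> I \<longrightarrow>
        regular_sequence R (as @ [b]) \<longrightarrow>
        rees_superficial_sequence R (as @ [b]) (replicate (d - 1) I @ [\<mm>]) \<longrightarrow>
        (\<exists>L::nat.
          (\<lambda>n. quot_length R (\<mm> \<cdot> ideal_pow R I n)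
                 (((PIdl b) \<cdot> ideal_pow R I n) <+> ((Idl (set as)) \<cdot> \<mm> \<cdot> ideal_pow R I (n - 1))))
            \<longlonglongrightarrow> enat L \<and>
          fiber_multiplicity R \<mm> d I = hilbert_samuel_multiplicity R d I - int L))"
proof -
  interpret noetherian_local_ring R \<mm>
    using assms(1) by (simp add: cohen_macaulay_local_ring_def)
  have data: "superficial_data R \<mm> I as x" and d: "d = Suc (length as)"
    if "length as = d - 1" "set as \<subseteq> I" "x \<in> \<mm>" "regular_sequence R (as @ [x])"
      "rees_superficial_sequence R (as @ [x]) (replicate (d - 1) I @ [\<mm>])" for as x
  proof -
    show d: "d = Suc (length as)" using that(1) assms(3) by simp
    then have len: "length as = d - 1" by simp
    show "superficial_data R \<mm> I as x"
      by (rule superficial_dataI[OF assms(2,4) d that(2-4)]) (use that(5) len in simp)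
  qed
  have Im: "I \<subseteq> \<mm>"
  proof -
    have "ideal I R" "I \<noteq> carrier R" using assms(4) by (auto simp: primary_to_def primary_ideal_def)
    then show ?thesis by (rule proper_ideal_subset_m)
  qed
  show ?thesis
  proof (intro conjI allI impI)
    fix as x
    assume "length as = d - 1" "set as \<subseteq> I" "x \<in> \<mm>" "regular_sequence R (as @ [x])"
      "rees_superficial_sequence R (as @ [x]) (replicate (d - 1) I @ [\<mm>])"
    from superficial_data.multiplicities[OF data[OF this], folded d[OF this]]
    show "\<exists>L::nat. (\<lambda>n. quot_length R (\<mm> \<cdot> ideal_pow R I n)
                 (((PIdl x) \<cdot> ideal_pow R I n) <+> ((Idl (set as)) \<cdot> \<mm> \<cdot> ideal_pow R I (n - 1))))
            \<longlonglongrightarrow> enat L \<and>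
          fiber_multiplicity R \<mm> d I = mixed_multiplicity R \<mm> d I - int L"
      by blast
  next
    fix as b
    assume *: "length as = d - 1" "set as \<subseteq> I" "b \<in> I" "regular_sequence R (as @ [b])"
      "rees_superficial_sequence R (as @ [b]) (replicate (d - 1) I @ [\<mm>])"
    \<comment> \<open>The last element plays the part of \<open>x\<close>, which is admissible
      because \<open>I \<subseteq> \<mm>\<close>; its membership in \<open>I\<close> yields the
      Hilbert-Samuel clause.\<close>
    then have "b \<in> \<mm>" using Im by blast
    from superficial_data.multiplicities[OF data[OF *(1,2) this *(4,5)], folded d[OF *(1,2) this *(4,5)]] *(3)
    show "\<exists>L::nat. (\<lambda>n. quot_length R (\<mm> \<cdot> ideal_pow R I n)
                 (((PIdl b) \<cdot> ideal_pow R I n) <+> ((Idl (set as)) \<cdot> \<mm> \<cdot> ideal_pow R I (n - 1))))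
            \<longlonglongrightarrow> enat L \<and>
          fiber_multiplicity R \<mm> d I = hilbert_samuel_multiplicity R d I - int L"
      by blast
  qed
qed

end
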